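(* Let $p\ge 2$, $T>0$, $\Delta t_0>0$, let $a\in\mathbb R$ with $a>1$, and let $b,\sigma,R,\rho_0$ satisfy the following assumption: there exist constants $L_b,L_\sigma,L_R$ such that for all $x,x'\in\mathbb R^d$ and $y,y'\in\mathbb R^{d_R}$, $|b(x,y)-b(x',y')|\le L_b(|x-x'|+|y-y'|)$, $|\sigma(x,y)-\sigma(x',y')|\le L_\sigma(|x-x'|+|y-y'|)$, $|R(x)-R(x')|\le L_R|x-x'|$, and $\mathbb E[|X_0|^p]<\infty$ for $X_0\sim\rho_0$. Consider any $q>1$ and any $\epsilon$ with $a^{-1/2}\ge\epsilon>0$, and choose $$L=\lfloor 2\log_a(\epsilon^{-1})\rfloor,\qquad J_\ell=\lfloor C_J\,q^{2(L-\ell)}a^{L-\ell}\rfloor\quad(0\le\ell\le L),$$ with $C_J\ge 1$. Let $X_n^{\ell,j},\widetilde X_n^{\ell,j}$ be the particles of the multilevel scheme with these parameters, and let $\bar X_n^{\ell,j},\bar{\widetilde X}{}_n^{\ell,j}$ be the corresponding mean-field particles (all defined in the context). Define (the values do not depend on the particle index $j$, which is omitted) $$e_n^\ell:=\mathbb E\Big[\max_{m\le n}|X_m^{\ell}-\bar X_m^{\ell}|^p\Big]\ (0\le\ell\le L),\qquad \tilde e_n^\ell:=\mathbb E\Big[\max_{m\le n}|\widetilde X_m^{\ell}-\bar{\widetilde X}{}_m^{\ell}|^p\Big]\ (1\le\ell\le L),$$ $\tilde e_n^{L+1}:=0$, and $E_n^\ell:=\max(e_n^\ell,\tilde e_n^{\ell+1})$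 for $0\le\ell\le L$. Then there is a constant $C$, independent of $L$, $n$, $\ell$ and $\epsilon$, such that for every $0\le\ell\le L$ and every integer $n\ge0$ with $n\Delta t_\ell\le T$, $$(E_n^\ell)^{1/p}\le C\,\epsilon/q^{L-\ell}.$$
   Context: Setting: $b$, $\sigma$, $R$ are functions with $b:\mathbb R^d\times\mathbb R^{d_R}\to\mathbb R^d$, $\sigma$ matrix-valued on $\mathbb R^d\times\mathbb R^{d_R}$ (with $d$ rows), $R:\mathbb R^d\to\mathbb R^{d_R}$, and $\rho_0$ is a probability distribution on $\mathbb R^d$. They are the data of the McKean--Vlasov SDE $dX_t=b(X_t,\mathbb E[R(X_t)])\,dt+\sigma(X_t,\mathbb E[R(X_t)])\,dW_t$, $X_0\sim\rho_0$. $|\cdot|$ is the Euclidean norm on vectors and the Frobenius norm on matrices. Timesteps: $\Delta t_\ell=a^{-\ell}\Delta t_0$, so $\Delta t_{\ell-1}=a\,\Delta t_\ell$. Randomness: for each level $\ell\in\{0,\dots,L\}$ and each $j\in\{1,\dots,J_\ell\}$ there is an initial value $X_0^{\ell,j}\sim\rho_0$ and a standard Brownian motion $W^{\ell,j}$ independent of it; the pairs $(X_0^{\ell,j},W^{\ell,j})$ are mutually independent over all $(\ell,j)$. Set $\Delta W_n^{\ell,j}=W^{\ell,j}_{(n+1)\Delta t_\ell}-W^{\ell,j}_{n\Delta t_\ell}$ and, for $\ell\ge1$, $\Delta\widetilde W_n^{\ell,j}=W^{\ell,j}_{(n+1)\Delta t_{\ell-1}}-W^{\ell,j}_{n\Delta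 t_{\ell-1}}$. Ensembles: $\mathbf x_n^\ell=\{X_n^{\ell,j}\}_{j=1}^{J_\ell}$ for $0\le\ell\le L$ and $\widetilde{\mathbf x}_n^\ell=\{\widetilde X_n^{\ell,j}\}_{j=1}^{J_\ell}$ for $1\le\ell\le L$. For a finite ensemble $\mathbf x$, $E_R(\mathbf x)=\frac1{|\mathbf x|}\sum_{x\in\mathbf x}R(x)$. The multilevel interaction estimate is $$E_R^{\mathrm{ML}}(\mathbf x_n^{\mathrm{ML},\ell})=E_R\big(\mathbf x^0_{\lfloor n/a^\ell\rfloor}\big)+\sum_{\ell'=1}^{\ell}\Big(E_R\big(\mathbf x^{\ell'}_{\lfloor n/a^{\ell-\ell'}\rfloor}\big)-E_R\big(\widetilde{\mathbf x}^{\ell'}_{\lfloor n/a^{\ell-\ell'+1}\rfloor}\big)\Big).$$ Multilevel scheme: for $0\le\ell\le L$, $$X_{n+1}^{\ell,j}=X_n^{\ell,j}+b\big(X_n^{\ell,j},E_R^{\mathrm{ML}}(\mathbf x_n^{\mathrm{ML},\ell})\big)\Delta t_\ell+\sigma\big(X_n^{\ell,j},E_R^{\mathrm{ML}}(\mathbf x_n^{\mathrm{ML},\ell})\big)\Delta W_n^{\ell,j}$$ (for $\ell=0$ the interaction term is just $E_R(\mathbf x_n^0)$), and for $1\le\ell\le L$, with $\widetilde X_0^{\ell,j}=X_0^{\ell,j}$, $$\widetilde X_{n+1}^{\ell,j}=\widetilde X_n^{\ell,j}+b\big(\widetilde X_n^{\ell,j},E_R^{\mathrm{ML}}(\mathbf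 x_n^{\mathrm{ML},\ell-1})\big)\Delta t_{\ell-1}+\sigma\big(\widetilde X_n^{\ell,j},E_R^{\mathrm{ML}}(\mathbf x_n^{\mathrm{ML},\ell-1})\big)\Delta\widetilde W_n^{\ell,j}.$$ The scheme is run on the time interval $[0,T]$. Mean-field particles: $\bar X_0^{\ell,j}=X_0^{\ell,j}$ and $$\bar X_{n+1}^{\ell,j}=\bar X_n^{\ell,j}+b(\bar X_n^{\ell,j},\mathbb E[R(\bar X_n^{\ell,j})])\Delta t_\ell+\sigma(\bar X_n^{\ell,j},\mathbb E[R(\bar X_n^{\ell,j})])\Delta W_n^{\ell,j},$$ and, for $\ell\ge1$, $\bar{\widetilde X}{}_0^{\ell,j}=\widetilde X_0^{\ell,j}$ and $$\bar{\widetilde X}{}_{n+1}^{\ell,j}=\bar{\widetilde X}{}_n^{\ell,j}+b(\bar{\widetilde X}{}_n^{\ell,j},\mathbb E[R(\bar{\widetilde X}{}_n^{\ell,j})])\Delta t_{\ell-1}+\sigma(\bar{\widetilde X}{}_n^{\ell,j},\mathbb E[R(\bar{\widetilde X}{}_n^{\ell,j})])\Delta\widetilde W_n^{\ell,j}.$$ The quantities $p,b,\sigma,R,\rho_0,T,a,\Delta t_0,q,C_J$ are regarded as fixed; the constant $C$ may depend on them. *)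

theory Defs
  imports "HOL-Probability.Probability"
begin

text \<open>
  Vectors are elements of \<open>real ^ 'd\<close> and matrices elements of \<open>real ^ 'm ^ 'd\<close> (\<open>'d\<close> rows,
  \<open>'m\<close> columns).  On the latter type \<open>norm\<close> is the Frobenius norm.
  A process is a function of time and of the sample point, in this order; only its values at
  times \<open>t \<ge> 0\<close> matter.
\<close>

subsection \<open>Brownian motion\<close>

text \<open>
  The density below is that of the Gaussian law with mean zero and covariance matrix
  \<open>(t - s)\<close> times the identity.
\<close>

definition std_brownian_motion :: "'w measure \<Rightarrow> (real \<Rightarrow> 'w \<Rightarrow> real ^ 'm) \<Rightarrow> bool" where
  "std_brownian_motion M W \<longleftrightarrow>
     (\<forall>t\<ge>0. W t \<in> borel_measurable M) \<and>
     (AE \<omega> in M. W 0 \<omega> = 0) \<and>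
     (AE \<omega> in M. continuous_on {0..} (\<lambda>t. W t \<omega>)) \<and>
     (\<forall>s t. 0 \<le> s \<and> s < t \<longrightarrow>
        distributed M lborel (\<lambda>\<omega>. W t \<omega> - W s \<omega>)
          (\<lambda>x. ennreal (\<Prod>i\<in>UNIV. normal_density 0 (sqrt (t - s)) (x $ i)))) \<and>
     (\<forall>(\<tau> :: nat \<Rightarrow> real) k. 0 \<le> \<tau> 0 \<and> incseq \<tau> \<longrightarrow>
        prob_space.indep_vars M (\<lambda>_. borel) (\<lambda>i \<omega>. W (\<tau> (Suc i)) \<omega> - W (\<tau> i) \<omega>) {..<k})"

definition path_space :: "(real \<Rightarrow> real ^ 'm) measure" where
  "path_space = Pi\<^sub>M {0..} (\<lambda>_. borel)"

definition path_of :: "(real \<Rightarrow> 'w \<Rightarrow> real ^ 'm) \<Rightarrow> 'w \<Rightarrow> real \<Rightarrow> real ^ 'm" where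
  "path_of W \<omega> = restrict (\<lambda>t. W t \<omega>) {0..}"

text \<open>
  Particles are indexed by a level \<open>l\<close> and a number \<open>j\<close>.  Independence of an initial value and
  its Brownian motion is stated for the generated sigma-algebras, since
  \<^const>\<open>prob_space.indep_var\<close> requires the two variables to have values in the same type.
\<close>

definition driving_noise ::
  "'w measure \<Rightarrow> (real ^ 'd) measure \<Rightarrow> (nat \<times> nat) set \<Rightarrow>
   (nat \<Rightarrow> nat \<Rightarrow> 'w \<Rightarrow> real ^ 'd) \<Rightarrow> (nat \<Rightarrow> nat \<Rightarrow> real \<Rightarrow> 'w \<Rightarrow> real ^ 'm) \<Rightarrow> bool" where
  "driving_noise M \<rho>0 I \<xi> W \<longleftrightarrow>
     (\<forall>(l, j)\<in>I.
        \<xi> l j \<in> borel_measurable M \<and> distr M borel (\<xi> l j) = \<rho>0 \<and>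
        std_brownian_motion M (W l j) \<and>
        prob_space.indep_set M
          (sets (vimage_algebra (space M) (\<xi> l j) borel))
          (sets (vimage_algebra (space M) (path_of (W l j)) path_space))) \<and>
     prob_space.indep_vars M (\<lambda>_. borel \<Otimes>\<^sub>M path_space)
       (\<lambda>(l, j) \<omega>. (\<xi> l j \<omega>, path_of (W l j) \<omega>)) I"

subsection \<open>Parameters of the multilevel method\<close>

definition time_step :: "real \<Rightarrow> real \<Rightarrow> nat \<Rightarrow> real" where
  "time_step a dt0 l = dt0 / a ^ l"

definition num_levels :: "real \<Rightarrow> real \<Rightarrow> nat" where
  "num_levels a \<epsilon> = nat \<lfloor>2 * log a (1 / \<epsilon>)\<rfloor>"

definition num_samples :: "real \<Rightarrow> real \<Rightarrow> real \<Rightarrow> nat \<Rightarrow> nat \<Rightarrow> nat" where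
  "num_samples C\<^sub>J q a L l = nat \<lfloor>C\<^sub>J * q ^ (2 * (L - l)) * a ^ (L - l)\<rfloor>"

subsection \<open>The multilevel scheme\<close>

text \<open>An ensemble of size \<open>J\<close> is the family \<open>x 1, \<dots>, x J\<close>, counted with repetitions.\<close>

definition ens_mean :: "('x \<Rightarrow> real ^ 'r) \<Rightarrow> nat \<Rightarrow> (nat \<Rightarrow> 'x) \<Rightarrow> real ^ 'r" where
  "ens_mean R J x = (1 / real J) *\<^sub>R (\<Sum>j = 1..J. R (x j))"

text \<open>
  Particle systems \<open>X\<close> and \<open>X'\<close> (the latter being the coarse ones, defined for levels
  \<open>l \<ge> 1\<close> only) take as arguments the level, the particle number, the time index
  and the sample point.
\<close>

definition ml_mean ::
  "(real ^ 'd \<Rightarrow> real ^ 'r) \<Rightarrow> real \<Rightarrow> (nat \<Rightarrow> nat) \<Rightarrow>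
   (nat \<Rightarrow> nat \<Rightarrow> nat \<Rightarrow> 'w \<Rightarrow> real ^ 'd) \<Rightarrow> (nat \<Rightarrow> nat \<Rightarrow> nat \<Rightarrow> 'w \<Rightarrow> real ^ 'd) \<Rightarrow>
   nat \<Rightarrow> nat \<Rightarrow> 'w \<Rightarrow> real ^ 'r" where
  "ml_mean R a J X X' l n \<omega> =
     ens_mean R (J 0) (\<lambda>j. X 0 j (nat \<lfloor>real n / a ^ l\<rfloor>) \<omega>) +
     (\<Sum>k = 1..l.
        ens_mean R (J k) (\<lambda>j. X k j (nat \<lfloor>real n / a ^ (l - k)\<rfloor>) \<omega>) -
        ens_mean R (J k) (\<lambda>j. X' k j (nat \<lfloor>real n / a ^ (l - k + 1)\<rfloor>) \<omega>))"

definition euler_step ::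
  "(real ^ 'd \<Rightarrow> real ^ 'r \<Rightarrow> real ^ 'd) \<Rightarrow> (real ^ 'd \<Rightarrow> real ^ 'r \<Rightarrow> real ^ 'm ^ 'd) \<Rightarrow>
   real \<Rightarrow> (real \<Rightarrow> 'w \<Rightarrow> real ^ 'm) \<Rightarrow> nat \<Rightarrow> 'w \<Rightarrow> real ^ 'r \<Rightarrow> real ^ 'd \<Rightarrow> real ^ 'd" where
  "euler_step b \<sigma> h W n \<omega> y x =
     x + h *\<^sub>R b x y + \<sigma> x y *v (W (real (n + 1) * h) \<omega> - W (real n * h) \<omega>)"

definition ml_scheme ::
  "'w measure \<Rightarrow> (real ^ 'd \<Rightarrow> real ^ 'r \<Rightarrow> real ^ 'd) \<Rightarrow>
   (real ^ 'd \<Rightarrow> real ^ 'r \<Rightarrow> real ^ 'm ^ 'd) \<Rightarrow> (real ^ 'd \<Rightarrow> real ^ 'r) \<Rightarrow>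
   real \<Rightarrow> real \<Rightarrow> nat \<Rightarrow> (nat \<Rightarrow> nat) \<Rightarrow>
   (nat \<Rightarrow> nat \<Rightarrow> 'w \<Rightarrow> real ^ 'd) \<Rightarrow> (nat \<Rightarrow> nat \<Rightarrow> real \<Rightarrow> 'w \<Rightarrow> real ^ 'm) \<Rightarrow>
   (nat \<Rightarrow> nat \<Rightarrow> nat \<Rightarrow> 'w \<Rightarrow> real ^ 'd) \<Rightarrow> (nat \<Rightarrow> nat \<Rightarrow> nat \<Rightarrow> 'w \<Rightarrow> real ^ 'd) \<Rightarrow> bool" where
  "ml_scheme M b \<sigma> R a dt0 L J \<xi> W X X' \<longleftrightarrow>
     (\<forall>\<omega>\<in>space M.
       (\<forall>l\<le>L. \<forall>j\<in>{1..J l}.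
          X l j 0 \<omega> = \<xi> l j \<omega> \<and>
          (\<forall>n. X l j (Suc n) \<omega> =
                 euler_step b \<sigma> (time_step a dt0 l) (W l j) n \<omega>
                   (ml_mean R a J X X' l n \<omega>) (X l j n \<omega>))) \<and>
       (\<forall>l\<in>{1..L}. \<forall>j\<in>{1..J l}.
          X' l j 0 \<omega> = \<xi> l j \<omega> \<and>
          (\<forall>n. X' l j (Suc n) \<omega> =
                 euler_step b \<sigma> (time_step a dt0 (l - 1)) (W l j) n \<omega>
                   (ml_mean R a J X X' (l - 1) n \<omega>) (X' l j n \<omega>))))"

subsection \<open>Mean-field particles\<close>

primrec mean_field ::
  "'w measure \<Rightarrow> (real ^ 'd \<Rightarrow> real ^ 'r \<Rightarrow> real ^ 'd) \<Rightarrow>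
   (real ^ 'd \<Rightarrow> real ^ 'r \<Rightarrow> real ^ 'm ^ 'd) \<Rightarrow> (real ^ 'd \<Rightarrow> real ^ 'r) \<Rightarrow>
   real \<Rightarrow> ('w \<Rightarrow> real ^ 'd) \<Rightarrow> (real \<Rightarrow> 'w \<Rightarrow> real ^ 'm) \<Rightarrow> nat \<Rightarrow> 'w \<Rightarrow> real ^ 'd" where
  "mean_field M b \<sigma> R h \<xi> W 0 = \<xi>"
| "mean_field M b \<sigma> R h \<xi> W (Suc n) =
     (\<lambda>\<omega>. euler_step b \<sigma> h W n \<omega>
        (integral\<^sup>L M (\<lambda>\<omega>'. R (mean_field M b \<sigma> R h \<xi> W n \<omega>')))
        (mean_field M b \<sigma> R h \<xi> W n \<omega>))"

subsection \<open>Errors\<close>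

text \<open>
  Errors are \<open>ennreal\<close>-valued, so that a bound on them is never satisfied merely because the
  Bochner integral of a non-integrable function is zero.
\<close>

definition max_error ::
  "'w measure \<Rightarrow> real \<Rightarrow> (nat \<Rightarrow> 'w \<Rightarrow> real ^ 'd) \<Rightarrow> (nat \<Rightarrow> 'w \<Rightarrow> real ^ 'd) \<Rightarrow> nat \<Rightarrow> ennreal" where
  "max_error M p Y Z n =
     (\<integral>\<^sup>+ \<omega>. ennreal (Max ((\<lambda>m. norm (Y m \<omega> - Z m \<omega>) powr p) ` {..n})) \<partial>M)"

text \<open>
  The errors do not depend on the particle number.  Here \<open>js l\<close> is the number of the particle
  that represents level \<open>l\<close>.
\<close>

definition level_error ::
  "'w measure \<Rightarrow> real \<Rightarrow> (real ^ 'd \<Rightarrow> real ^ 'r \<Rightarrow> real ^ 'd) \<Rightarrow>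
   (real ^ 'd \<Rightarrow> real ^ 'r \<Rightarrow> real ^ 'm ^ 'd) \<Rightarrow> (real ^ 'd \<Rightarrow> real ^ 'r) \<Rightarrow> real \<Rightarrow> real \<Rightarrow> nat \<Rightarrow>
   (nat \<Rightarrow> nat \<Rightarrow> 'w \<Rightarrow> real ^ 'd) \<Rightarrow> (nat \<Rightarrow> nat \<Rightarrow> real \<Rightarrow> 'w \<Rightarrow> real ^ 'm) \<Rightarrow>
   (nat \<Rightarrow> nat \<Rightarrow> nat \<Rightarrow> 'w \<Rightarrow> real ^ 'd) \<Rightarrow> (nat \<Rightarrow> nat \<Rightarrow> nat \<Rightarrow> 'w \<Rightarrow> real ^ 'd) \<Rightarrow>
   (nat \<Rightarrow> nat) \<Rightarrow> nat \<Rightarrow> nat \<Rightarrow> ennreal" where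
  "level_error M p b \<sigma> R a dt0 L \<xi> W X X' js l n =
     (let e = (\<lambda>k. max_error M p (X k (js k))
                (mean_field M b \<sigma> R (time_step a dt0 k) (\<xi> k (js k)) (W k (js k))) n);
          e' = (\<lambda>k. if k = L + 1 then 0 else max_error M p (X' k (js k))
                (mean_field M b \<sigma> R (time_step a dt0 (k - 1)) (\<xi> k (js k)) (W k (js k))) n)
      in max (e l) (e' (l + 1)))"

end

theory Submission
  imports Defs
begin

text \<open>
  On its own grid, the difference between a particle of level \<open>l\<close> and its mean-field counterpart is an
  adapted stochastic sum, so the \<open>p\<close>-th moment of its running maximum is bounded by a time sum of the
  \<open>p\<close>-th moments of that difference and of the error in the interaction term. The latter splits
  into two parts. The first compares the multilevel estimate with the same estimate for mean-field
  particles; by Minkowski's inequality it is controlled by the errors of the levels \<open>k \<le> l\<close>. The second is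
  purely statistical: it has no bias, because the coarse mean-field particles of level \<open>k\<close> have the law
  of the fine ones of level \<open>k - 1\<close> and the expectations telescope, and its level \<open>k\<close> term is of
  order \<open>J\<^sub>k\<^bsup>-1/2\<^esup> a\<^bsup>-k/2\<^esup>\<close>, hence at most a multiple of \<open>\<epsilon> / q\<^bsup>L-k\<^esup>\<close>, by the strong
  error of the Euler scheme. Since \<open>q > 1\<close>, sums over \<open>k \<le> l\<close> are dominated by their last term, so
  a discrete Gronwall argument with the weights \<open>\<epsilon> / q\<^bsup>L-l\<^esup>\<close>, by induction on \<open>(l, n)\<close>, yields a
  constant that does not depend on \<open>L\<close>.
\<close>

subsection \<open>Inequalities for real powers\<close>

text \<open>Since \<open>a\<close> is an arbitrary real, the grid of level l-1 need not be part of
  that of level l. Two mean-field Euler schemes are therefore compared with each other, through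
  interpolations on the union of both grids; the solution of the SDE never enters. As the particles
  of all levels interact, one joint filtration serves them all, and the increments of each Brownian
  motion have to be shown independent of that joint past. The martingale bound carries free weights
  w_k with sum at most 1. With w_k = (time step)/T it bounds the p-th moment of a stochastic sum by
  an expression linear in the time steps, with a constant that does not depend on their number; with
  w_k = 1/J it gives the rate J^(-1/2) for averages. Every constant is built in locales that mention
  neither the probability space nor \<epsilon>, L and the ensembles, so C can be fixed before these
  are.\<close>

lemma powr_tangent:
  fixes r z w :: real
  assumes "1 \<le> r" "0 \<le> z" "0 \<le> w"
  shows "w powr r + r * w powr (r - 1) * (z - w) \<le> z powr r"
proof (cases "r = 1 \<or> w = 0")
  case True
  then show ?thesis using assms by auto
next
  case False
  then have r: "r > 1" and w: "w > 0" using assms by auto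
  \<comment> \<open>Young's inequality with exponents r and r/(r-1), applied to z and w^(r-1), is
    the tangent inequality after multiplication by r; no derivative is taken, so z = 0 is
    covered.\<close>
  have "z * w powr (r - 1) \<le> z powr r / r + (w powr (r - 1)) powr (r / (r - 1)) / (r / (r - 1))"
    by (rule Youngs_inequality) (use r assms in \<open>auto simp: field_simps\<close>)
  also have "(w powr (r - 1)) powr (r / (r - 1)) = w powr r"
    using r by (simp add: powr_powr)
  finally have "r * (z * w powr (r - 1)) \<le> z powr r + (r - 1) * w powr r"
    using r by (simp add: field_simps)
  moreover have "w powr r = w powr (r - 1) * w"
    using w by (simp add: powr_diff)
  ultimately show ?thesis by (simp add: algebra_simps)
qed

text \<open>Jensen for finitely many weights: the tangent at the weighted mean w is averaged, and
  its linear part cancels because the weights sum to 1.\<close>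

lemma powr_convex_sum:
  fixes \<theta> x :: "'i \<Rightarrow> real"
  assumes "1 \<le> p" "\<And>i. i \<in> S \<Longrightarrow> 0 \<le> \<theta> i" "\<And>i. i \<in> S \<Longrightarrow> 0 \<le> x i" "sum \<theta> S = 1"
  shows "(\<Sum>i\<in>S. \<theta> i * x i) powr p \<le> (\<Sum>i\<in>S. \<theta> i * x i powr p)"
proof -
  define w where "w = (\<Sum>i\<in>S. \<theta> i * x i)"
  have w: "0 \<le> w" unfolding w_def using assms by (auto intro!: sum_nonneg)
  have "(\<Sum>i\<in>S. \<theta> i * (w powr p + p * w powr (p - 1) * (x i - w))) \<le> (\<Sum>i\<in>S. \<theta> i * x i powr p)"
    using assms w by (intro sum_mono mult_left_mono powr_tangent) auto
  also have "(\<Sum>i\<in>S. \<theta> i * (w powr p + p * w powr (p - 1) * (x i - w)))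
      = sum \<theta> S * w powr p + p * w powr (p - 1) * ((\<Sum>i\<in>S. \<theta> i * x i) - sum \<theta> S * w)"
    by (simp add: algebra_simps sum.distrib sum_distrib_left sum_distrib_right sum_subtractf)
  also have "\<dots> = w powr p" using assms by (simp add: w_def)
  finally show ?thesis unfolding w_def .
qed

lemma powr_add_le:
  fixes x y :: real
  assumes "1 \<le> p" "0 \<le> x" "0 \<le> y"
  shows "(x + y) powr p \<le> 2 powr p * (x powr p + y powr p)"
proof -
  have "x + y \<le> 2 * max x y" by auto
  then have "(x + y) powr p \<le> (2 * max x y) powr p"
    using assms by (intro powr_mono2) auto
  also have "\<dots> = 2 powr p * (max x y) powr p" by (simp add: powr_mult)
  also have "(max x y) powr p \<le> x powr p + y powr p" by (auto simp: max_def)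
  finally show ?thesis by simp
qed

text \<open>A crude Young inequality: the larger of u and v carries the product. It turns a bound
  |G| \<le> V^(p-1) on a test function into integrability of its product with any D that has a p-th
  moment.\<close>

lemma powr_minus_1_mult_le:
  fixes u v p :: real
  assumes "1 \<le> p" "0 \<le> u" "0 \<le> v"
  shows "u powr (p - 1) * v \<le> u powr p + v powr p"
proof -
  have *: "z powr (p - 1) * z = z powr p" if "0 \<le> z" for z
    using that powr_add[of z "p - 1" 1] by simp
  show ?thesis
  proof (cases "u \<le> v")
    case True
    then have "u powr (p - 1) * v \<le> v powr (p - 1) * v"
      using assms by (intro mult_right_mono powr_mono2) auto
    then show ?thesis using *[of v] assms by (simp add: add_increasing)
  next
    case False
    then have "u powr (p - 1) * v \<le> u powr (p - 1) * u"
      using assms by (intro mult_left_mono) auto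
    then show ?thesis using *[of u] assms by (simp add: add_increasing2)
  qed
qed

text \<open>Young's inequality with a free weight w, from comparing v^2 with w u^2. A small w keeps
  the growth factor of the accumulated u close to 1 at the price w^(1-p/2) on the new increment v;
  for w proportional to a time step, the Gaussian scaling of v offsets this price.\<close>

lemma powr_minus_2_mult_le:
  fixes u v w p :: real
  assumes "2 \<le> p" "0 \<le> u" "0 \<le> v" "0 < w"
  shows "u powr (p - 2) * v\<^sup>2 \<le> w * u powr p + w powr (1 - p / 2) * v powr p"
proof (cases "v = 0")
  case True
  then show ?thesis using assms by simp
next
  case False
  then have v: "v > 0" using assms by simp
  have sq: "z powr (p - 2) * z\<^sup>2 = z powr p" if "0 \<le> z" for z :: real
    using that powr_add[of z "p - 2" 2] by simp
  show ?thesis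
  proof (cases "v\<^sup>2 \<le> w * u\<^sup>2")
    case True
    have "u powr (p - 2) * v\<^sup>2 \<le> u powr (p - 2) * (w * u\<^sup>2)"
      using True by (intro mult_left_mono) auto
    also have "\<dots> = w * u powr p" using sq[of u] assms by (simp add: algebra_simps)
    finally show ?thesis by (simp add: add_increasing2)
  next
    case False
    have "(sqrt w * u)\<^sup>2 \<le> v\<^sup>2" using False assms by (simp add: power_mult_distrib)
    then have "sqrt w * u \<le> v" using v by (meson less_imp_le power2_le_imp_le)
    then have "u \<le> v / sqrt w" using assms by (simp add: field_simps)
    then have "u powr (p - 2) \<le> (v / sqrt w) powr (p - 2)"
      using assms by (intro powr_mono2) auto
    also have "\<dots> = v powr (p - 2) * w powr (1 - p / 2)"
      using assms powr_minus_divide[of w "p / 2 - 1"]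
      by (simp add: powr_divide powr_half_sqrt[symmetric] powr_powr right_diff_distrib)
    finally have "u powr (p - 2) * v\<^sup>2 \<le> (v powr (p - 2) * w powr (1 - p / 2)) * v\<^sup>2"
      by (intro mult_right_mono) auto
    also have "\<dots> = w powr (1 - p / 2) * v powr p" using sq[of v] v by (simp add: algebra_simps)
    finally show ?thesis using assms by (simp add: add_increasing)
  qed
qed

text \<open>The tangent inequality taken at 1+u, not at 1, leaves the remainder r u ((1+u)^(r-1) -
  1), which is quadratic because z^(r-1) is Lipschitz on [1/4, 9/4]. The interval stays away from 0
  since r-2 may be negative; it is the range of |x+y|^2 / |x|^2 for |y| \<le> |x|/2.\<close>

lemma powr_1_plus_le:
  fixes r u :: real
  assumes r: "1 \<le> r" and u: "- 3 / 4 \<le> u" "u \<le> 5 / 4"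
  shows "(1 + u) powr r \<le> 1 + r * u + r\<^sup>2 * 4 powr r * u\<^sup>2"
proof -
  define s where "s = r - 1"
  have bound: "s * z powr (s - 1) \<le> r * 4 powr r" if "1 / 4 \<le> z" "z \<le> 9 / 4" for z
  proof -
    have "z powr (s - 1) \<le> 4 powr r"
    proof (cases "s \<ge> 1")
      case True
      have "z powr (s - 1) \<le> 4 powr (s - 1)" using True that by (intro powr_mono2) auto
      also have "\<dots> \<le> 4 powr r" by (intro powr_mono) (auto simp: s_def)
      finally show ?thesis .
    next
      case False
      have "z powr (s - 1) \<le> (1 / 4) powr (s - 1)" using False that by (intro powr_mono2') auto
      also have "\<dots> = 4 powr (1 - s)" by (simp add: powr_divide powr_minus[symmetric] divide_powr_uminus)
      also have "\<dots> \<le> 4 powr r" using r by (intro powr_mono) (auto simp: s_def)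
      finally show ?thesis .
    qed
    then show ?thesis using r by (intro mult_mono) (auto simp: s_def)
  qed
  have lip: "\<bar>(1 + u) powr s - 1\<bar> \<le> r * 4 powr r * \<bar>u\<bar>"
  proof -
    have "norm ((1 + u) powr s - 1 powr s) \<le> r * 4 powr r * norm ((1 + u) - 1)"
    proof (rule field_differentiable_bound[where S = "{1/4..9/4}" and f' = "\<lambda>z. s * z powr (s - 1)"])
      fix z :: real assume z: "z \<in> {1/4..9/4}"
      show "((\<lambda>z. z powr s) has_field_derivative s * z powr (s - 1)) (at z within {1/4..9/4})"
        using z by (auto intro!: derivative_eq_intros DERIV_subset[OF has_real_derivative_powr])
      show "norm (s * z powr (s - 1)) \<le> r * 4 powr r"
        using bound[of z] z r by (auto simp: s_def abs_mult)
    qed (use u in auto)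
    then show ?thesis by simp
  qed
  have "(1 + u) powr r + r * (1 + u) powr (r - 1) * (1 - (1 + u)) \<le> 1 powr r"
    using u r by (intro powr_tangent) auto
  then have "(1 + u) powr r \<le> 1 + r * u + r * (u * ((1 + u) powr s - 1))"
    by (simp add: s_def algebra_simps)
  also have "u * ((1 + u) powr s - 1) \<le> \<bar>u\<bar> * \<bar>(1 + u) powr s - 1\<bar>"
    by (metis abs_ge_self abs_mult)
  also have "\<dots> \<le> \<bar>u\<bar> * (r * 4 powr r * \<bar>u\<bar>)" using lip by (intro mult_left_mono) auto
  finally have "(1 + u) powr r \<le> 1 + r * u + r * (\<bar>u\<bar> * (r * 4 powr r * \<bar>u\<bar>))"
    using r by (simp add: mult_left_mono)
  moreover have "r * (\<bar>u\<bar> * (r * 4 powr r * \<bar>u\<bar>)) = r\<^sup>2 * 4 powr r * u\<^sup>2"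
    by (simp add: power2_eq_square)
  ultimately show ?thesis by simp
qed

text \<open>If |x| \<le> 2|y|, every term is at most a multiple of |y|^p; otherwise |x+y|^2 = |x|^2
  (1+u) and the expansion of (1+u)^(p/2) applies. The first-order term is kept exactly, because it
  vanishes in the mean for martingale increments.\<close>

lemma norm_add_powr_le:
  fixes x y :: "'b::real_inner"
  assumes p: "2 \<le> p"
  shows "norm (x + y) powr p \<le> norm x powr p + p * (norm x powr (p - 2) * (x \<bullet> y))
     + 2 * p\<^sup>2 * 3 powr p * (norm x powr (p - 2) * (norm y)\<^sup>2 + norm y powr p)"
proof (cases "norm x \<le> 2 * norm y")
  case True
  have p1: "p * 2 powr (p - 1) \<le> p * 3 powr p"
    using p by (intro mult_left_mono order_trans[OF powr_mono2[of "p - 1" 2 3] powr_mono]) auto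
  have "norm (x + y) \<le> 3 * norm y" using True norm_triangle_ineq[of x y] by simp
  then have "norm (x + y) powr p \<le> (3 * norm y) powr p" using p by (intro powr_mono2) auto
  then have 1: "norm (x + y) powr p \<le> 3 powr p * norm y powr p" by (simp add: powr_mult)
  have "\<bar>norm x powr (p - 2) * (x \<bullet> y)\<bar> \<le> norm x powr (p - 2) * (norm x * norm y)"
    by (simp add: abs_mult Cauchy_Schwarz_ineq2 mult_left_mono)
  also have "\<dots> = norm x powr (p - 1) * norm y"
    using powr_mult_base[of "norm x" "p - 2"] by (simp add: algebra_simps)
  also have "\<dots> \<le> (2 * norm y) powr (p - 1) * norm y"
    using True p by (intro mult_right_mono powr_mono2) auto
  also have "\<dots> = 2 powr (p - 1) * norm y powr p"
    using powr_mult_base[of "norm y" "p - 1"] by (simp add: powr_mult algebra_simps)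
  finally have "p * \<bar>norm x powr (p - 2) * (x \<bullet> y)\<bar> \<le> p * (2 powr (p - 1) * norm y powr p)"
    using p by (intro mult_left_mono) auto
  also have "\<dots> \<le> p * 3 powr p * norm y powr p"
    using mult_right_mono[OF p1, of "norm y powr p"] by (simp add: algebra_simps)
  finally have 2: "- (p * (norm x powr (p - 2) * (x \<bullet> y))) \<le> p * 3 powr p * norm y powr p"
    using p by (metis abs_ge_minus_self abs_mult abs_of_nonneg minus_mult_right mult_left_mono order_trans zero_le_numeral)
  have "p * 2 \<le> p * p" using p by (intro mult_left_mono) auto
  then have "1 + p \<le> 2 * p\<^sup>2" using p unfolding power2_eq_square by linarith
  then have "(1 + p) * (3 powr p * norm y powr p) \<le> 2 * p\<^sup>2 * (3 powr p * norm y powr p)"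
    by (intro mult_right_mono) auto
  then have "(1 + p) * (3 powr p * norm y powr p) \<le>
      2 * p\<^sup>2 * 3 powr p * (norm x powr (p - 2) * (norm y)\<^sup>2 + norm y powr p)"
    by (rule order_trans) (simp add: algebra_simps)
  then have "3 powr p * norm y powr p + p * 3 powr p * norm y powr p \<le>
      2 * p\<^sup>2 * 3 powr p * (norm x powr (p - 2) * (norm y)\<^sup>2 + norm y powr p)"
    by (simp add: distrib_right mult.assoc)
  then show ?thesis using 1 2 powr_ge_zero[of "norm x" p] by linarith
next
  case False
  define r where "r = p / 2"
  have r: "1 \<le> r" using p by (simp add: r_def)
  define t where "t = norm y / norm x"
  have x: "norm x > 0" using False by (meson not_le norm_ge_zero order_trans mult_nonneg_nonneg zero_le_numeral)
  have t: "0 \<le> t" "t \<le> 1 / 2" using False x by (auto simp: t_def field_simps)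
  define u where "u = (2 * (x \<bullet> y) + (norm y)\<^sup>2) / (norm x)\<^sup>2"
  have cs: "\<bar>x \<bullet> y\<bar> / (norm x)\<^sup>2 \<le> t"
    using Cauchy_Schwarz_ineq2[of x y] x by (simp add: t_def field_simps power2_eq_square)
  have u_eq: "u = 2 * ((x \<bullet> y) / (norm x)\<^sup>2) + t\<^sup>2"
    by (simp add: u_def t_def power_divide add_divide_distrib)
  have t2: "t\<^sup>2 \<le> t / 2" using mult_left_mono[OF t(2) t(1)] by (simp add: power2_eq_square)
  have cs': "\<bar>(x \<bullet> y) / (norm x)\<^sup>2\<bar> \<le> t" using cs by simp
  have absu: "\<bar>u\<bar> \<le> 5 / 2 * t" using cs' t2 t zero_le_power2[of t] unfolding u_eq by linarith
  have u: "u \<le> 5 / 4" using absu t by linarith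
  have n2: "(norm (x + y))\<^sup>2 = (norm x)\<^sup>2 * (1 + u)"
    using x by (simp add: u_def field_simps power2_norm_eq_inner inner_add inner_commute)
  have "norm x / 2 \<le> norm (x + y)"
    using False norm_diff_ineq[of x y] by simp
  then have "(norm x / 2)\<^sup>2 \<le> (norm x)\<^sup>2 * (1 + u)"
    unfolding n2[symmetric] by (intro power_mono) auto
  then have "(norm x)\<^sup>2 * (1 / 4) \<le> (norm x)\<^sup>2 * (1 + u)" by (simp add: power_divide)
  then have "1 / 4 \<le> 1 + u" using x by (subst (asm) mult_le_cancel_left_pos) auto
  then have u': "- 3 / 4 \<le> u" by simp
  have "norm (x + y) powr p = ((norm (x + y))\<^sup>2) powr r"
    by (simp add: r_def powr_powr flip: powr_numeral)
  also have "\<dots> = norm x powr p * (1 + u) powr r"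
    unfolding n2 by (simp add: r_def powr_mult powr_powr flip: powr_numeral)
  also have "\<dots> \<le> norm x powr p * (1 + r * u + r\<^sup>2 * 4 powr r * u\<^sup>2)"
    using powr_1_plus_le[OF r u' u] by (intro mult_left_mono) auto
  also have "\<dots> \<le> norm x powr p * (1 + p * ((x \<bullet> y) / (norm x)\<^sup>2) + 2 * p\<^sup>2 * 3 powr p * t\<^sup>2)"
  proof -
    have "u\<^sup>2 \<le> (5 / 2 * t)\<^sup>2" using absu by (metis abs_le_square_iff abs_of_nonneg abs_ge_zero order_trans)
    then have a: "u\<^sup>2 \<le> 25 / 4 * t\<^sup>2" by (simp add: power_mult_distrib power_divide)
    have "r \<le> r\<^sup>2" using r by (simp add: power2_eq_square)
    moreover have "1 \<le> 4 powr r" using r by (simp add: ge_one_powr_ge_zero)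
    ultimately have "r * 1 \<le> r\<^sup>2 * 4 powr r" using r by (intro mult_mono) auto
    then have b: "r * t\<^sup>2 \<le> r\<^sup>2 * 4 powr r * t\<^sup>2" by (intro mult_right_mono) auto
    have c: "r\<^sup>2 * 4 powr r * u\<^sup>2 \<le> r\<^sup>2 * 4 powr r * (25 / 4 * t\<^sup>2)"
      using a by (intro mult_left_mono) auto
    have "4 powr r = 2 powr p"
      using powr_powr[of 2 2 r] by (simp add: r_def)
    also have "\<dots> \<le> 3 powr p" using p by (intro powr_mono2) auto
    finally have "8 * (r\<^sup>2 * 4 powr r * t\<^sup>2) \<le> 8 * (r\<^sup>2 * 3 powr p * t\<^sup>2)"
      by (intro mult_left_mono mult_right_mono) auto
    also have "\<dots> = 2 * p\<^sup>2 * 3 powr p * t\<^sup>2" by (simp add: r_def power_divide)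
    finally have d: "8 * (r\<^sup>2 * 4 powr r * t\<^sup>2) \<le> 2 * p\<^sup>2 * 3 powr p * t\<^sup>2" .
    have "0 \<le> r\<^sup>2 * 4 powr r * t\<^sup>2" by simp
    moreover have "r * u = p * ((x \<bullet> y) / (norm x)\<^sup>2) + r * t\<^sup>2"
      unfolding u_eq by (simp add: r_def algebra_simps)
    ultimately have "1 + r * u + r\<^sup>2 * 4 powr r * u\<^sup>2 \<le>
        1 + p * ((x \<bullet> y) / (norm x)\<^sup>2) + 2 * p\<^sup>2 * 3 powr p * t\<^sup>2"
      using b c d by linarith
    then show ?thesis by (intro mult_left_mono) auto
  qed
  also have "\<dots> = norm x powr p + p * (norm x powr (p - 2) * (x \<bullet> y))
     + 2 * p\<^sup>2 * 3 powr p * (norm x powr (p - 2) * (norm y)\<^sup>2)"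
    using x by (simp add: t_def power_divide powr_diff field_simps)
  also have "\<dots> \<le> norm x powr p + p * (norm x powr (p - 2) * (x \<bullet> y))
     + 2 * p\<^sup>2 * 3 powr p * (norm x powr (p - 2) * (norm y)\<^sup>2 + norm y powr p)"
    by (intro add_left_mono mult_left_mono) auto
  finally show ?thesis .
qed

subsection \<open>Bounded moments\<close>

text \<open>Measurability and integrability belong to the predicate, so a bound never holds through
  the default value 0 of the Bochner integral. The number v bounds the p-th moment itself; where the
  triangle inequality in L^p is wanted, it is written as \<open>c powr p\<close>.\<close>

definition moment_le :: "'w measure \<Rightarrow> real \<Rightarrow> real \<Rightarrow> ('w \<Rightarrow> 'b::euclidean_space) \<Rightarrow> bool" where
  "moment_le M p v Y \<longleftrightarrow> Y \<in> borel_measurable M \<and>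
     integrable M (\<lambda>\<omega>. norm (Y \<omega>) powr p) \<and> (\<integral>\<omega>. norm (Y \<omega>) powr p \<partial>M) \<le> v"

lemma moment_leD:
  assumes "moment_le M p v Y"
  shows "Y \<in> borel_measurable M" "integrable M (\<lambda>\<omega>. norm (Y \<omega>) powr p)"
    "(\<integral>\<omega>. norm (Y \<omega>) powr p \<partial>M) \<le> v"
  using assms by (auto simp: moment_le_def)

lemma moment_le_nonneg: "moment_le M p v Y \<Longrightarrow> 0 \<le> v"
  unfolding moment_le_def
  by (elim conjE, erule order_trans[rotated], intro Bochner_Integration.integral_nonneg) auto

lemma moment_le_mono: "moment_le M p v Y \<Longrightarrow> v \<le> v' \<Longrightarrow> moment_le M p v' Y"
  by (auto simp: moment_le_def)

lemma moment_le_I: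
  assumes "Z \<in> borel_measurable M" "integrable M f" "(\<integral>\<omega>. f \<omega> \<partial>M) \<le> v"
    and "\<And>\<omega>. \<omega> \<in> space M \<Longrightarrow> norm (Z \<omega>) powr p \<le> f \<omega>"
  shows "moment_le M p v Z"
proof -
  have int: "integrable M (\<lambda>\<omega>. norm (Z \<omega>) powr p)"
  proof (rule Bochner_Integration.integrable_bound[OF assms(2)])
    show "AE \<omega> in M. norm (norm (Z \<omega>) powr p) \<le> norm (f \<omega>)"
      using assms(4) by (intro AE_I2) fastforce
  qed (use assms(1) in measurable)
  moreover have "(\<integral>\<omega>. norm (Z \<omega>) powr p \<partial>M) \<le> (\<integral>\<omega>. f \<omega> \<partial>M)"
    by (intro integral_mono int assms)
  ultimately show ?thesis using assms by (auto simp: moment_le_def)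
qed

lemma moment_le_scaled:
  assumes Y: "moment_le M p v Y" and [measurable]: "Z \<in> borel_measurable M"
    and "0 \<le> c" "0 \<le> p" "\<And>\<omega>. \<omega> \<in> space M \<Longrightarrow> norm (Z \<omega>) \<le> c * norm (Y \<omega>)"
  shows "moment_le M p (c powr p * v) Z"
proof (rule moment_le_I[where f = "\<lambda>\<omega>. c powr p * norm (Y \<omega>) powr p"])
  show "(\<integral>\<omega>. c powr p * norm (Y \<omega>) powr p \<partial>M) \<le> c powr p * v"
    using moment_leD[OF Y] by (simp add: mult_left_mono)
  fix \<omega> assume "\<omega> \<in> space M"
  then have "norm (Z \<omega>) powr p \<le> (c * norm (Y \<omega>)) powr p"
    using assms by (intro powr_mono2) auto
  then show "norm (Z \<omega>) powr p \<le> c powr p * norm (Y \<omega>) powr p" by (simp add: powr_mult)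
qed (use moment_leD[OF Y] in auto)

lemma moment_le_dom:
  assumes "moment_le M p v Y" "Z \<in> borel_measurable M" "0 \<le> p"
    and "\<And>\<omega>. \<omega> \<in> space M \<Longrightarrow> norm (Z \<omega>) \<le> norm (Y \<omega>)"
  shows "moment_le M p v Z"
  using moment_le_scaled[OF assms(1,2), of 1] assms by simp

lemma moment_le_cong:
  assumes "moment_le M p v Y" "\<And>\<omega>. \<omega> \<in> space M \<Longrightarrow> Z \<omega> = Y \<omega>"
  shows "moment_le M p v Z"
proof -
  have "Z \<in> borel_measurable M \<longleftrightarrow> Y \<in> borel_measurable M"
    by (rule measurable_cong) (use assms in auto)
  moreover have "integrable M (\<lambda>\<omega>. norm (Z \<omega>) powr p) \<longleftrightarrow> integrable M (\<lambda>\<omega>. norm (Y \<omega>) powr p)"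
    by (rule Bochner_Integration.integrable_cong) (use assms in auto)
  moreover have "(\<integral>\<omega>. norm (Z \<omega>) powr p \<partial>M) = (\<integral>\<omega>. norm (Y \<omega>) powr p \<partial>M)"
    by (rule Bochner_Integration.integral_cong) (use assms in auto)
  ultimately show ?thesis using assms(1) by (auto simp: moment_le_def)
qed

text \<open>Minkowski's inequality, stated for upper bounds of the norms.\<close>

lemma moment_le_sum:
  fixes f :: "'i \<Rightarrow> 'w \<Rightarrow> 'b::euclidean_space"
  assumes p: "1 \<le> p" and f: "\<And>i. i \<in> S \<Longrightarrow> moment_le M p (c i powr p) (f i)"
    and c: "\<And>i. i \<in> S \<Longrightarrow> 0 \<le> c i" and S: "finite S"
  shows "moment_le M p ((\<Sum>i\<in>S. c i) powr p) (\<lambda>\<omega>. \<Sum>i\<in>S. f i \<omega>)"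
proof (cases "S = {}")
  case True
  then show ?thesis by (simp add: moment_le_def)
next
  case False
  have [measurable]: "f i \<in> borel_measurable M" if "i \<in> S" for i using f that by (auto simp: moment_le_def)
  have meas: "(\<lambda>\<omega>. \<Sum>i\<in>S. f i \<omega>) \<in> borel_measurable M" by measurable
  \<comment> \<open>The slack e keeps all denominators c_i + e positive, as some c_i may be 0; a
    limit removes it at the end.\<close>
  have bound: "moment_le M p ((\<Sum>i\<in>S. c i + e) powr p) (\<lambda>\<omega>. \<Sum>i\<in>S. f i \<omega>)" if e: "e > 0" for e
  proof -
    define C where "C = (\<Sum>i\<in>S. c i + e)"
    have ce: "c i + e > 0" if "i \<in> S" for i using e c[OF that] by simp
    have C: "C > 0" unfolding C_def using ce S False by (intro sum_pos) auto
    \<comment> \<open>Weights proportional to the norm bounds: Jensen's inequality for these weights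
      and the rescaled functions f_i / (c_i + e) is Minkowski's inequality.\<close>
    define \<theta> where "\<theta> i = (c i + e) / C" for i
    have \<theta>: "0 \<le> \<theta> i" if "i \<in> S" for i using ce[OF that] C by (simp add: \<theta>_def)
    have \<theta>1: "sum \<theta> S = 1" using C by (simp add: \<theta>_def C_def flip: sum_divide_distrib)
    define g where "g \<omega> = (\<Sum>i\<in>S. C powr p * \<theta> i / (c i + e) powr p * norm (f i \<omega>) powr p)" for \<omega>
    have int: "integrable M (\<lambda>\<omega>. norm (f i \<omega>) powr p)" if "i \<in> S" for i
      using f[OF that] by (simp add: moment_le_def)
    show ?thesis unfolding C_def[symmetric]
    proof (rule moment_le_I[OF meas, where f = g])
      show "integrable M g" unfolding g_def using int by auto
      have "(\<integral>\<omega>. g \<omega> \<partial>M) = (\<Sum>i\<in>S. C powr p * \<theta> i / (c i + e) powr p * (\<integral>\<omega>. norm (f i \<omega>) powr p \<partial>M))"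
        unfolding g_def using int by (subst Bochner_Integration.integral_sum) auto
      also have "\<dots> \<le> (\<Sum>i\<in>S. C powr p * \<theta> i / (c i + e) powr p * (c i + e) powr p)"
      proof (intro sum_mono mult_left_mono)
        fix i assume i: "i \<in> S"
        have "(\<integral>\<omega>. norm (f i \<omega>) powr p \<partial>M) \<le> c i powr p" using f[OF i] by (simp add: moment_le_def)
        also have "\<dots> \<le> (c i + e) powr p" using c[OF i] e p by (intro powr_mono2) auto
        finally show "(\<integral>\<omega>. norm (f i \<omega>) powr p \<partial>M) \<le> (c i + e) powr p" .
      qed (use \<theta> in auto)
      also have "\<dots> = (\<Sum>i\<in>S. C powr p * \<theta> i)"
        using ce by (intro sum.cong) fastforce+
      also have "\<dots> = C powr p" by (simp add: \<theta>1 flip: sum_distrib_left)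
      finally show "(\<integral>\<omega>. g \<omega> \<partial>M) \<le> C powr p" .
      fix \<omega>
      have eq: "norm (f i \<omega>) = C * (\<theta> i * (norm (f i \<omega>) / (c i + e)))" if "i \<in> S" for i
        using ce[OF that] C by (simp add: \<theta>_def)
      have "norm (\<Sum>i\<in>S. f i \<omega>) \<le> (\<Sum>i\<in>S. norm (f i \<omega>))" by (rule norm_sum)
      also have "\<dots> = (\<Sum>i\<in>S. C * (\<theta> i * (norm (f i \<omega>) / (c i + e))))"
        using eq by (intro sum.cong) auto
      also have "\<dots> = C * (\<Sum>i\<in>S. \<theta> i * (norm (f i \<omega>) / (c i + e)))"
        by (simp add: sum_distrib_left)
      finally have "norm (\<Sum>i\<in>S. f i \<omega>) powr p \<le> (C * (\<Sum>i\<in>S. \<theta> i * (norm (f i \<omega>) / (c i + e)))) powr p"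
        using p by (intro powr_mono2) auto
      also have "\<dots> = C powr p * (\<Sum>i\<in>S. \<theta> i * (norm (f i \<omega>) / (c i + e))) powr p" by (rule powr_mult)
      also have "\<dots> \<le> C powr p * (\<Sum>i\<in>S. \<theta> i * (norm (f i \<omega>) / (c i + e)) powr p)"
        using p \<theta> \<theta>1 ce by (intro mult_left_mono powr_convex_sum) (auto intro!: divide_nonneg_pos)
      also have "\<dots> = g \<omega>" unfolding g_def by (simp add: sum_distrib_left powr_divide algebra_simps)
      finally show "norm (\<Sum>i\<in>S. f i \<omega>) powr p \<le> g \<omega>" .
    qed
  qed
  have "((\<lambda>e. (\<Sum>i\<in>S. c i + e) powr p) \<longlongrightarrow> (\<Sum>i\<in>S. c i + 0) powr p) (at_right 0)"
    using p c by (intro tendsto_powr' tendsto_sum tendsto_intros) (auto intro!: sum_nonneg eventually_at_rightI[of 0 1])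
  then have "(\<integral>\<omega>. norm (\<Sum>i\<in>S. f i \<omega>) powr p \<partial>M) \<le> (\<Sum>i\<in>S. c i + 0) powr p"
    by (rule tendsto_lowerbound) (use bound in \<open>auto simp: moment_le_def intro!: eventually_at_rightI[of 0 1]\<close>)
  then show ?thesis using bound[of 1] meas by (auto simp: moment_le_def)
qed

lemma moment_le_add2:
  assumes "1 \<le> p" "moment_le M p (c powr p) f" "moment_le M p (d powr p) g" "0 \<le> c" "0 \<le> d"
  shows "moment_le M p ((c + d) powr p) (\<lambda>\<omega>. f \<omega> + g \<omega>)"
proof -
  have "moment_le M p ((\<Sum>i\<in>UNIV. (if i then c else d)) powr p)
      (\<lambda>\<omega>. \<Sum>i\<in>UNIV. (if i then f else g) \<omega>)"
    by (rule moment_le_sum) (use assms in auto)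
  then show ?thesis by (simp add: UNIV_bool add.commute)
qed

lemma moment_le_add:
  assumes p: "1 \<le> p" and f: "moment_le M p v f" and g: "moment_le M p v' g"
  shows "moment_le M p (2 powr p * (v + v')) (\<lambda>\<omega>. f \<omega> + g \<omega>)"
proof (rule moment_le_I[where f = "\<lambda>\<omega>. 2 powr p * (norm (f \<omega>) powr p + norm (g \<omega>) powr p)"])
  note [measurable] = moment_leD(1)[OF f] moment_leD(1)[OF g]
  show "(\<lambda>\<omega>. f \<omega> + g \<omega>) \<in> borel_measurable M" by measurable
  show "integrable M (\<lambda>\<omega>. 2 powr p * (norm (f \<omega>) powr p + norm (g \<omega>) powr p))"
    using moment_leD(2)[OF f] moment_leD(2)[OF g] by auto
  show "(\<integral>\<omega>. 2 powr p * (norm (f \<omega>) powr p + norm (g \<omega>) powr p) \<partial>M) \<le> 2 powr p * (v + v')"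
    using moment_leD(2,3)[OF f] moment_leD(2,3)[OF g] by simp
  fix \<omega>
  have "norm (f \<omega> + g \<omega>) powr p \<le> (norm (f \<omega>) + norm (g \<omega>)) powr p"
    using p by (intro powr_mono2 norm_triangle_ineq) auto
  also have "\<dots> \<le> 2 powr p * (norm (f \<omega>) powr p + norm (g \<omega>) powr p)"
    using p by (intro powr_add_le) auto
  finally show "norm (f \<omega> + g \<omega>) powr p \<le> 2 powr p * (norm (f \<omega>) powr p + norm (g \<omega>) powr p)" .
qed

lemma (in prob_space) moment_le_const: "moment_le M p (norm c powr p) (\<lambda>_. c)"
  by (simp add: moment_le_def prob_space)

lemma (in prob_space) moment_le_integrable:
  assumes "1 \<le> p" "moment_le M p v Y"
  shows "integrable M Y"
proof (rule Bochner_Integration.integrable_bound)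
  show "integrable M (\<lambda>\<omega>. 1 + norm (Y \<omega>) powr p)" using moment_leD[OF assms(2)] by auto
  have "norm (Y \<omega>) \<le> 1 + norm (Y \<omega>) powr p" for \<omega>
    using powr_minus_1_mult_le[of p 1 "norm (Y \<omega>)"] assms by simp
  then show "AE \<omega> in M. norm (Y \<omega>) \<le> norm (1 + norm (Y \<omega>) powr p)"
    by (intro AE_I2) (metis abs_of_nonneg add_nonneg_nonneg powr_ge_zero real_norm_def zero_le_one)
qed (use moment_leD[OF assms(2)] in auto)

lemma (in prob_space) norm_expectation_powr_le:
  fixes Y :: "'a \<Rightarrow> 'b::euclidean_space"
  assumes p: "1 \<le> p" and Y: "moment_le M p v Y"
  shows "norm (expectation Y) powr p \<le> v"
proof -
  define w where "w = expectation (\<lambda>\<omega>. norm (Y \<omega>))"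
  note int = moment_le_integrable[OF p Y]
  have w: "0 \<le> w" by (simp add: w_def integral_nonneg)
  have "norm (expectation Y) powr p \<le> w powr p"
    using p by (intro powr_mono2) (auto simp: w_def integral_norm_bound)
  also have "w powr p = expectation (\<lambda>\<omega>. w powr p + p * w powr (p - 1) * (norm (Y \<omega>) - w))"
    using int by (simp add: prob_space w_def)
  also have "\<dots> \<le> expectation (\<lambda>\<omega>. norm (Y \<omega>) powr p)"
    using int moment_leD[OF Y] p w by (intro integral_mono powr_tangent) auto
  also have "\<dots> \<le> v" by (rule moment_leD[OF Y])
  finally show ?thesis .
qed

subsection \<open>Moments of martingales\<close>

text \<open>
  The condition on \<open>G\<close> makes \<open>G \<bullet> D\<close> integrable. It is what \<open>D\<close> having conditional mean
  zero given the sub-sigma-algebra \<open>F\<close> means for test functions of the dual exponent.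
\<close>

definition mart_diff :: "'w measure \<Rightarrow> real \<Rightarrow> 'w measure \<Rightarrow> ('w \<Rightarrow> 'b::euclidean_space) \<Rightarrow> bool" where
  "mart_diff M p F D \<longleftrightarrow>
     (\<forall>G V. G \<in> borel_measurable F \<longrightarrow> V \<in> borel_measurable M \<longrightarrow>
        integrable M (\<lambda>\<omega>. V \<omega> powr p) \<longrightarrow>
        (\<forall>\<omega>\<in>space M. 0 \<le> V \<omega> \<and> norm (G \<omega>) \<le> V \<omega> powr (p - 1)) \<longrightarrow>
        (\<integral>\<omega>. G \<omega> \<bullet> D \<omega> \<partial>M) = 0)"

lemma mart_diffD:
  assumes "mart_diff M p F D" "G \<in> borel_measurable F" "V \<in> borel_measurable M"
    "integrable M (\<lambda>\<omega>. V \<omega> powr p)"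
    "\<And>\<omega>. \<omega> \<in> space M \<Longrightarrow> 0 \<le> V \<omega>" "\<And>\<omega>. \<omega> \<in> space M \<Longrightarrow> norm (G \<omega>) \<le> V \<omega> powr (p - 1)"
  shows "(\<integral>\<omega>. G \<omega> \<bullet> D \<omega> \<partial>M) = 0"
  using assms unfolding mart_diff_def by blast

lemma integrable_dual_inner:
  assumes p: "1 \<le> p" and D: "moment_le M p v D"
    and [measurable]: "G \<in> borel_measurable M" "V \<in> borel_measurable M"
    and V: "integrable M (\<lambda>\<omega>. V \<omega> powr p)" "\<And>\<omega>. \<omega> \<in> space M \<Longrightarrow> 0 \<le> V \<omega>"
    and G: "\<And>\<omega>. \<omega> \<in> space M \<Longrightarrow> norm (G \<omega>) \<le> V \<omega> powr (p - 1)"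
  shows "integrable M (\<lambda>\<omega>. G \<omega> \<bullet> D \<omega>)"
proof (rule Bochner_Integration.integrable_bound)
  note [measurable] = moment_leD(1)[OF D]
  show "(\<lambda>\<omega>. G \<omega> \<bullet> D \<omega>) \<in> borel_measurable M" by measurable
  show "integrable M (\<lambda>\<omega>. V \<omega> powr p + norm (D \<omega>) powr p)"
    using V moment_leD[OF D] by auto
  show "AE \<omega> in M. norm (G \<omega> \<bullet> D \<omega>) \<le> norm (V \<omega> powr p + norm (D \<omega>) powr p)"
  proof (intro AE_I2)
    fix \<omega> assume w: "\<omega> \<in> space M"
    have "norm (G \<omega> \<bullet> D \<omega>) \<le> norm (G \<omega>) * norm (D \<omega>)" by (simp add: Cauchy_Schwarz_ineq2)
    also have "\<dots> \<le> V \<omega> powr (p - 1) * norm (D \<omega>)" using G[OF w] by (intro mult_right_mono) auto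
    also have "\<dots> \<le> V \<omega> powr p + norm (D \<omega>) powr p" using p V w by (intro powr_minus_1_mult_le) auto
    finally show "norm (G \<omega> \<bullet> D \<omega>) \<le> norm (V \<omega> powr p + norm (D \<omega>) powr p)" by simp
  qed
qed

text \<open>With c = 4 p^2 3^p, twice the constant in the expansion of |x+y|^p, this is c exp(c): c
  multiplies each increment, and exp(c) bounds the product of the growth factors 1 + c w_k.\<close>

definition mart_const :: "real \<Rightarrow> real" where
  "mart_const p = 4 * p\<^sup>2 * 3 powr p * exp (4 * p\<^sup>2 * 3 powr p)"

lemma mart_const_nonneg [simp]: "0 \<le> mart_const p" by (simp add: mart_const_def)

text \<open>A Burkholder inequality with weights. In the expansion of |S + D|^p the linear term has
  mean zero and the quadratic one is split with weight w_m, so one more increment multiplies the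
  moment by 1 + c w_m and adds c w_m^(1-p/2) times the moment of D. As the weights sum to at most 1,
  the factors multiply to at most exp(c).\<close>

lemma moment_le_martingale:
  fixes D :: "nat \<Rightarrow> 'w \<Rightarrow> 'b::euclidean_space"
  assumes p: "2 \<le> p"
    and mart: "\<And>k. k < n \<Longrightarrow> mart_diff M p (F k) (D k)"
    and adapt: "\<And>k j. k < n \<Longrightarrow> j < k \<Longrightarrow> D j \<in> borel_measurable (F k)"
    and D: "\<And>k. k < n \<Longrightarrow> moment_le M p (d k) (D k)"
    and w: "\<And>k. k < n \<Longrightarrow> 0 < w k" "(\<Sum>k<n. w k) \<le> 1"
  shows "moment_le M p (mart_const p * (\<Sum>k<n. w k powr (1 - p / 2) * d k)) (\<lambda>\<omega>. \<Sum>k<n. D k \<omega>)"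
proof -
  define c where "c = 4 * p\<^sup>2 * 3 powr p"
  have c0: "0 \<le> c" by (simp add: c_def)
  have w1: "w k \<le> 1" if "k < n" for k
  proof -
    have "w k \<le> (\<Sum>k<n. w k)" using that w(1) by (intro member_le_sum) (auto intro: less_imp_le)
    then show ?thesis using w(2) by simp
  qed
  have step: "moment_le M p (exp (c * (\<Sum>k<m. w k)) * (c * (\<Sum>k<m. w k powr (1 - p / 2) * d k)))
      (\<lambda>\<omega>. \<Sum>k<m. D k \<omega>)" if "m \<le> n" for m
    using that
  proof (induction m)
    case 0
    then show ?case by (simp add: moment_le_def)
  next
    case (Suc m)
    let ?S = "\<lambda>\<omega>. \<Sum>k<m. D k \<omega>"
    define s where "s = (\<integral>\<omega>. norm (?S \<omega>) powr p \<partial>M)"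
    define v where "v = w m powr (1 - p / 2)"
    define A where "A = exp (c * (\<Sum>k<m. w k))"
    define B where "B = c * (\<Sum>k<m. w k powr (1 - p / 2) * d k)"
    have m: "m < n" using Suc by simp
    note Dm = moment_leD[OF D[OF m]]
    have IH: "moment_le M p (A * B) ?S" unfolding A_def B_def using Suc by auto
    note S = moment_leD[OF IH]
    have d0: "0 \<le> d k" if "k < n" for k using moment_le_nonneg[OF D[OF that]] .
    have B0: "0 \<le> B" unfolding B_def using c0 d0 m by (auto intro!: mult_nonneg_nonneg sum_nonneg)
    \<comment> \<open>Weights are at most 1 and 1 - p/2 \<le> 0, so v also dominates the coefficient
      1 of the pure |D|^p term.\<close>
    have v1: "1 \<le> v"
      using powr_mono2'[of "1 - p / 2" "w m" 1] w(1)[OF m] w1[OF m] p by (simp add: v_def)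
    have sF: "?S \<in> borel_measurable (F m)" using adapt m by (intro borel_measurable_sum) auto
    \<comment> \<open>The gradient of |S|^p up to the factor p: it is determined by the past and has
      size |S|^(p-1), hence is an admissible test function with V = |S|.\<close>
    define G where "G \<omega> = norm (?S \<omega>) powr (p - 2) *\<^sub>R ?S \<omega>" for \<omega>
    have G: "G \<in> borel_measurable (F m)" unfolding G_def using sF by measurable
    have GM: "G \<in> borel_measurable M" unfolding G_def using S(1) by measurable
    have nG: "norm (G \<omega>) \<le> norm (?S \<omega>) powr (p - 1)" for \<omega>
      using powr_mult_base[of "norm (?S \<omega>)" "p - 2"] by (simp add: G_def mult.commute)
    have GD0: "(\<integral>\<omega>. G \<omega> \<bullet> D m \<omega> \<partial>M) = 0"
      using S p nG by (intro mart_diffD[OF mart[OF m] G, where V = "\<lambda>\<omega>. norm (?S \<omega>)"]) auto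
    have GDint: "integrable M (\<lambda>\<omega>. G \<omega> \<bullet> D m \<omega>)"
      using S p nG by (intro integrable_dual_inner[OF _ D[OF m] GM, where V = "\<lambda>\<omega>. norm (?S \<omega>)"]) auto
    define f where "f \<omega> = norm (?S \<omega>) powr p + p * (G \<omega> \<bullet> D m \<omega>)
        + (c / 2) * (w m * norm (?S \<omega>) powr p + 2 * v * norm (D m \<omega>) powr p)" for \<omega>
    have "moment_le M p ((1 + c * w m) * (A * B) + c * v * d m) (\<lambda>\<omega>. \<Sum>k<Suc m. D k \<omega>)"
    proof (rule moment_le_I[where f = f])
      show "integrable M f" unfolding f_def using S Dm GDint by auto
      have "(\<integral>\<omega>. f \<omega> \<partial>M) = s + (c / 2) * (w m * s + 2 * v * (\<integral>\<omega>. norm (D m \<omega>) powr p \<partial>M))"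
        unfolding f_def s_def using S Dm GDint GD0 by simp
      also have "\<dots> \<le> A * B + (c / 2) * (w m * (A * B) + 2 * v * d m)"
        using S(3) Dm(3) c0 w(1)[OF m] v1 unfolding s_def
        by (intro add_mono mult_left_mono) auto
      also have "\<dots> \<le> (1 + c * w m) * (A * B) + c * v * d m"
        using c0 w(1)[OF m] B0 by (simp add: A_def algebra_simps)
      finally show "(\<integral>\<omega>. f \<omega> \<partial>M) \<le> (1 + c * w m) * (A * B) + c * v * d m" .
      fix \<omega>
      have "norm (?S \<omega> + D m \<omega>) powr p \<le> norm (?S \<omega>) powr p + p * (G \<omega> \<bullet> D m \<omega>)
        + (c / 2) * (norm (?S \<omega>) powr (p - 2) * (norm (D m \<omega>))\<^sup>2 + norm (D m \<omega>) powr p)"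
        using norm_add_powr_le[OF p, of "?S \<omega>" "D m \<omega>"] by (simp add: c_def G_def)
      also have "\<dots> \<le> norm (?S \<omega>) powr p + p * (G \<omega> \<bullet> D m \<omega>)
        + (c / 2) * (w m * norm (?S \<omega>) powr p + v * norm (D m \<omega>) powr p + v * norm (D m \<omega>) powr p)"
      proof (intro add_mono mult_left_mono order.refl)
        show "norm (?S \<omega>) powr (p - 2) * (norm (D m \<omega>))\<^sup>2
            \<le> w m * norm (?S \<omega>) powr p + v * norm (D m \<omega>) powr p"
          unfolding v_def using w(1)[OF m] p by (intro powr_minus_2_mult_le) auto
        show "norm (D m \<omega>) powr p \<le> v * norm (D m \<omega>) powr p"
          using mult_right_mono[OF v1, of "norm (D m \<omega>) powr p"] by simp
      qed (use c0 p in auto)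
      finally show "norm (\<Sum>k<Suc m. D k \<omega>) powr p \<le> f \<omega>" by (simp add: f_def algebra_simps)
    qed (use S(1) Dm(1) in simp)
    then show ?case
    proof (rule moment_le_mono)
      have "(1 + c * w m) * (A * B) \<le> exp (c * w m) * (A * B)"
        using B0 by (intro mult_right_mono exp_ge_add_one_self) (auto simp: A_def)
      moreover have "c * v * d m \<le> exp (c * w m) * A * (c * v * d m)"
      proof -
        have "1 * 1 \<le> exp (c * w m) * A"
          unfolding A_def using c0 w(1) m
          by (intro mult_mono) (auto intro!: mult_nonneg_nonneg sum_nonneg less_imp_le[OF w(1)])
        then have "1 * (c * v * d m) \<le> exp (c * w m) * A * (c * v * d m)"
          using c0 v1 d0[OF m] by (intro mult_right_mono) auto
        then show ?thesis by simp
      qed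
      ultimately have "(1 + c * w m) * (A * B) + c * v * d m \<le> exp (c * w m) * A * (B + c * v * d m)"
        by (simp add: algebra_simps)
      also have "exp (c * w m) * A = exp (c * (\<Sum>k<Suc m. w k))"
        by (simp add: A_def algebra_simps exp_add)
      also have "B + c * v * d m = c * (\<Sum>k<Suc m. w k powr (1 - p / 2) * d k)"
        by (simp add: B_def v_def algebra_simps)
      finally show "(1 + c * w m) * (A * B) + c * v * d m \<le>
        exp (c * (\<Sum>k<Suc m. w k)) * (c * (\<Sum>k<Suc m. w k powr (1 - p / 2) * d k))" .
    qed
  qed
  have "moment_le M p (exp (c * (\<Sum>k<n. w k)) * (c * (\<Sum>k<n. w k powr (1 - p / 2) * d k)))
      (\<lambda>\<omega>. \<Sum>k<n. D k \<omega>)" by (rule step) simp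
  then show ?thesis
  proof (rule moment_le_mono)
    have "exp (c * (\<Sum>k<n. w k)) \<le> exp c" using mult_left_mono[OF w(2) c0] by simp
    moreover have "0 \<le> c * (\<Sum>k<n. w k powr (1 - p / 2) * d k)"
      using c0 moment_le_nonneg[OF D] by (intro mult_nonneg_nonneg sum_nonneg) auto
    ultimately have "exp (c * (\<Sum>k<n. w k)) * (c * (\<Sum>k<n. w k powr (1 - p / 2) * d k))
      \<le> exp c * (c * (\<Sum>k<n. w k powr (1 - p / 2) * d k))" by (rule mult_right_mono)
    then show "exp (c * (\<Sum>k<n. w k)) * (c * (\<Sum>k<n. w k powr (1 - p / 2) * d k))
      \<le> mart_const p * (\<Sum>k<n. w k powr (1 - p / 2) * d k)"
      by (simp add: mart_const_def c_def algebra_simps)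
  qed
qed

section \<open>Running maxima of martingales\<close>

definition running_max :: "(nat \<Rightarrow> 'w \<Rightarrow> 'b::real_normed_vector) \<Rightarrow> nat \<Rightarrow> 'w \<Rightarrow> real" where
  "running_max S n \<omega> = Max ((\<lambda>m. norm (S m \<omega>)) ` {..n})"

lemma running_max_0: "running_max S 0 \<omega> = norm (S 0 \<omega>)"
  by (simp add: running_max_def)

lemma running_max_Suc: "running_max S (Suc n) \<omega> = max (norm (S (Suc n) \<omega>)) (running_max S n \<omega>)"
  by (simp add: running_max_def atMost_Suc)

lemma running_max_ge: "m \<le> n \<Longrightarrow> norm (S m \<omega>) \<le> running_max S n \<omega>"
  by (auto simp: running_max_def intro!: Max_ge)

lemma running_max_nonneg [simp]: "0 \<le> running_max S n \<omega>"
  using running_max_ge[of 0 n S \<omega>] norm_ge_zero order_trans by blast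

lemma running_max_le: "(\<And>m. m \<le> n \<Longrightarrow> norm (S m \<omega>) \<le> c) \<Longrightarrow> running_max S n \<omega> \<le> c"
  by (simp add: running_max_def)

lemma measurable_running_max:
  fixes S :: "nat \<Rightarrow> 'w \<Rightarrow> 'b::euclidean_space"
  shows "(\<And>m. m \<le> n \<Longrightarrow> S m \<in> borel_measurable M) \<Longrightarrow> running_max S n \<in> borel_measurable M"
proof (induction n)
  case 0
  then have "S 0 \<in> borel_measurable M" by simp
  then show ?case by (subst running_max_0[abs_def]) (intro measurable_compose[OF _ borel_measurable_norm])
next
  case (Suc n)
  then have "S (Suc n) \<in> borel_measurable M" "running_max S n \<in> borel_measurable M" by auto
  then show ?case
    by (subst running_max_Suc[abs_def]) (intro borel_measurable_max measurable_compose[OF _ borel_measurable_norm])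
qed

lemma running_max_powr_le:
  assumes "1 \<le> p"
  shows "running_max S n \<omega> powr p \<le> (\<Sum>m\<le>n. norm (S m \<omega>) powr p)"
proof -
  have "running_max S n \<omega> \<in> (\<lambda>m. norm (S m \<omega>)) ` {..n}"
    unfolding running_max_def by (rule Max_in) auto
  then obtain m where m: "m \<le> n" "running_max S n \<omega> = norm (S m \<omega>)" by auto
  show ?thesis unfolding m(2) using m(1) by (intro member_le_sum) auto
qed

text \<open>
  Doob's maximal inequality: for nonnegative numbers \<open>s\<^sub>0, s\<^sub>1, \<dots>\<close> with running maxima
  \<open>t\<^sub>0, t\<^sub>1, \<dots>\<close> the increments of \<open>t\<^sub>k\<^bsup>p-1\<^esup> s\<^sub>k - (p-1)/p t\<^sub>k\<^bsup>p\<^esup>\<close> are at least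
  \<open>t\<^sub>k\<^bsup>p-1\<^esup> (s\<^sub>k\<^sub>+\<^sub>1 - s\<^sub>k)\<close>, whose expectation is nonnegative for a submartingale.
\<close>

lemma moment_le_running_max:
  fixes D :: "nat \<Rightarrow> 'w \<Rightarrow> 'b::euclidean_space"
  assumes p: "2 \<le> p"
    and mart: "\<And>k. k < n \<Longrightarrow> mart_diff M p (F k) (D k)"
    and adapt: "\<And>k j. k < n \<Longrightarrow> j < k \<Longrightarrow> D j \<in> borel_measurable (F k)"
    and D: "\<And>k. k < n \<Longrightarrow> moment_le M p (d k) (D k)"
    and S: "moment_le M p v (\<lambda>\<omega>. \<Sum>k<n. D k \<omega>)"
  shows "moment_le M p (4 powr p * v) (running_max (\<lambda>m \<omega>. \<Sum>k<m. D k \<omega>) n)"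
proof -
  define S where "S m \<omega> = (\<Sum>k<m. D k \<omega>)" for m \<omega>
  let ?T = "running_max S"
  have Dm: "D k \<in> borel_measurable M" if "k < n" for k using moment_leD(1)[OF D[OF that]] .
  have Sm: "S m \<in> borel_measurable M" if "m \<le> n" for m
    unfolding S_def using Dm that by (intro borel_measurable_sum) auto
  have SF: "S m \<in> borel_measurable (F k)" if "m \<le> k" "k < n" for m k
    unfolding S_def using adapt that by (intro borel_measurable_sum) auto
  have Tm: "?T m \<in> borel_measurable M" if "m \<le> n" for m
    using Sm that by (intro measurable_running_max) auto
  have TF: "?T k \<in> borel_measurable (F k)" if "k < n" for k
    using SF that by (intro measurable_running_max) auto
  have Sint: "\<exists>u. moment_le M p u (S m)" if "m \<le> n" for m
    using that
  proof (induction m)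
    case 0
    then show ?case by (auto simp: S_def moment_le_def)
  next
    case (Suc m)
    then obtain u where "moment_le M p u (S m)" by auto
    from moment_le_add[OF _ this D[of m]] show ?case using Suc p by (auto simp: S_def)
  qed
  have Sint': "integrable M (\<lambda>\<omega>. norm (S m \<omega>) powr p)" if "m \<le> n" for m
    using Sint[OF that] moment_leD(2) by blast
  have Tint: "integrable M (\<lambda>\<omega>. ?T m \<omega> powr p)" if "m \<le> n" for m
  proof (rule Bochner_Integration.integrable_bound)
    show "integrable M (\<lambda>\<omega>. \<Sum>k\<le>m. norm (S k \<omega>) powr p)"
      using Sint' that by auto
    show "AE \<omega> in M. norm (?T m \<omega> powr p) \<le> norm (\<Sum>k\<le>m. norm (S k \<omega>) powr p)"
      using running_max_powr_le[of p S m] p by (intro AE_I2) (simp add: sum_nonneg)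
  qed (use Tm[OF that] in measurable)
  define V where "V m \<omega> = p * (?T m \<omega> powr (p - 1) * norm (S m \<omega>)) - (p - 1) * ?T m \<omega> powr p" for m \<omega>
  have TSint: "integrable M (\<lambda>\<omega>. ?T m \<omega> powr (p - 1) * norm (S m \<omega>))" if "m \<le> n" for m
  proof (rule Bochner_Integration.integrable_bound[OF Tint[OF that]])
    show "(\<lambda>\<omega>. ?T m \<omega> powr (p - 1) * norm (S m \<omega>)) \<in> borel_measurable M"
      using Tm[OF that] Sm[OF that] by measurable
    show "AE \<omega> in M. norm (?T m \<omega> powr (p - 1) * norm (S m \<omega>)) \<le> norm (?T m \<omega> powr p)"
    proof (intro AE_I2)
      fix \<omega>
      have "?T m \<omega> powr (p - 1) * norm (S m \<omega>) \<le> ?T m \<omega> powr (p - 1) * ?T m \<omega>"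
        by (intro mult_left_mono running_max_ge) auto
      also have "\<dots> = ?T m \<omega> powr p"
        using powr_mult_base[of "?T m \<omega>" "p - 1"] by (simp add: mult.commute)
      finally show "norm (?T m \<omega> powr (p - 1) * norm (S m \<omega>)) \<le> norm (?T m \<omega> powr p)" by simp
    qed
  qed
  have Vint: "integrable M (V m)" if "m \<le> n" for m
    unfolding V_def using TSint[OF that] Tint[OF that] by auto
  have V0: "0 \<le> (\<integral>\<omega>. V m \<omega> \<partial>M)" if "m \<le> n" for m
    using that
  proof (induction m)
    case 0
    then show ?case by (simp add: V_def S_def running_max_0)
  next
    case (Suc m)
    then have m: "m < n" by simp
    define G where "G \<omega> = (p * ?T m \<omega> powr (p - 1)) *\<^sub>R sgn (S m \<omega>)" for \<omega>
    \<comment> \<open>\<open>mart_diff\<close> asks for a bound by a power p - 1, so the factor p of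
      G is moved into the base as p^(1/(p-1)).\<close>
    define U where "U \<omega> = p powr (1 / (p - 1)) * ?T m \<omega>" for \<omega>
    have GF: "G \<in> borel_measurable (F m)"
      unfolding G_def
      by (intro borel_measurable_scaleR borel_measurable_times borel_measurable_const powr_real_measurable
          TF[OF m] measurable_compose[OF SF[OF order.refl m] borel_measurable_sgn])
    have GM: "G \<in> borel_measurable M"
      unfolding G_def using m
      by (intro borel_measurable_scaleR borel_measurable_times borel_measurable_const powr_real_measurable
          Tm measurable_compose[OF Sm borel_measurable_sgn]) auto
    have UM: "U \<in> borel_measurable M" unfolding U_def using m by (intro borel_measurable_times borel_measurable_const Tm) auto
    have Uint: "integrable M (\<lambda>\<omega>. U \<omega> powr p)"
      unfolding U_def powr_mult using Tint[of m] m by auto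
    have U0: "0 \<le> U \<omega>" for \<omega> by (simp add: U_def)
    have "U \<omega> powr (p - 1) = p * ?T m \<omega> powr (p - 1)" for \<omega>
      using p unfolding U_def powr_mult powr_powr by simp
    then have nG: "norm (G \<omega>) \<le> U \<omega> powr (p - 1)" for \<omega>
      using p by (simp add: G_def norm_sgn)
    have GD0: "(\<integral>\<omega>. G \<omega> \<bullet> D m \<omega> \<partial>M) = 0"
      by (rule mart_diffD[OF mart[OF m] GF UM Uint U0 nG])
    have GDint: "integrable M (\<lambda>\<omega>. G \<omega> \<bullet> D m \<omega>)"
      by (rule integrable_dual_inner[OF _ D[OF m] GM UM Uint U0 nG]) (use p in auto)
    have pw: "V m \<omega> + G \<omega> \<bullet> D m \<omega> \<le> V (Suc m) \<omega>" for \<omega>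
    proof -
      define t where "t = ?T m \<omega>"
      define s where "s = norm (S m \<omega>)"
      define s' where "s' = norm (S (Suc m) \<omega>)"
      have t: "0 \<le> t" by (simp add: t_def)
      have s': "0 \<le> s'" by (simp add: s'_def)
      \<comment> \<open>The submartingale property of the norm: projecting the new sum onto the
        direction of the old one can only shorten it. Where the old sum is 0, \<open>sgn\<close> is
        0 and the claim is trivial.\<close>
      have inner_le: "s + sgn (S m \<omega>) \<bullet> D m \<omega> \<le> s'"
      proof -
        have "s + sgn (S m \<omega>) \<bullet> D m \<omega> = sgn (S m \<omega>) \<bullet> S (Suc m) \<omega>"
          by (cases "S m \<omega> = 0")
            (auto simp: s_def S_def inner_add_right sgn_div_norm power2_norm_eq_inner[symmetric] power2_eq_square)
        also have "\<dots> \<le> norm (sgn (S m \<omega>)) * s'" unfolding s'_def by (rule norm_cauchy_schwarz)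
        also have "\<dots> \<le> 1 * s'" using s' by (intro mult_right_mono) (auto simp: norm_sgn)
        finally show ?thesis by simp
      qed
      have "G \<omega> \<bullet> D m \<omega> = p * t powr (p - 1) * (sgn (S m \<omega>) \<bullet> D m \<omega>)" by (simp add: G_def t_def)
      also have "\<dots> \<le> p * t powr (p - 1) * (s' - s)"
        using inner_le p by (intro mult_left_mono) auto
      finally have 1: "V m \<omega> + G \<omega> \<bullet> D m \<omega> \<le> p * t powr (p - 1) * s' - (p - 1) * t powr p"
        by (simp add: V_def t_def[symmetric] s_def[symmetric] algebra_simps)
      have pm: "z powr (p - 1) * z = z powr p" if "0 \<le> z" for z
        using powr_mult_base[OF that, of "p - 1"] by (simp add: mult.commute)
      have 2: "p * t powr (p - 1) * s' - (p - 1) * t powr p \<le> V (Suc m) \<omega>"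
      proof (cases "s' \<le> t")
        case True
        then have "?T (Suc m) \<omega> = t" by (simp add: running_max_Suc t_def s'_def max_def)
        then show ?thesis by (simp add: V_def s'_def)
      next
        case False
        then have "?T (Suc m) \<omega> = s'" by (simp add: running_max_Suc t_def s'_def)
        then have "V (Suc m) \<omega> = s' powr p"
          using pm[OF s'] by (simp add: V_def s'_def[symmetric] algebra_simps)
        \<comment> \<open>At a new maximum, \<open>V (Suc m)\<close> is s'^p, which lies above its
          tangent at the old maximum t.\<close>
        moreover have "t powr p + p * t powr (p - 1) * (s' - t) \<le> s' powr p"
          using p t s' by (intro powr_tangent) auto
        ultimately show ?thesis using pm[OF t] by (simp add: algebra_simps)
      qed
      show ?thesis using 1 2 by simp
    qed
    have "0 \<le> (\<integral>\<omega>. V m \<omega> + G \<omega> \<bullet> D m \<omega> \<partial>M)"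
      using Suc Vint[of m] GDint GD0 by simp
    also have "\<dots> \<le> (\<integral>\<omega>. V (Suc m) \<omega> \<partial>M)"
      using Vint[of m] Vint[of "Suc m"] Suc(2) GDint pw by (intro integral_mono) auto
    finally show ?case .
  qed
  have pw: "V n \<omega> \<le> p * 4 powr (p - 1) * norm (S n \<omega>) powr p - (p / 4) * ?T n \<omega> powr p" for \<omega>
  proof -
    define t where "t = ?T n \<omega>"
    define s where "s = norm (S n \<omega>)"
    have s: "0 \<le> s" "s \<le> t" by (auto simp: s_def t_def intro!: running_max_ge)
    have pm: "z powr (p - 1) * z = z powr p" if "0 \<le> z" for z
      using powr_mult_base[OF that, of "p - 1"] by (simp add: mult.commute)
    \<comment> \<open>Giving t^p the share 1/4 leaves p/4 of it on the other side, as p - 1 \<ge>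
      p/2; the maximum is integrable, so it can be absorbed there.\<close>
    have "t powr (p - 1) * s \<le> t powr p / 4 + 4 powr (p - 1) * s powr p"
    proof (cases "4 * s \<le> t")
      case True
      have "t powr (p - 1) * s \<le> t powr (p - 1) * (t / 4)" using True by (intro mult_left_mono) auto
      also have "\<dots> = t powr p / 4" using pm[of t] s by simp
      finally show ?thesis by (simp add: add_increasing2)
    next
      case False
      have "t powr (p - 1) * s \<le> (4 * s) powr (p - 1) * s"
        using False p s by (intro mult_right_mono powr_mono2) auto
      also have "\<dots> = 4 powr (p - 1) * s powr p" using pm[OF s(1)] by (simp add: powr_mult)
      finally show ?thesis by (simp add: add_increasing)
    qed
    then have "p * (t powr (p - 1) * s) \<le> p * (t powr p / 4 + 4 powr (p - 1) * s powr p)"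
      using p by (intro mult_left_mono) auto
    moreover have "(p / 2) * t powr p \<le> (p - 1) * t powr p" using p by (intro mult_right_mono) auto
    ultimately show ?thesis unfolding V_def t_def[symmetric] s_def[symmetric] by (simp add: algebra_simps)
  qed
  have "0 \<le> (\<integral>\<omega>. p * 4 powr (p - 1) * norm (S n \<omega>) powr p - (p / 4) * ?T n \<omega> powr p \<partial>M)"
    using V0[of n] integral_mono[OF Vint[of n] _ pw] Sint'[of n] Tint[of n] by fastforce
  also have "\<dots> = p * 4 powr (p - 1) * (\<integral>\<omega>. norm (S n \<omega>) powr p \<partial>M) - (p / 4) * (\<integral>\<omega>. ?T n \<omega> powr p \<partial>M)"
    using Sint'[of n] Tint[of n] by simp
  finally have "p * (\<integral>\<omega>. ?T n \<omega> powr p \<partial>M) \<le> p * (4 * 4 powr (p - 1) * (\<integral>\<omega>. norm (S n \<omega>) powr p \<partial>M))"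
    by (simp add: algebra_simps)
  then have "(\<integral>\<omega>. ?T n \<omega> powr p \<partial>M) \<le> 4 powr p * (\<integral>\<omega>. norm (S n \<omega>) powr p \<partial>M)"
    using p powr_mult_base[of 4 "p - 1"] by simp
  also have "\<dots> \<le> 4 powr p * v" using moment_leD(3)[OF assms(5)] by (simp add: S_def)
  finally show ?thesis
    unfolding moment_le_def S_def[abs_def, symmetric] using Tm Tint by simp
qed

subsection \<open>Gaussian increments\<close>

lemma norm_matrix_vector_le:
  fixes A :: "real ^ 'm ^ 'd"
  shows "norm (A *v x) \<le> norm A * norm x"
proof -
  have "norm (A *v x) = L2_set (\<lambda>i. norm (A $ i \<bullet> x)) UNIV"
    by (simp add: norm_vec_def matrix_mult_dot)
  also have "\<dots> \<le> L2_set (\<lambda>i. norm (A $ i) * norm x) UNIV"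
    by (intro L2_set_mono) (auto simp: Cauchy_Schwarz_ineq2)
  also have "\<dots> = norm A * norm x"
    by (simp add: L2_set_left_distrib norm_vec_def)
  finally show ?thesis .
qed

lemma borel_measurable_vec_nth_compose:
  fixes Z :: "'w \<Rightarrow> 'b::{real_normed_vector, second_countable_topology} ^ 'm"
  shows "Z \<in> borel_measurable N \<Longrightarrow> (\<lambda>\<omega>. Z \<omega> $ i) \<in> borel_measurable N"
  by (erule measurable_compose) (intro borel_measurable_continuous_onI continuous_intros)

lemma borel_measurable_matrix_vector:
  fixes A :: "'w \<Rightarrow> real ^ 'm ^ 'd"
  assumes A: "A \<in> borel_measurable N" and Z: "Z \<in> borel_measurable N"
  shows "(\<lambda>\<omega>. A \<omega> *v Z \<omega>) \<in> borel_measurable N"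
  using A Z by (rule borel_measurable_continuous_Pair)
    (auto simp: matrix_vector_mult_def split_beta intro!: continuous_intros)

text \<open>With k the ceiling of p, (2k)! / (2^k k!) is the 2k-th moment of a standard normal
  variable, which together with 1 dominates its p-th moment; m^p is the price of summing m
  coordinates by Minkowski.\<close>

definition gauss_const :: "real \<Rightarrow> real \<Rightarrow> real" where
  "gauss_const m p = m powr p * (1 + fact (2 * nat \<lceil>p\<rceil>) / (2 ^ nat \<lceil>p\<rceil> * fact (nat \<lceil>p\<rceil>)))"

lemma gauss_const_nonneg [simp]: "0 \<le> gauss_const m p"
  by (simp add: gauss_const_def)

lemma prod_Basis_cart:
  fixes h :: "real ^ 'm \<Rightarrow> real \<Rightarrow> ennreal"
  shows "(\<Prod>b\<in>Basis. h b (x \<bullet> b)) = (\<Prod>j\<in>UNIV. h (axis j 1) (x $ j))"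
proof -
  have *: "(Basis :: (real ^ 'm) set) = range (\<lambda>j. axis j 1)" by (auto simp: Basis_vec_def)
  have "inj (\<lambda>j::'m. axis j (1::real))" by (auto simp: inj_on_def axis_eq_axis)
  from prod.reindex[OF this, of "\<lambda>b. h b (x \<bullet> b)"] show ?thesis
    unfolding * by (simp add: inner_axis)
qed

lemma (in prob_space) gaussian_component:
  fixes Z :: "'a \<Rightarrow> real ^ 'm"
  assumes s: "0 < s"
    and Z: "distributed M lborel Z (\<lambda>x. ennreal (\<Prod>i\<in>UNIV. normal_density 0 s (x $ i)))"
  shows "distributed M lborel (\<lambda>\<omega>. Z \<omega> $ i) (normal_density 0 s)"
proof -
  have [measurable]: "Z \<in> borel_measurable M" using distributed_measurable[OF Z] by simp
  have meas: "(\<lambda>\<omega>. Z \<omega> $ i) \<in> borel_measurable M" by (intro borel_measurable_vec_nth_compose) simp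
  have one: "(\<integral>\<^sup>+x. ennreal (normal_density 0 s x) \<partial>lborel) = 1"
    using s by (subst nn_integral_eq_integral) auto

  show ?thesis
    unfolding distributed_def
  proof (intro conjI)
    show "distr M lborel (\<lambda>\<omega>. Z \<omega> $ i) = density lborel (\<lambda>x. ennreal (normal_density 0 s x))"
    proof (rule measure_eqI)
      fix A assume "A \<in> sets (distr M lborel (\<lambda>\<omega>. Z \<omega> $ i))"
      then have A[measurable]: "A \<in> sets borel" by simp
      \<comment> \<open>The indicator of A sits in the i-th factor only; every other factor is a
        full normal density and integrates to 1.\<close>
      define h where "h b x = ennreal (normal_density 0 s x) * (if b = axis i 1 then indicator A x else 1)"
        for b :: "real ^ 'm" and x
      have "emeasure (distr M lborel (\<lambda>\<omega>. Z \<omega> $ i)) A = (\<integral>\<^sup>+\<omega>. indicator A (Z \<omega> $ i) \<partial>M)"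
        using meas by (subst emeasure_distr) (auto simp: nn_integral_indicator[symmetric] indicator_def intro!: nn_integral_cong)
      also have "\<dots> = (\<integral>\<^sup>+x. ennreal (\<Prod>j\<in>UNIV. normal_density 0 s (x $ j)) * indicator A (x $ i) \<partial>lborel)"
        by (rule distributed_nn_integral[OF Z, symmetric]) measurable
      also have "\<dots> = (\<integral>\<^sup>+x. (\<Prod>b\<in>Basis. h b (x \<bullet> b)) \<partial>lborel)"
      proof (intro nn_integral_cong)
        fix x :: "real ^ 'm"
        have "(\<Prod>b\<in>Basis. h b (x \<bullet> b)) = (\<Prod>j\<in>UNIV. ennreal (normal_density 0 s (x $ j)) *
             (if j = i then indicator A (x $ j) else 1))"
          using prod_Basis_cart[of h x] unfolding h_def by (simp add: axis_eq_axis)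
        also have "\<dots> = (\<Prod>j\<in>UNIV. ennreal (normal_density 0 s (x $ j))) * indicator A (x $ i)"
          by (simp add: prod.distrib)
        finally show "ennreal (\<Prod>j\<in>UNIV. normal_density 0 s (x $ j)) * indicator A (x $ i) = (\<Prod>b\<in>Basis. h b (x \<bullet> b))"
          by (simp add: prod_ennreal)
      qed
      also have "\<dots> = (\<Prod>b\<in>Basis. \<integral>\<^sup>+x. h b x \<partial>lborel)"
        by (rule nn_integral_lborel_prod) (auto simp: h_def)
      also have "\<dots> = (\<Prod>b\<in>(Basis :: (real ^ 'm) set). if b = axis i 1 then (\<integral>\<^sup>+x. ennreal (normal_density 0 s x) * indicator A x \<partial>lborel) else 1)"
        by (intro prod.cong) (auto simp: h_def one)
      also have "\<dots> = (\<integral>\<^sup>+x. ennreal (normal_density 0 s x) * indicator A x \<partial>lborel)"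
        by (subst prod.delta) (auto simp: axis_in_Basis_iff)
      also have "\<dots> = emeasure (density lborel (normal_density 0 s)) A"
        by (subst emeasure_density) auto
      finally show "emeasure (distr M lborel (\<lambda>\<omega>. Z \<omega> $ i)) A = emeasure (density lborel (normal_density 0 s)) A" .
    qed simp
  qed (use meas in auto)
qed

lemma (in prob_space) gaussian_moment:
  fixes Z :: "'a \<Rightarrow> real ^ 'm"
  assumes s: "0 < s" and p: "1 \<le> p"
    and Z: "distributed M lborel Z (\<lambda>x. ennreal (\<Prod>i\<in>UNIV. normal_density 0 s (x $ i)))"
  shows "moment_le M p (gauss_const CARD('m) p * s powr p) Z" "expectation (\<lambda>\<omega>. Z \<omega> $ i) = 0"
proof -
  define k where "k = nat \<lceil>p\<rceil>"
  define g :: real where "g = 1 + fact (2 * k) / (2 ^ k * fact k)"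
  have g: "0 \<le> g" by (simp add: g_def)
  have Zm: "Z \<in> borel_measurable M" using distributed_measurable[OF Z] by simp
  note comp = gaussian_component[OF s Z]
  show "expectation (\<lambda>\<omega>. Z \<omega> $ i) = 0"
    by (rule normal_distributed_expectation[OF s comp])
  have "moment_le M p ((s * g powr (1 / p)) powr p) (\<lambda>\<omega>. Z \<omega> $ i)" for i
  proof (rule moment_le_I)
    show "(\<lambda>\<omega>. Z \<omega> $ i) \<in> borel_measurable M" using Zm by (rule borel_measurable_vec_nth_compose)
    have "has_bochner_integral lborel (\<lambda>x. normal_density 0 s x * (x - 0) ^ (2 * k))
        (fact (2 * k) / ((2 / s\<^sup>2) ^ k * fact k))" by (rule normal_moment_even[OF s])
    then have b: "has_bochner_integral lborel (\<lambda>x. normal_density 0 s x * x ^ (2 * k))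
        (fact (2 * k) / ((2 / s\<^sup>2) ^ k * fact k))" by simp
    have int: "integrable M (\<lambda>\<omega>. (Z \<omega> $ i) ^ (2 * k))"
      using distributed_integrable[OF comp[of i], of "\<lambda>x. x ^ (2 * k)"] b
      by (auto simp: has_bochner_integral_iff)
    have val: "expectation (\<lambda>\<omega>. (Z \<omega> $ i) ^ (2 * k)) = fact (2 * k) / ((2 / s\<^sup>2) ^ k * fact k)"
      using distributed_integral[OF comp[of i], of "\<lambda>x. x ^ (2 * k)"] b
      by (auto simp: has_bochner_integral_iff)
    let ?f = "\<lambda>\<omega>. s powr p * (1 + (Z \<omega> $ i) ^ (2 * k) / s ^ (2 * k))"
    show "integrable M ?f" using int by auto
    have "expectation ?f = s powr p * (1 + fact (2 * k) / ((2 / s\<^sup>2) ^ k * fact k) / s ^ (2 * k))"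
      using int val by (simp add: prob_space)
    also have "\<dots> = s powr p * g"
      using s by (simp add: g_def power_divide field_simps flip: power_mult)
    finally show "expectation ?f \<le> (s * g powr (1 / p)) powr p"
      using p g s by (simp add: powr_mult powr_powr)
    fix \<omega>
    define x where "x = \<bar>Z \<omega> $ i\<bar> / s"
    have x: "0 \<le> x" using s by (simp add: x_def)
    have "x powr p \<le> 1 + x ^ (2 * k)"
    proof (cases "x \<le> 1")
      case True
      then have "x powr p \<le> 1 powr p" using x p by (intro powr_mono2) auto
      then show ?thesis using x by (simp add: add_increasing2)
    next
      case False
      have "p \<le> real k" unfolding k_def using p by linarith
      then have "p \<le> real (2 * k)" by simp
      then have "x powr p \<le> x powr real (2 * k)" using False by (intro powr_mono) auto
      then show ?thesis using False by (simp add: powr_realpow del: of_nat_mult)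
    qed
    then have "s powr p * x powr p \<le> s powr p * (1 + x ^ (2 * k))" by (intro mult_left_mono) auto
    moreover have "x ^ (2 * k) = (Z \<omega> $ i) ^ (2 * k) / s ^ (2 * k)"
      by (simp add: x_def power_divide power_even_abs)
    moreover have "s powr p * x powr p = norm (Z \<omega> $ i) powr p"
      using s by (simp add: x_def powr_mult[symmetric])
    ultimately show "norm (Z \<omega> $ i) powr p \<le> ?f \<omega>" by simp
  qed
  note comp_le = this
  have [measurable]: "(\<lambda>\<omega>. Z \<omega> $ i) \<in> borel_measurable M" for i
    by (rule borel_measurable_vec_nth_compose[OF Zm])
  have "moment_le M p ((s * g powr (1 / p)) powr p) (\<lambda>\<omega>. \<bar>Z \<omega> $ i\<bar>)" for i
    by (rule moment_le_dom[OF comp_le[of i]]) (use p in auto)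
  then have "moment_le M p ((\<Sum>i\<in>(UNIV::'m set). s * g powr (1 / p)) powr p) (\<lambda>\<omega>. \<Sum>i\<in>UNIV. \<bar>Z \<omega> $ i\<bar>)"
    using p s by (intro moment_le_sum) auto
  then have "moment_le M p ((\<Sum>i\<in>(UNIV::'m set). s * g powr (1 / p)) powr p) Z"
  proof (rule moment_le_dom)
    show "norm (Z \<omega>) \<le> norm (\<Sum>i\<in>UNIV. \<bar>Z \<omega> $ i\<bar>)" for \<omega>
      using norm_le_l1_cart[of "Z \<omega>"] by simp
  qed (use p Zm in auto)
  also have "(\<Sum>i\<in>(UNIV::'m set). s * g powr (1 / p)) powr p = gauss_const CARD('m) p * s powr p"
    using p g by (simp add: powr_mult powr_powr gauss_const_def g_def k_def)
  finally show "moment_le M p (gauss_const CARD('m) p * s powr p) Z" .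
qed

subsection \<open>Adapted stochastic sums\<close>

lemma (in prob_space) indep_var_indep_set:
  assumes ind: "indep_set (sets F) (sets H)" and u: "u \<in> measurable F N" and v: "v \<in> measurable H N'"
    and sp: "space F = space M" "space H = space M"
  shows "indep_var N u N' v"
proof -
  have sub: "sets F \<subseteq> events" "sets H \<subseteq> events"
    using indep_setD_ev1[OF ind] indep_setD_ev2[OF ind] by auto
  have "sigma_sets (space F) {u -` A \<inter> space F |A. A \<in> sets N} \<subseteq> sets F"
    using measurable_sets[OF u] by (intro sets.sigma_sets_subset) auto
  moreover have "sigma_sets (space H) {v -` A \<inter> space H |A. A \<in> sets N'} \<subseteq> sets H"
    using measurable_sets[OF v] by (intro sets.sigma_sets_subset) auto
  ultimately have "indep_set (sigma_sets (space M) {u -` A \<inter> space M |A. A \<in> sets N})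
     (sigma_sets (space M) {v -` A \<inter> space M |A. A \<in> sets N'})"
    using ind sub unfolding indep_sets2_eq sp by (meson subsetD subset_trans)
  moreover have "random_variable N u" "random_variable N' v"
    using u v sub sp by (auto simp: measurable_def)
  ultimately show ?thesis unfolding indep_var_eq by auto
qed

text \<open>One noise process, described through its increments: adapted, Gaussian, independent of
  the past. The filtration may be larger than the one generated by W, which makes the results
  applicable to interacting particles.\<close>

locale driven = prob_space M for M :: "'w measure" +
  fixes F :: "real \<Rightarrow> 'w measure" and W :: "real \<Rightarrow> 'w \<Rightarrow> real ^ 'm"
  assumes space_F: "space (F t) = space M"
    and sets_F: "sets (F t) \<subseteq> sets M"
    and sets_F_mono: "s \<le> t \<Longrightarrow> sets (F s) \<subseteq> sets (F t)"
    and incr_measurable: "0 \<le> s \<Longrightarrow> s \<le> t \<Longrightarrow> t \<le> u \<Longrightarrow> (\<lambda>\<omega>. W t \<omega> - W s \<omega>) \<in> borel_measurable (F u)"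
    and incr_distributed: "0 \<le> s \<Longrightarrow> s < t \<Longrightarrow> distributed M lborel (\<lambda>\<omega>. W t \<omega> - W s \<omega>)
          (\<lambda>x. ennreal (\<Prod>i\<in>UNIV. normal_density 0 (sqrt (t - s)) (x $ i)))"
    and incr_indep: "0 \<le> s \<Longrightarrow> s < t \<Longrightarrow> indep_set (sets (F s))
          (sets (vimage_algebra (space M) (\<lambda>\<omega>. W t \<omega> - W s \<omega>) borel))"
begin

lemma measurable_F_M: "f \<in> measurable (F t) N \<Longrightarrow> f \<in> measurable M N"
  using sets_F[of t] space_F[of t] by (auto simp: measurable_def)

lemma measurable_F_mono: "f \<in> measurable (F s) N \<Longrightarrow> s \<le> t \<Longrightarrow> f \<in> measurable (F t) N"
  using sets_F_mono[of s t] space_F by (auto simp: measurable_def)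

text \<open>\<open>indep_var\<close> asks both variables to have one value type, so adapted factors
  and increments meet through real-valued functions such as norms and coordinates.\<close>

lemma indep_var_incr:
  fixes u :: "'w \<Rightarrow> real" and g :: "real ^ 'm \<Rightarrow> real"
  assumes st: "0 \<le> s" "s < t" and u: "u \<in> borel_measurable (F s)" and g: "g \<in> borel_measurable borel"
  shows "indep_var borel u borel (\<lambda>\<omega>. g (W t \<omega> - W s \<omega>))"
  using incr_indep[OF st] u
  by (rule indep_var_indep_set) (auto simp: space_F intro!: measurable_compose[OF measurable_vimage_algebra1 g])

text \<open>A is known at time s and the increment Z is independent of that past, so the expectation
  of |A|^p |Z|^p factors, and the Gaussian moment supplies (t-s)^(p/2).\<close>

lemma moment_le_stoch_incr:
  fixes A :: "'w \<Rightarrow> real ^ 'm ^ 'd"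
  assumes p: "1 \<le> p" and st: "0 \<le> s" "s < t"
    and A: "moment_le M p v A" "A \<in> borel_measurable (F s)"
  shows "moment_le M p (gauss_const CARD('m) p * (t - s) powr (p / 2) * v) (\<lambda>\<omega>. A \<omega> *v (W t \<omega> - W s \<omega>))"
proof -
  let ?Z = "\<lambda>\<omega>. W t \<omega> - W s \<omega>"
  have Zm: "?Z \<in> borel_measurable M"
    using st by (intro measurable_F_M[OF incr_measurable[OF _ _ order.refl]]) auto
  have Z: "moment_le M p (gauss_const CARD('m) p * (t - s) powr (p / 2)) ?Z"
    using gaussian_moment(1)[OF _ p incr_distributed[OF st]] st
    by (simp add: powr_half_sqrt[symmetric] powr_powr)
  have ind: "indep_var borel (\<lambda>\<omega>. norm (A \<omega>) powr p) borel (\<lambda>\<omega>. norm (?Z \<omega>) powr p)"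
    using indep_var_incr[OF st, of "\<lambda>\<omega>. norm (A \<omega>) powr p" "\<lambda>z. norm z powr p"] A(2) by simp
  show ?thesis
  proof (rule moment_le_I)
    show "(\<lambda>\<omega>. A \<omega> *v ?Z \<omega>) \<in> borel_measurable M"
      using moment_leD(1)[OF A(1)] Zm by (rule borel_measurable_matrix_vector)
    show "integrable M (\<lambda>\<omega>. norm (A \<omega>) powr p * norm (?Z \<omega>) powr p)"
      using indep_var_integrable[OF ind] moment_leD(2)[OF A(1)] moment_leD(2)[OF Z] by simp
    have "expectation (\<lambda>\<omega>. norm (A \<omega>) powr p * norm (?Z \<omega>) powr p) =
       expectation (\<lambda>\<omega>. norm (A \<omega>) powr p) * expectation (\<lambda>\<omega>. norm (?Z \<omega>) powr p)"
      using indep_var_lebesgue_integral[OF ind] moment_leD(2)[OF A(1)] moment_leD(2)[OF Z] by simp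
    also have "\<dots> \<le> v * (gauss_const CARD('m) p * (t - s) powr (p / 2))"
      using moment_leD(3)[OF A(1)] moment_leD(3)[OF Z] moment_le_nonneg[OF A(1)]
      by (intro mult_mono) (auto intro!: Bochner_Integration.integral_nonneg)
    finally show "expectation (\<lambda>\<omega>. norm (A \<omega>) powr p * norm (?Z \<omega>) powr p) \<le>
       gauss_const CARD('m) p * (t - s) powr (p / 2) * v" by (simp add: mult.commute)
    fix \<omega>
    have "norm (A \<omega> *v ?Z \<omega>) powr p \<le> (norm (A \<omega>) * norm (?Z \<omega>)) powr p"
      using p by (intro powr_mono2 norm_matrix_vector_le) auto
    then show "norm (A \<omega> *v ?Z \<omega>) powr p \<le> norm (A \<omega>) powr p * norm (?Z \<omega>) powr p"
      by (simp add: powr_mult)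
  qed
qed

text \<open>The pairing of G with A Z is a double sum of terms u_ij Z_j with adapted u_ij. The bound
  V^(p-1) |A| \<le> V^p + |A|^p makes u_ij integrable, and independence gives each term mean
  zero.\<close>

lemma mart_diff_stoch_incr:
  fixes A :: "'w \<Rightarrow> real ^ 'm ^ 'd"
  assumes p: "1 \<le> p" and st: "0 \<le> s" "s < t"
    and A: "moment_le M p v A" "A \<in> borel_measurable (F s)"
  shows "mart_diff M p (F s) (\<lambda>\<omega>. A \<omega> *v (W t \<omega> - W s \<omega>))"
  unfolding mart_diff_def
proof (intro allI impI)
  let ?Z = "\<lambda>\<omega>. W t \<omega> - W s \<omega>"
  fix G :: "'w \<Rightarrow> real ^ 'd" and V
  assume G: "G \<in> borel_measurable (F s)" and V: "V \<in> borel_measurable M" "integrable M (\<lambda>\<omega>. V \<omega> powr p)"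
    and GV: "\<forall>\<omega>\<in>space M. 0 \<le> V \<omega> \<and> norm (G \<omega>) \<le> V \<omega> powr (p - 1)"
  have Zm: "?Z \<in> borel_measurable M"
    using st by (intro measurable_F_M[OF incr_measurable[OF _ _ order.refl]]) auto
  have Z: "moment_le M p (gauss_const CARD('m) p * (t - s) powr (p / 2)) ?Z"
    using gaussian_moment(1)[OF _ p incr_distributed[OF st]] st
    by (simp add: powr_half_sqrt[symmetric] powr_powr)
  have Zi: "integrable M (\<lambda>\<omega>. ?Z \<omega> $ j)" "expectation (\<lambda>\<omega>. ?Z \<omega> $ j) = 0" for j
  proof -
    show "integrable M (\<lambda>\<omega>. ?Z \<omega> $ j)"
    proof (rule Bochner_Integration.integrable_bound)
      show "integrable M ?Z" by (rule moment_le_integrable[OF p Z])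
      show "AE \<omega> in M. norm (?Z \<omega> $ j) \<le> norm (?Z \<omega>)"
        by (intro AE_I2) (simp add: component_le_norm_cart del: vector_minus_component)
    qed (rule borel_measurable_vec_nth_compose[OF Zm])
    show "expectation (\<lambda>\<omega>. ?Z \<omega> $ j) = 0"
      using gaussian_moment(2)[OF _ p incr_distributed[OF st]] st by simp
  qed
  define u where "u i j \<omega> = G \<omega> $ i * A \<omega> $ i $ j" for i j \<omega>
  have u_meas: "u i j \<in> borel_measurable (F s)" for i j
    unfolding u_def using G A(2) by (intro borel_measurable_times borel_measurable_vec_nth_compose)
  have u_int: "integrable M (u i j)" for i j
  proof (rule Bochner_Integration.integrable_bound)
    show "integrable M (\<lambda>\<omega>. V \<omega> powr p + norm (A \<omega>) powr p)"
      using V moment_leD(2)[OF A(1)] by simp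
    show "AE \<omega> in M. norm (u i j \<omega>) \<le> norm (V \<omega> powr p + norm (A \<omega>) powr p)"
    proof (intro AE_I2)
      fix \<omega> assume w: "\<omega> \<in> space M"
      have "\<bar>A \<omega> $ i $ j\<bar> \<le> norm (A \<omega>)"
        using component_le_norm_cart[of "A \<omega> $ i" j] Finite_Cartesian_Product.norm_nth_le[of "A \<omega>" i]
        by simp
      then have "norm (u i j \<omega>) \<le> norm (G \<omega>) * norm (A \<omega>)"
        unfolding u_def by (simp add: abs_mult component_le_norm_cart mult_mono)
      also have "\<dots> \<le> V \<omega> powr (p - 1) * norm (A \<omega>)" using GV w by (intro mult_right_mono) auto
      also have "\<dots> \<le> V \<omega> powr p + norm (A \<omega>) powr p" using p GV w by (intro powr_minus_1_mult_le) auto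
      finally show "norm (u i j \<omega>) \<le> norm (V \<omega> powr p + norm (A \<omega>) powr p)" by simp
    qed
  qed (use measurable_F_M[OF u_meas] in simp)
  have ind: "indep_var borel (u i j) borel (\<lambda>\<omega>. ?Z \<omega> $ j)" for i j
    using indep_var_incr[OF st u_meas[of i j], of "\<lambda>z. z $ j"] by simp
  have prod: "integrable M (\<lambda>\<omega>. u i j \<omega> * ?Z \<omega> $ j)" "expectation (\<lambda>\<omega>. u i j \<omega> * ?Z \<omega> $ j) = 0" for i j
    using indep_var_integrable[OF ind u_int Zi(1)] indep_var_lebesgue_integral[OF ind u_int Zi(1)] Zi(2)
    by auto
  have "G \<omega> \<bullet> (A \<omega> *v ?Z \<omega>) = (\<Sum>i\<in>UNIV. \<Sum>j\<in>UNIV. u i j \<omega> * ?Z \<omega> $ j)" for \<omega>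
    by (simp add: inner_vec_def matrix_vector_mult_def u_def sum_distrib_left mult.assoc)
  then have "expectation (\<lambda>\<omega>. G \<omega> \<bullet> (A \<omega> *v ?Z \<omega>)) = expectation (\<lambda>\<omega>. \<Sum>i\<in>UNIV. \<Sum>j\<in>UNIV. u i j \<omega> * ?Z \<omega> $ j)"
    by (simp del: vector_minus_component)
  also have "\<dots> = (\<Sum>i\<in>UNIV. \<Sum>j\<in>UNIV. expectation (\<lambda>\<omega>. u i j \<omega> * ?Z \<omega> $ j))"
    using prod(1) by (subst Bochner_Integration.integral_sum, simp del: vector_minus_component,
       intro sum.cong refl Bochner_Integration.integral_sum)
  finally show "expectation (\<lambda>\<omega>. G \<omega> \<bullet> (A \<omega> *v ?Z \<omega>)) = 0"
    using prod(2) by (simp del: vector_minus_component)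
qed

end

lemma chain_mono:
  fixes \<tau> :: "nat \<Rightarrow> real"
  assumes \<tau>: "\<And>k. k < n \<Longrightarrow> \<tau> k < \<tau> (Suc k)" and "i \<le> k" "k \<le> n"
  shows "\<tau> i \<le> \<tau> k"
  using assms(2,3)
proof (induction k rule: dec_induct)
  case (step k)
  then show ?case using \<tau>[of k] by simp
qed simp

text \<open>2^p separates drift from noise, and H^(p-1) is Jensen's inequality in time for the
  drift. For the noise, 4^p is Doob's constant, \<open>mart_const p\<close> that of the martingale
  bound, H^(p/2-1) is left over from the weights, and the last factor is the Gaussian
  moment.\<close>

definition ito_const :: "real \<Rightarrow> real \<Rightarrow> real \<Rightarrow> real" where
  "ito_const m p H = 2 powr p * (H powr (p - 1) + 4 powr p * mart_const p * H powr (p / 2 - 1) * gauss_const m p)"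

lemma ito_const_nonneg [simp]: "0 \<le> ito_const m p H"
  by (simp add: ito_const_def)

text \<open>The discrete counterpart of the moment bound for an Ito process. The grid may be
  non-uniform, and the bound is a Riemann sum over its steps, the form that Gronwall's inequality
  takes up.\<close>

lemma (in driven) moment_le_ito_sum:
  fixes A :: "nat \<Rightarrow> 'w \<Rightarrow> real ^ 'm ^ 'd"
  assumes p: "2 \<le> p" and H: "0 < H" "\<tau> n - \<tau> 0 \<le> H"
    and \<tau>: "0 \<le> \<tau> 0" "\<And>k. k < n \<Longrightarrow> \<tau> k < \<tau> (Suc k)"
    and A: "\<And>k. k < n \<Longrightarrow> moment_le M p (s k) (A k)" "\<And>k. k < n \<Longrightarrow> A k \<in> borel_measurable (F (\<tau> k))"
    and B: "\<And>k. k < n \<Longrightarrow> moment_le M p (\<beta> k) (B k)"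
  shows "moment_le M p (ito_const CARD('m) p H * (\<Sum>k<n. (\<tau> (Suc k) - \<tau> k) * (\<beta> k + s k)))
     (running_max (\<lambda>m \<omega>. \<Sum>k<m. (\<tau> (Suc k) - \<tau> k) *\<^sub>R B k \<omega> + A k \<omega> *v (W (\<tau> (Suc k)) \<omega> - W (\<tau> k) \<omega>)) n)"
proof (cases "n = 0")
  case True
  then show ?thesis by (simp add: moment_le_def running_max_0[abs_def])
next
  case False
  define \<delta> where "\<delta> k = \<tau> (Suc k) - \<tau> k" for k
  define D where "D k \<omega> = A k \<omega> *v (W (\<tau> (Suc k)) \<omega> - W (\<tau> k) \<omega>)" for k \<omega>
  define \<gamma> where "\<gamma> = gauss_const CARD('m) p"
  have \<delta>: "0 < \<delta> k" if "k < n" for k using \<tau>(2)[OF that] by (simp add: \<delta>_def)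
  have sum\<delta>: "(\<Sum>k<n. \<delta> k) = \<tau> n - \<tau> 0" unfolding \<delta>_def by (rule sum_lessThan_telescope)
  note \<tau>_le = chain_mono[of n \<tau>, OF \<tau>(2)]
  have \<tau>0: "0 \<le> \<tau> k" if "k \<le> n" for k using \<tau>_le[of 0 k] \<tau>(1) that by simp
  have Dm: "moment_le M p (\<gamma> * \<delta> k powr (p / 2) * s k) (D k)" if "k < n" for k
    unfolding D_def \<gamma>_def \<delta>_def using p \<tau>0[of k] \<tau>(2) A that by (intro moment_le_stoch_incr) auto
  have mart: "mart_diff M p (F (\<tau> k)) (D k)" if "k < n" for k
    unfolding D_def using p \<tau>0[of k] \<tau>(2) A that by (intro mart_diff_stoch_incr) auto
  have adapt: "D j \<in> borel_measurable (F (\<tau> k))" if "k < n" "j < k" for k j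
    unfolding D_def
  proof (rule borel_measurable_matrix_vector)
    show "A j \<in> borel_measurable (F (\<tau> k))"
      using measurable_F_mono[OF A(2)[of j] \<tau>_le[of j k]] that by simp
    show "(\<lambda>\<omega>. W (\<tau> (Suc j)) \<omega> - W (\<tau> j) \<omega>) \<in> borel_measurable (F (\<tau> k))"
      using that by (intro incr_measurable \<tau>0 \<tau>_le) auto
  qed
  have M1: "moment_le M p (mart_const p * (\<Sum>k<n. (\<delta> k / H) powr (1 - p / 2) * (\<gamma> * \<delta> k powr (p / 2) * s k)))
      (\<lambda>\<omega>. \<Sum>k<n. D k \<omega>)"
    using \<delta> H sum\<delta> by (intro moment_le_martingale[OF p mart adapt Dm]) (auto simp flip: sum_divide_distrib)
  \<comment> \<open>Here the weight \<delta>_k / H pays off: its power 1 - p/2 and the Gaussian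
    \<delta>_k^(p/2) combine to the first power of the step.\<close>
  have "(\<delta> k / H) powr (1 - p / 2) * (\<gamma> * \<delta> k powr (p / 2) * s k) = H powr (p / 2 - 1) * \<gamma> * (\<delta> k * s k)"
    if "k < n" for k
  proof -
    have "\<delta> k powr (1 - p / 2) * \<delta> k powr (p / 2) = \<delta> k"
      using \<delta>[OF that] by (simp flip: powr_add)
    moreover have "(1 / H) powr (1 - p / 2) = H powr (p / 2 - 1)"
      using H powr_minus_divide[of H "1 - p / 2"] by (simp add: powr_divide)
    ultimately show ?thesis
      using powr_mult[of "\<delta> k" "1 / H" "1 - p / 2"] by (simp add: mult_ac)
  qed
  then have "(\<Sum>k<n. (\<delta> k / H) powr (1 - p / 2) * (\<gamma> * \<delta> k powr (p / 2) * s k))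
      = H powr (p / 2 - 1) * \<gamma> * (\<Sum>k<n. \<delta> k * s k)"
    unfolding sum_distrib_left by (intro sum.cong) auto
  then have M2: "moment_le M p (mart_const p * H powr (p / 2 - 1) * \<gamma> * (\<Sum>k<n. \<delta> k * s k)) (\<lambda>\<omega>. \<Sum>k<n. D k \<omega>)"
    using M1 by (simp add: mult.assoc)
  have M3: "moment_le M p (4 powr p * (mart_const p * H powr (p / 2 - 1) * \<gamma> * (\<Sum>k<n. \<delta> k * s k)))
      (running_max (\<lambda>m \<omega>. \<Sum>k<m. D k \<omega>) n)"
    by (rule moment_le_running_max[OF p mart adapt Dm M2])
  define b where "b \<omega> = (\<Sum>k<n. \<delta> k * norm (B k \<omega>))" for \<omega>
  have Bm: "B k \<in> borel_measurable M" if "k < n" for k using moment_leD(1)[OF B[OF that]] .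
  have b_meas: "b \<in> borel_measurable M"
    unfolding b_def using Bm by (intro borel_measurable_sum borel_measurable_times) auto
  have \<beta>0: "0 \<le> \<beta> k" if "k < n" for k using moment_le_nonneg[OF B[OF that]] .
  have b0: "0 \<le> b \<omega>" for \<omega> unfolding b_def using \<delta> by (intro sum_nonneg mult_nonneg_nonneg) (auto intro: less_imp_le)
  have M4: "moment_le M p (H powr (p - 1) * (\<Sum>k<n. \<delta> k * \<beta> k)) b"
  proof (rule moment_le_I[OF b_meas])
    \<comment> \<open>Jensen needs weights with sum exactly 1, hence division by the elapsed time
      \<Delta> and not by H.\<close>
    define \<Delta> where "\<Delta> = (\<Sum>k<n. \<delta> k)"
    have \<Delta>: "0 < \<Delta>" "\<Delta> \<le> H" using H sum\<delta> sum_pos[of "{..<n}" \<delta>] \<delta> False by (simp_all add: \<Delta>_def lessThan_empty_iff)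
    let ?f = "\<lambda>\<omega>. \<Delta> powr p * (\<Sum>k<n. \<delta> k / \<Delta> * norm (B k \<omega>) powr p)"
    show int: "integrable M ?f" using moment_leD(2)[OF B] by auto
    have "expectation ?f = \<Delta> powr p * (\<Sum>k<n. \<delta> k / \<Delta> * expectation (\<lambda>\<omega>. norm (B k \<omega>) powr p))"
      using moment_leD(2)[OF B] by (simp add: Bochner_Integration.integral_sum)
    also have "\<dots> \<le> \<Delta> powr p * (\<Sum>k<n. \<delta> k / \<Delta> * \<beta> k)"
      using moment_leD(3)[OF B] \<delta> \<Delta> by (intro mult_left_mono sum_mono) (auto intro!: divide_nonneg_pos less_imp_le)
    also have "\<dots> = \<Delta> powr (p - 1) * (\<Sum>k<n. \<delta> k * \<beta> k)"
      using \<Delta> by (simp add: powr_diff sum_distrib_left)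
    also have "\<dots> \<le> H powr (p - 1) * (\<Sum>k<n. \<delta> k * \<beta> k)"
      using \<Delta> p \<delta> \<beta>0 by (intro mult_right_mono powr_mono2 sum_nonneg mult_nonneg_nonneg) (auto intro: less_imp_le)
    finally show "expectation ?f \<le> H powr (p - 1) * (\<Sum>k<n. \<delta> k * \<beta> k)" .
    fix \<omega>
    have "norm (b \<omega>) = \<Delta> * (\<Sum>k<n. \<delta> k / \<Delta> * norm (B k \<omega>))"
      using \<Delta> b0[of \<omega>] by (simp add: b_def sum_distrib_left)
    then have "norm (b \<omega>) powr p = \<Delta> powr p * (\<Sum>k<n. \<delta> k / \<Delta> * norm (B k \<omega>)) powr p"
      by (simp add: powr_mult)
    also have "\<dots> \<le> ?f \<omega>"
      using p \<Delta> \<delta> by (intro mult_left_mono powr_convex_sum)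
        (auto intro!: divide_nonneg_pos less_imp_le simp: \<Delta>_def simp flip: sum_divide_distrib)
    finally show "norm (b \<omega>) powr p \<le> ?f \<omega>" .
  qed
  let ?X = "\<lambda>m \<omega>. \<Sum>k<m. \<delta> k *\<^sub>R B k \<omega> + D k \<omega>"
  have "moment_le M p (2 powr p * (H powr (p - 1) * (\<Sum>k<n. \<delta> k * \<beta> k) +
      4 powr p * (mart_const p * H powr (p / 2 - 1) * \<gamma> * (\<Sum>k<n. \<delta> k * s k)))) (running_max ?X n)"
  proof (rule moment_le_dom[OF moment_le_add[OF _ M4 M3]])
    show "running_max ?X n \<in> borel_measurable M"
      using moment_leD(1)[OF Dm] Bm
      by (intro measurable_running_max borel_measurable_sum borel_measurable_add borel_measurable_scaleR) auto
    fix \<omega>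
    have "running_max ?X n \<omega> \<le> b \<omega> + running_max (\<lambda>m \<omega>. \<Sum>k<m. D k \<omega>) n \<omega>"
    proof (rule running_max_le)
      fix m assume m: "m \<le> n"
      have "norm (?X m \<omega>) \<le> norm (\<Sum>k<m. \<delta> k *\<^sub>R B k \<omega>) + norm (\<Sum>k<m. D k \<omega>)"
        unfolding sum.distrib by (rule norm_triangle_ineq)
      also have "norm (\<Sum>k<m. \<delta> k *\<^sub>R B k \<omega>) \<le> (\<Sum>k<m. norm (\<delta> k *\<^sub>R B k \<omega>))" by (rule norm_sum)
      also have "\<dots> = (\<Sum>k<m. \<delta> k * norm (B k \<omega>))" 
        using \<delta> m by (intro sum.cong) (auto simp: abs_of_pos)
      also have "\<dots> \<le> b \<omega>"
        unfolding b_def using \<delta> m by (intro sum_mono2) (auto intro!: mult_nonneg_nonneg intro: less_imp_le)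
      also have "norm (\<Sum>k<m. D k \<omega>) \<le> running_max (\<lambda>m \<omega>. \<Sum>k<m. D k \<omega>) n \<omega>"
        using running_max_ge[OF m, of "\<lambda>m \<omega>. \<Sum>k<m. D k \<omega>"] by simp
      finally show "norm (?X m \<omega>) \<le> b \<omega> + running_max (\<lambda>m \<omega>. \<Sum>k<m. D k \<omega>) n \<omega>" by simp
    qed
    then show "norm (running_max ?X n \<omega>) \<le> norm (b \<omega> + running_max (\<lambda>m \<omega>. \<Sum>k<m. D k \<omega>) n \<omega>)"
      using b0[of \<omega>] by simp
  qed (use p in auto)
  then show ?thesis unfolding \<delta>_def[symmetric] D_def[symmetric]
  proof (rule moment_le_mono)
    define x where "x = (\<Sum>k<n. \<delta> k * \<beta> k)"
    define y where "y = (\<Sum>k<n. \<delta> k * s k)"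
    have x: "0 \<le> x" unfolding x_def using \<delta> \<beta>0 by (intro sum_nonneg mult_nonneg_nonneg) (auto intro: less_imp_le)
    have y: "0 \<le> y" unfolding y_def using \<delta> moment_le_nonneg[OF A(1)] by (intro sum_nonneg mult_nonneg_nonneg) (auto intro: less_imp_le)
    have xy: "(\<Sum>k<n. \<delta> k * (\<beta> k + s k)) = x + y"
      by (simp add: x_def y_def algebra_simps sum.distrib)
    have "a * x + c * y \<le> (a + c) * (x + y)" if "0 \<le> a" "0 \<le> c" for a c
      using that x y by (simp add: algebra_simps)
    from this[of "H powr (p - 1)" "4 powr p * mart_const p * H powr (p / 2 - 1) * \<gamma>"]
    have "2 powr p * (H powr (p - 1) * x + 4 powr p * mart_const p * H powr (p / 2 - 1) * \<gamma> * y) \<le>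
       2 powr p * ((H powr (p - 1) + 4 powr p * mart_const p * H powr (p / 2 - 1) * \<gamma>) * (x + y))"
      by (intro mult_left_mono) (auto simp: \<gamma>_def)
    then show "2 powr p * (H powr (p - 1) * x + 4 powr p * (mart_const p * H powr (p / 2 - 1) * \<gamma> * y))
       \<le> ito_const CARD('m) p H * (\<Sum>k<n. \<delta> k * (\<beta> k + s k))"
      unfolding xy ito_const_def \<gamma>_def[symmetric] by (simp add: mult.assoc)
  qed
qed

subsection \<open>Independence of the driving noise\<close>

lemma measurable_sub_algebra:
  "f \<in> measurable F N \<Longrightarrow> space F = space H \<Longrightarrow> sets F \<subseteq> sets H \<Longrightarrow> f \<in> measurable H N"
  by (auto simp: measurable_def)

lemma Int_stable_preimages: "Int_stable {f -` A \<inter> S | A. A \<in> sets N}"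
proof (rule Int_stableI)
  fix a b assume "a \<in> {f -` A \<inter> S | A. A \<in> sets N}" "b \<in> {f -` A \<inter> S | A. A \<in> sets N}"
  then obtain A B where "a = f -` A \<inter> S" "b = f -` B \<inter> S" "A \<in> sets N" "B \<in> sets N"
    by auto
  then show "a \<inter> b \<in> {f -` A \<inter> S | A. A \<in> sets N}"
    by (auto intro!: exI[of _ "A \<inter> B"])
qed

text \<open>The finest independent pieces of the noise on a grid: for each particle,
  \<open>None\<close> stands for the initial value and \<open>Some k\<close> for the increment over
  the k-th interval. They are families of events, not random variables, because their values have
  different types.\<close>

definition noise_cell ::
  "'w measure \<Rightarrow> (nat \<Rightarrow> nat \<Rightarrow> 'w \<Rightarrow> real ^ 'd) \<Rightarrow> (nat \<Rightarrow> nat \<Rightarrow> real \<Rightarrow> 'w \<Rightarrow> real ^ 'm) \<Rightarrow>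
   (nat \<Rightarrow> real) \<Rightarrow> (nat \<times> nat) \<times> nat option \<Rightarrow> 'w set set" where
  "noise_cell M \<xi> W \<tau> = (\<lambda>((l, j), c). case c of
      None \<Rightarrow> {\<xi> l j -` A \<inter> space M | A. A \<in> sets borel}
    | Some k \<Rightarrow> {(\<lambda>\<omega>. W l j (\<tau> (Suc k)) \<omega> - W l j (\<tau> k) \<omega>) -` A \<inter> space M | A. A \<in> sets borel})"

definition noise_pair where
  "noise_pair \<xi> W = (\<lambda>(l, j) \<omega>. (\<xi> l j \<omega>, path_of (W l j) \<omega>))"

definition particle_algebra ::
  "'w measure \<Rightarrow> (nat \<Rightarrow> nat \<Rightarrow> 'w \<Rightarrow> real ^ 'd) \<Rightarrow> (nat \<Rightarrow> nat \<Rightarrow> real \<Rightarrow> 'w \<Rightarrow> real ^ 'm) \<Rightarrow>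
   nat \<times> nat \<Rightarrow> 'w measure" where
  "particle_algebra M \<xi> W i = vimage_algebra (space M) (noise_pair \<xi> W i) (borel \<Otimes>\<^sub>M path_space)"

lemma space_particle_algebra [simp]: "space (particle_algebra M \<xi> W i) = space M"
  by (simp add: particle_algebra_def)

lemma path_of_space: "path_of W \<omega> \<in> space path_space"
  by (simp add: path_of_def path_space_def space_PiM)

lemma measurable_path_incr:
  assumes "0 \<le> r" "0 \<le> s"
  shows "(\<lambda>x. x s - x r) \<in> borel_measurable (path_space :: (real \<Rightarrow> real ^ 'm) measure)"
  unfolding path_space_def using assms by (intro borel_measurable_diff measurable_component_singleton) auto

lemma particle_algebra_initial:
  "\<xi> l j \<in> borel_measurable (particle_algebra M \<xi> W (l, j))"
proof -
  have "noise_pair \<xi> W (l, j) \<in> measurable (particle_algebra M \<xi> W (l, j)) (borel \<Otimes>\<^sub>M path_space)"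
    unfolding particle_algebra_def
    by (rule measurable_vimage_algebra1) (auto simp: noise_pair_def space_pair_measure path_of_space)
  from measurable_compose[OF this measurable_fst] show ?thesis by (simp add: noise_pair_def)
qed

lemma particle_algebra_incr:
  assumes "0 \<le> r" "0 \<le> s"
  shows "(\<lambda>\<omega>. W l j s \<omega> - W l j r \<omega>) \<in> borel_measurable (particle_algebra M \<xi> W (l, j))"
proof -
  have "noise_pair \<xi> W (l, j) \<in> measurable (particle_algebra M \<xi> W (l, j)) (borel \<Otimes>\<^sub>M path_space)"
    unfolding particle_algebra_def
    by (rule measurable_vimage_algebra1) (auto simp: noise_pair_def space_pair_measure path_of_space)
  from measurable_compose[OF measurable_compose[OF this measurable_snd] measurable_path_incr[OF assms]]
  show ?thesis using assms by (simp add: noise_pair_def path_of_def)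
qed

lemma driving_noise_initial:
  assumes "driving_noise M \<rho>0 I \<xi> W" "(l, j) \<in> I"
  shows "\<xi> l j \<in> borel_measurable M" "distr M borel (\<xi> l j) = \<rho>0" "std_brownian_motion M (W l j)"
    "prob_space.indep_set M (sets (vimage_algebra (space M) (\<xi> l j) borel))
          (sets (vimage_algebra (space M) (path_of (W l j)) path_space))"
  using assms unfolding driving_noise_def by auto

lemma (in prob_space) indep_particle_algebras:
  assumes "driving_noise M \<rho>0 I \<xi> W"
  shows "indep_sets (\<lambda>i. sets (particle_algebra M \<xi> W i)) I"
proof -
  have "indep_vars (\<lambda>_. borel \<Otimes>\<^sub>M path_space) (noise_pair \<xi> W) I"
    using assms unfolding driving_noise_def noise_pair_def by (simp add: case_prod_beta')
  then have "indep_sets (\<lambda>i. {noise_pair \<xi> W i -` A \<inter> space M |A. A \<in> sets (borel \<Otimes>\<^sub>M path_space)}) I"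
    by (simp add: indep_vars_def2)
  moreover have "sets (particle_algebra M \<xi> W i) =
      {noise_pair \<xi> W i -` A \<inter> space M |A. A \<in> sets (borel \<Otimes>\<^sub>M path_space)}" for i
    unfolding particle_algebra_def
    by (rule sets_vimage_algebra2) (auto simp: noise_pair_def space_pair_measure path_of_space split: prod.split)
  ultimately show ?thesis by simp
qed

text \<open>Three kinds of independence are merged: between particles, between an initial value and
  its path, and between the increments of one path. The probability of an intersection is factored
  in this order.\<close>

lemma (in prob_space) indep_noise_cells:
  assumes dn: "driving_noise M \<rho>0 I \<xi> W" and I: "finite I" and \<tau>: "incseq \<tau>" "0 \<le> \<tau> 0"
  shows "indep_sets (noise_cell M \<xi> W \<tau>) (I \<times> insert None (Some ` {..<K}))"
proof (cases "I = {}")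
  case True
  then show ?thesis by (simp add: indep_sets_def)
next
  case False
  let ?O = "insert None (Some ` {..<K})"
  let ?PA = "particle_algebra M \<xi> W"
  have \<tau>0: "0 \<le> \<tau> k" for k using \<tau> incseqD[of \<tau> 0 k] by simp
  have cell_PA: "noise_cell M \<xi> W \<tau> (i, c) \<subseteq> sets (?PA i)" for i c
  proof (cases i)
    case (Pair l j)
    show ?thesis
      using measurable_sets[OF particle_algebra_initial[of \<xi> l j M W]]
        measurable_sets[OF particle_algebra_incr[of "\<tau> k" "\<tau> (Suc k)" W l j M \<xi> for k, OF \<tau>0 \<tau>0]]
      by (cases c) (auto simp: noise_cell_def Pair)
  qed
  have PA_events: "sets (?PA i) \<subseteq> events" if "i \<in> I" for i
    using indep_particle_algebras[OF dn] that by (auto simp: indep_sets_def)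
  have single: "prob (\<Inter>c\<in>?O. A c) = (\<Prod>c\<in>?O. prob (A c))"
    if i: "i \<in> I" and A: "\<And>c. c \<in> ?O \<Longrightarrow> A c \<in> noise_cell M \<xi> W \<tau> (i, c)" for i A
  proof -
    obtain l j where lj: "i = (l, j)" by (cases i)
    note dni = driving_noise_initial[OF dn i[unfolded lj]]
    \<comment> \<open>The intersection with \<open>space M\<close> gives the empty family of
      increments (K = 0) the whole space as its value.\<close>
    define C where "C = space M \<inter> (\<Inter>k\<in>{..<K}. A (Some k))"
    let ?VP = "vimage_algebra (space M) (path_of (W l j)) path_space"
    have A_path: "A (Some k) \<in> sets ?VP" if "k < K" for k
    proof -
      have "path_of (W l j) \<in> measurable ?VP path_space"
        by (rule measurable_vimage_algebra1) (auto simp: path_of_space)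
      from measurable_compose[OF this measurable_path_incr[OF \<tau>0 \<tau>0, of "Suc k" k]]
      have "(\<lambda>\<omega>. W l j (\<tau> (Suc k)) \<omega> - W l j (\<tau> k) \<omega>) \<in> borel_measurable ?VP"
        using \<tau>0 by (simp add: path_of_def)
      from measurable_sets[OF this] show ?thesis
        using A[of "Some k"] that by (auto simp: noise_cell_def lj)
    qed
    have C: "C \<in> sets ?VP"
    proof (cases "K = 0")
      case True
      then show ?thesis using sets.top[of ?VP] by (simp add: C_def)
    next
      case False
      then show ?thesis unfolding C_def using sets.top[of ?VP] A_path
        by (intro sets.Int sets.finite_INT) auto
    qed
    have A0: "A None \<in> sets (vimage_algebra (space M) (\<xi> l j) borel)"
      using A[of None] by (auto simp: noise_cell_def lj sets_vimage_algebra2)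
    have sub: "A None \<subseteq> space M" using A[of None] by (auto simp: noise_cell_def lj)
    have prC: "prob C = (\<Prod>k<K. prob (A (Some k)))"
    proof (cases "K = 0")
      case True
      then show ?thesis by (simp add: C_def prob_space)
    next
      case False
      have "C = (\<Inter>k\<in>{..<K}. A (Some k))"
        using False A[of "Some 0"] by (auto simp: C_def noise_cell_def lj)
      moreover have "indep_vars (\<lambda>_. borel) (\<lambda>k \<omega>. W l j (\<tau> (Suc k)) \<omega> - W l j (\<tau> k) \<omega>) {..<K}"
        using dni(3) \<tau> unfolding std_brownian_motion_def by blast
      then have "indep_sets (\<lambda>k. {(\<lambda>\<omega>. W l j (\<tau> (Suc k)) \<omega> - W l j (\<tau> k) \<omega>) -` A \<inter> space M |A. A \<in> sets borel}) {..<K}"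
        by (simp add: indep_vars_def2)
      then have "prob (\<Inter>k\<in>{..<K}. A (Some k)) = (\<Prod>k<K. prob (A (Some k)))"
      proof (rule indep_setsD)
        show "{..<K} \<noteq> {}" using False by (simp add: lessThan_empty_iff)
        show "\<forall>k\<in>{..<K}. A (Some k) \<in> {(\<lambda>\<omega>. W l j (\<tau> (Suc k)) \<omega> - W l j (\<tau> k) \<omega>) -` A \<inter> space M |A. A \<in> sets borel}"
        proof
          fix k assume "k \<in> {..<K}"
          then show "A (Some k) \<in> {(\<lambda>\<omega>. W l j (\<tau> (Suc k)) \<omega> - W l j (\<tau> k) \<omega>) -` A \<inter> space M |A. A \<in> sets borel}"
            using A[of "Some k"] by (simp add: noise_cell_def lj)
        qed
      qed auto
      ultimately show ?thesis by simp
    qed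
    have "(\<Inter>c\<in>?O. A c) = A None \<inter> C" using sub by (auto simp: C_def)
    then have "prob (\<Inter>c\<in>?O. A c) = prob (A None) * prob C"
      using indep_setD[OF dni(4) A0 C] by simp
    also have "\<dots> = (\<Prod>c\<in>?O. prob (A c))"
      by (simp add: prC prod.reindex)
    finally show ?thesis .
  qed
  \<comment> \<open>As each family contains the whole space, testing intersections over the full
    finite index set suffices for independence.\<close>
  have spaceM: "space M \<in> noise_cell M \<xi> W \<tau> x" for x
    by (cases x) (auto simp: noise_cell_def split: option.split intro!: exI[of _ UNIV])
  show ?thesis
  proof (subst indep_sets_finite)
    show "I \<times> ?O \<noteq> {}" "finite (I \<times> ?O)" using False I by auto
    show "space M \<in> noise_cell M \<xi> W \<tau> x" if "x \<in> I \<times> ?O" for x by (rule spaceM)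
    show "noise_cell M \<xi> W \<tau> x \<subseteq> events" if "x \<in> I \<times> ?O" for x
      using that cell_PA PA_events by (cases x) blast
    show "\<forall>A\<in>Pi (I \<times> ?O) (noise_cell M \<xi> W \<tau>). prob (\<Inter>x\<in>I \<times> ?O. A x) = (\<Prod>x\<in>I \<times> ?O. prob (A x))"
    proof
      fix A assume A: "A \<in> Pi (I \<times> ?O) (noise_cell M \<xi> W \<tau>)"
      define T where "T i = (\<Inter>c\<in>?O. A (i, c))" for i
      have A': "A (i, c) \<in> noise_cell M \<xi> W \<tau> (i, c)" if "i \<in> I" "c \<in> ?O" for i c
        using A that by (auto simp: Pi_iff)
      have T: "T i \<in> sets (?PA i)" if "i \<in> I" for i
        unfolding T_def using subsetD[OF cell_PA A'[OF that]] by (intro sets.finite_INT) auto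
      have "(\<Inter>x\<in>I \<times> ?O. A x) = (\<Inter>i\<in>I. T i)" by (auto simp: T_def)
      also have "prob \<dots> = (\<Prod>i\<in>I. prob (T i))"
        using indep_particle_algebras[OF dn] by (rule indep_setsD) (use False I T in auto)
      also have "\<dots> = (\<Prod>i\<in>I. \<Prod>c\<in>?O. prob (A (i, c)))"
        unfolding T_def using A' by (intro prod.cong refl single) auto
      also have "\<dots> = (\<Prod>x\<in>I \<times> ?O. prob (A x))"
        by (subst prod.cartesian_product) (simp add: split_beta)
      finally show "prob (\<Inter>x\<in>I \<times> ?O. A x) = (\<Prod>x\<in>I \<times> ?O. prob (A x))" .
    qed
  qed
qed

section \<open>The joint filtration of all particles\<close>

lemma finite_real_grid:
  fixes G :: "real set"
  assumes "finite G" "G \<noteq> {}"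
  obtains \<tau> :: "nat \<Rightarrow> real" and n where "\<tau> ` {..n} = G" "\<And>k. k < n \<Longrightarrow> \<tau> k < \<tau> (Suc k)"
proof -
  define xs where "xs = sorted_list_of_set G"
  have xs: "set xs = G" "sorted_wrt (<) xs" "xs \<noteq> []"
    using assms by (auto simp: xs_def)
  define n where "n = length xs - 1"
  have n: "{..n} = {..<length xs}" using xs(3) by (cases xs) (auto simp: n_def)
  show thesis
  proof (rule that[of "\<lambda>k. xs ! k" n])
    show "(!) xs ` {..n} = G" unfolding n using xs(1) by (auto simp: set_conv_nth)
    fix k assume "k < n"
    then show "xs ! k < xs ! Suc k"
      using sorted_wrt_nth_less[OF xs(2), of k "Suc k"] by (auto simp: n_def)
  qed
qed

text \<open>Keeping the set S of times as a parameter allows the past, where S is an interval, to be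
  exhausted by finite sets of times, for which independence of grid increments is available.\<close>

definition noise_gen ::
  "'w measure \<Rightarrow> (nat \<Rightarrow> nat \<Rightarrow> 'w \<Rightarrow> real ^ 'd) \<Rightarrow> (nat \<Rightarrow> nat \<Rightarrow> real \<Rightarrow> 'w \<Rightarrow> real ^ 'm) \<Rightarrow>
   (nat \<times> nat) set \<Rightarrow> real set \<Rightarrow> 'w set set" where
  "noise_gen M \<xi> W I S =
     {\<xi> l j -` A \<inter> space M | l j A. (l, j) \<in> I \<and> A \<in> sets borel} \<union>
     {(\<lambda>\<omega>. W l j s \<omega> - W l j r \<omega>) -` A \<inter> space M | l j r s A.
        (l, j) \<in> I \<and> r \<in> S \<and> s \<in> S \<and> r \<le> s \<and> A \<in> sets borel}"

definition noise_filtration ::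
  "'w measure \<Rightarrow> (nat \<Rightarrow> nat \<Rightarrow> 'w \<Rightarrow> real ^ 'd) \<Rightarrow> (nat \<Rightarrow> nat \<Rightarrow> real \<Rightarrow> 'w \<Rightarrow> real ^ 'm) \<Rightarrow>
   (nat \<times> nat) set \<Rightarrow> real \<Rightarrow> 'w measure" where
  "noise_filtration M \<xi> W I t = sigma (space M) (noise_gen M \<xi> W I {0..t})"

lemma noise_gen_Pow: "noise_gen M \<xi> W I S \<subseteq> Pow (space M)"
  by (auto simp: noise_gen_def)

lemma noise_gen_mono: "S \<subseteq> S' \<Longrightarrow> noise_gen M \<xi> W I S \<subseteq> noise_gen M \<xi> W I S'"
  unfolding noise_gen_def by blast

lemma space_noise_filtration [simp]: "space (noise_filtration M \<xi> W I t) = space M"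
  by (simp add: noise_filtration_def noise_gen_Pow space_measure_of)

lemma sets_noise_filtration:
  "sets (noise_filtration M \<xi> W I t) = sigma_sets (space M) (noise_gen M \<xi> W I {0..t})"
  by (simp add: noise_filtration_def noise_gen_Pow sets_measure_of)

lemma noise_filtration_initial:
  fixes \<xi> :: "nat \<Rightarrow> nat \<Rightarrow> 'w \<Rightarrow> real ^ 'd"
  assumes "(l, j) \<in> I"
  shows "\<xi> l j \<in> borel_measurable (noise_filtration M \<xi> W I t)"
proof (rule measurableI)
  fix A :: "(real ^ 'd) set" assume "A \<in> sets borel"
  then have "\<xi> l j -` A \<inter> space M \<in> noise_gen M \<xi> W I {0..t}"
    using assms unfolding noise_gen_def by blast
  then show "\<xi> l j -` A \<inter> space (noise_filtration M \<xi> W I t) \<in> sets (noise_filtration M \<xi> W I t)"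
    by (auto simp: sets_noise_filtration)
qed simp

lemma noise_filtration_incr:
  fixes W :: "nat \<Rightarrow> nat \<Rightarrow> real \<Rightarrow> 'w \<Rightarrow> real ^ 'm"
  assumes "(l, j) \<in> I" "0 \<le> r" "r \<le> s" "s \<le> t"
  shows "(\<lambda>\<omega>. W l j s \<omega> - W l j r \<omega>) \<in> borel_measurable (noise_filtration M \<xi> W I t)"
proof (rule measurableI)
  fix A :: "(real ^ 'm) set" assume "A \<in> sets borel"
  then have "(\<lambda>\<omega>. W l j s \<omega> - W l j r \<omega>) -` A \<inter> space M \<in> noise_gen M \<xi> W I {0..t}"
    using assms unfolding noise_gen_def by fastforce
  then show "(\<lambda>\<omega>. W l j s \<omega> - W l j r \<omega>) -` A \<inter> space (noise_filtration M \<xi> W I t) \<in> sets (noise_filtration M \<xi> W I t)"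
    by (auto simp: sets_noise_filtration)
qed simp

text \<open>The past of an increment involves uncountably many times. Independence is proved for the
  algebra generated by finitely many of them, where grid cells can be regrouped, and extended by the
  \<pi>-\<lambda> argument: the union P of these algebras is stable under intersection and generates
  the past.\<close>

lemma (in prob_space) driving_noise_driven:
  fixes \<xi> :: "nat \<Rightarrow> nat \<Rightarrow> 'a \<Rightarrow> real ^ 'd" and W :: "nat \<Rightarrow> nat \<Rightarrow> real \<Rightarrow> 'a \<Rightarrow> real ^ 'm"
  assumes dn: "driving_noise M \<rho>0 I \<xi> W" and I: "finite I" and lj: "(l, j) \<in> I"
  shows "driven M (noise_filtration M \<xi> W I) (W l j)"
proof
  let ?F = "noise_filtration M \<xi> W I"
  show "space (?F t) = space M" for t by simp
  have bm: "std_brownian_motion M (W l' j')" if "(l', j') \<in> I" for l' j'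
    using driving_noise_initial(3)[OF dn that] .
  have gen_events: "noise_gen M \<xi> W I {0..t} \<subseteq> events" for t
  proof -
    have "\<xi> l' j' -` A \<inter> space M \<in> events" if "(l', j') \<in> I" "A \<in> sets borel" for l' j' A
      using measurable_sets[OF driving_noise_initial(1)[OF dn that(1)] that(2)] .
    moreover have "(\<lambda>\<omega>. W l' j' s \<omega> - W l' j' r \<omega>) -` A \<inter> space M \<in> events"
      if "(l', j') \<in> I" "A \<in> sets borel" "0 \<le> r" "0 \<le> s" for l' j' r s A
      using bm[OF that(1)] that unfolding std_brownian_motion_def
      by (intro measurable_sets[OF borel_measurable_diff]) auto
    ultimately show ?thesis unfolding noise_gen_def by auto
  qed
  show "sets (?F t) \<subseteq> events" for t
    unfolding sets_noise_filtration using gen_events by (intro sets.sigma_sets_subset)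
  show "sets (?F s) \<subseteq> sets (?F t)" if "s \<le> t" for s t
    unfolding sets_noise_filtration using that by (intro sigma_sets_mono' noise_gen_mono) auto
  show "(\<lambda>\<omega>. W l j t \<omega> - W l j s \<omega>) \<in> borel_measurable (?F u)" if "0 \<le> s" "s \<le> t" "t \<le> u" for s t u
    using lj that by (rule noise_filtration_incr)
  show "distributed M lborel (\<lambda>\<omega>. W l j t \<omega> - W l j s \<omega>)
          (\<lambda>x. ennreal (\<Prod>i\<in>UNIV. normal_density 0 (sqrt (t - s)) (x $ i)))" if "0 \<le> s" "s < t" for s t
    using bm[OF lj] that unfolding std_brownian_motion_def by blast
  show "indep_set (sets (?F s)) (sets (vimage_algebra (space M) (\<lambda>\<omega>. W l j t \<omega> - W l j s \<omega>) borel))"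
    if st: "0 \<le> s" "s < t" for s t
  proof -
    define V where "V = {(\<lambda>\<omega>. W l j t \<omega> - W l j s \<omega>) -` A \<inter> space M | A. A \<in> sets borel}"
    define P where "P = (\<Union>S\<in>{S. finite S \<and> S \<subseteq> {0..s}}. sigma_sets (space M) (noise_gen M \<xi> W I S))"
    have ind: "indep_set (sigma_sets (space M) (noise_gen M \<xi> W I S)) V" if S: "finite S" "S \<subseteq> {0..s}" for S
    proof -
      \<comment> \<open>The times 0 and s are added so that the grid starts at 0 and ends exactly at
        s.\<close>
      obtain \<sigma> n where \<sigma>: "\<sigma> ` {..n} = insert 0 (insert s S)" "\<And>k. k < n \<Longrightarrow> \<sigma> k < \<sigma> (Suc k)"
        using finite_real_grid[of "insert 0 (insert s S)"] S by auto
      note \<sigma>_mono = chain_mono[of n \<sigma>, OF \<sigma>(2)]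
      have \<sigma>_in: "\<sigma> k \<in> {0..s}" if "k \<le> n" for k
        using \<sigma>(1) S st that by (metis (no_types, lifting) atMost_iff atLeastAtMost_iff imageI insert_iff order_refl subset_iff)
      have "s \<in> \<sigma> ` {..n}" "0 \<in> \<sigma> ` {..n}" unfolding \<sigma>(1) by auto
      then obtain m m' where "m \<le> n" "\<sigma> m = s" "m' \<le> n" "\<sigma> m' = 0" by auto
      then have \<sigma>n: "\<sigma> n = s" and \<sigma>0: "\<sigma> 0 = 0"
        using \<sigma>_mono[of m n] \<sigma>_in[of n] \<sigma>_mono[of 0 m'] \<sigma>_in[of 0] by auto
      \<comment> \<open>Grids are infinite sequences: s is followed by t, repeated for ever, so cell
        n of particle (l, j) is the increment from s to t.\<close>
      define \<tau> where "\<tau> k = (if k \<le> n then \<sigma> k else t)" for k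
      have \<tau>_inc: "incseq \<tau>"
        unfolding incseq_def \<tau>_def using \<sigma>_mono \<sigma>_in st by fastforce
      have \<tau>0: "\<tau> 0 = 0" by (simp add: \<tau>_def \<sigma>0)
      \<comment> \<open>Two groups of cells: everything up to time s, and the single increment from
        s to t.\<close>
      define C where "C = (\<lambda>c. if c then I \<times> insert None (Some ` {..<n}) else {((l, j), Some n)})"
      let ?E = "noise_cell M \<xi> W \<tau>"
      have "indep_sets ?E (I \<times> insert None (Some ` {..<Suc n}))"
        using indep_noise_cells[OF dn I \<tau>_inc] \<tau>0 by simp
      then have "indep_sets ?E (\<Union>c\<in>UNIV. C c)"
        by (rule indep_sets_mono_index[rotated]) (use lj in \<open>auto simp: C_def less_Suc_eq\<close>)
      then have "indep_sets (\<lambda>c. sigma_sets (space M) (\<Union>x\<in>C c. ?E x)) UNIV"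
      proof (rule indep_sets_collect_sigma)
        show "Int_stable (?E x)" for x
          by (cases x) (auto simp: noise_cell_def Int_stable_preimages split: option.split)
        show "disjoint_family_on C UNIV"
          by (auto simp: disjoint_family_on_def C_def)
      qed
      then have ind: "indep_set (sigma_sets (space M) (\<Union>x\<in>C True. ?E x)) (sigma_sets (space M) (\<Union>x\<in>C False. ?E x))"
        unfolding indep_set_def by (rule indep_sets_mono_sets) (auto split: bool.split)
      let ?N = "sigma (space M) (\<Union>x\<in>C True. ?E x)"
      have Pow: "(\<Union>x\<in>C True. ?E x) \<subseteq> Pow (space M)"
        by (auto simp: noise_cell_def split: option.splits)
      have N: "space ?N = space M" "sets ?N = sigma_sets (space M) (\<Union>x\<in>C True. ?E x)"
        using Pow by (auto simp: space_measure_of sets_measure_of)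
      have "sigma_sets (space M) (noise_gen M \<xi> W I S) \<subseteq> sets ?N"
      proof -
        have init: "\<xi> l' j' \<in> borel_measurable ?N" if "(l', j') \<in> I" for l' j'
        proof (rule measurableI)
          fix A :: "(real ^ 'd) set" assume A: "A \<in> sets borel"
          have "((l', j'), None) \<in> C True" using that by (auto simp: C_def)
          moreover have "\<xi> l' j' -` A \<inter> space M \<in> ?E ((l', j'), None)" using A by (auto simp: noise_cell_def)
          ultimately show "\<xi> l' j' -` A \<inter> space ?N \<in> sets ?N" unfolding N by blast
        qed (simp add: N)
        have incr1: "(\<lambda>\<omega>. W l' j' (\<sigma> (Suc k)) \<omega> - W l' j' (\<sigma> k) \<omega>) \<in> borel_measurable ?N"
          if "(l', j') \<in> I" "k < n" for l' j' k
        proof (rule measurableI)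
          fix A :: "(real ^ 'm) set" assume A: "A \<in> sets borel"
          have "((l', j'), Some k) \<in> C True" using that by (auto simp: C_def)
          moreover have "(\<lambda>\<omega>. W l' j' (\<sigma> (Suc k)) \<omega> - W l' j' (\<sigma> k) \<omega>) -` A \<inter> space M \<in> ?E ((l', j'), Some k)"
            using A that by (auto simp: noise_cell_def \<tau>_def)
          ultimately show "(\<lambda>\<omega>. W l' j' (\<sigma> (Suc k)) \<omega> - W l' j' (\<sigma> k) \<omega>) -` A \<inter> space ?N \<in> sets ?N" unfolding N by blast
        qed (simp add: N)
        have incr: "(\<lambda>\<omega>. W l' j' u \<omega> - W l' j' r \<omega>) \<in> borel_measurable ?N"
          if "(l', j') \<in> I" "r \<in> S" "u \<in> S" "r \<le> u" for l' j' r u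
        proof -
          have "r \<in> \<sigma> ` {..n}" "u \<in> \<sigma> ` {..n}" using that unfolding \<sigma>(1) by auto
          then obtain kr ku where k: "kr \<le> n" "r = \<sigma> kr" "ku \<le> n" "u = \<sigma> ku" by auto
          show ?thesis
          proof (cases "kr \<le> ku")
            case True
            have "(\<lambda>\<omega>. \<Sum>k = kr..<ku. W l' j' (\<sigma> (Suc k)) \<omega> - W l' j' (\<sigma> k) \<omega>) \<in> borel_measurable ?N"
              using that k by (intro borel_measurable_sum incr1) auto
            also have "(\<lambda>\<omega>. \<Sum>k = kr..<ku. W l' j' (\<sigma> (Suc k)) \<omega> - W l' j' (\<sigma> k) \<omega>) = (\<lambda>\<omega>. W l' j' u \<omega> - W l' j' r \<omega>)"
              using sum_Suc_diff'[OF True, of "\<lambda>k. W l' j' (\<sigma> k) \<omega>" for \<omega>] by (simp add: k)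
            finally show ?thesis .
          next
            case False
            then have "u \<le> r" using \<sigma>_mono[of ku kr] k by simp
            then have "u = r" using that by simp
            then show ?thesis by simp
          qed
        qed
        show ?thesis
          using measurable_sets[OF init] measurable_sets[OF incr]
          by (intro sets.sigma_sets_subset[of _ ?N, unfolded N(1)]) (auto simp: noise_gen_def N(1))
      qed
      moreover have "V \<subseteq> sigma_sets (space M) (\<Union>x\<in>C False. ?E x)"
        by (auto simp: C_def noise_cell_def V_def \<tau>_def \<sigma>n intro!: sigma_sets.Basic)
      ultimately show ?thesis
        using ind unfolding indep_sets2_eq N(2) by (meson subsetD subset_trans)
    qed
    have V_sets: "sets (vimage_algebra (space M) (\<lambda>\<omega>. W l j t \<omega> - W l j s \<omega>) borel) = V"
      unfolding V_def by (rule sets_vimage_algebra2) auto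
    have "indep_set P V"
      using ind ind[of "{}"] unfolding indep_sets2_eq P_def by blast
    moreover have "Int_stable P"
    proof (rule Int_stableI)
      fix a b assume "a \<in> P" "b \<in> P"
      then obtain S S' where S: "finite S" "S \<subseteq> {0..s}" "a \<in> sigma_sets (space M) (noise_gen M \<xi> W I S)"
        and S': "finite S'" "S' \<subseteq> {0..s}" "b \<in> sigma_sets (space M) (noise_gen M \<xi> W I S')"
        unfolding P_def by auto
      let ?G = "noise_gen M \<xi> W I (S \<union> S')"
      have "a \<in> sigma_sets (space M) ?G" "b \<in> sigma_sets (space M) ?G"
        using S(3) S'(3) subsetD[OF sigma_sets_mono'[OF noise_gen_mono[of S "S \<union> S'"]]]
          subsetD[OF sigma_sets_mono'[OF noise_gen_mono[of S' "S \<union> S'"]]] by blast+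
      then have "a \<inter> b \<in> sigma_sets (space M) ?G"
        using sets.Int[of a "sigma (space M) ?G" b] by (simp add: sets_measure_of[OF noise_gen_Pow])
      then show "a \<inter> b \<in> P" unfolding P_def using S S' by auto
    qed
    moreover have "Int_stable V"
      unfolding V_sets[symmetric] by (rule sets.Int_stable)
    ultimately have "indep_set (sigma_sets (space M) P) (sigma_sets (space M) V)"
      by (rule indep_set_sigma_sets)
    moreover have "sets (?F s) \<subseteq> sigma_sets (space M) P"
    proof -
      have "noise_gen M \<xi> W I {0..s} \<subseteq> P"
      proof
        fix a assume "a \<in> noise_gen M \<xi> W I {0..s}"
        then have "(\<exists>l j A. a = \<xi> l j -` A \<inter> space M \<and> (l, j) \<in> I \<and> A \<in> sets borel) \<or>
          (\<exists>l j r u A. a = (\<lambda>\<omega>. W l j u \<omega> - W l j r \<omega>) -` A \<inter> space M \<and> (l, j) \<in> I \<and>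
             r \<in> {0..s} \<and> u \<in> {0..s} \<and> r \<le> u \<and> A \<in> sets borel)"
          unfolding noise_gen_def by (simp only: Un_iff mem_Collect_eq)
        \<comment> \<open>A single generator involves at most two times, so it already occurs for a
          finite S.\<close>
        then have "\<exists>S. finite S \<and> S \<subseteq> {0..s} \<and> a \<in> noise_gen M \<xi> W I S"
        proof (elim disjE exE conjE)
          fix l j A assume "a = \<xi> l j -` A \<inter> space M" "(l, j) \<in> I" "A \<in> sets borel"
          then have "a \<in> noise_gen M \<xi> W I {}"
            unfolding noise_gen_def Un_iff mem_Collect_eq by (intro disjI1 exI conjI)
          then show ?thesis by (intro exI[of _ "{}"]) simp
        next
          fix l j r u A assume a: "a = (\<lambda>\<omega>. W l j u \<omega> - W l j r \<omega>) -` A \<inter> space M" "(l, j) \<in> I"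
             "r \<in> {0..s}" "u \<in> {0..s}" "r \<le> u" "A \<in> sets borel"
          then have "a \<in> noise_gen M \<xi> W I {r, u}"
            unfolding noise_gen_def Un_iff mem_Collect_eq by (intro disjI2, intro exI[of _ l] exI[of _ j] exI[of _ r] exI[of _ u] exI[of _ A]) auto
          then show ?thesis using a by (intro exI[of _ "{r, u}"]) simp
        qed
        then show "a \<in> P" unfolding P_def by auto
      qed
      then show ?thesis unfolding sets_noise_filtration by (rule sigma_sets_mono')
    qed
    moreover have "V \<subseteq> sigma_sets (space M) V" by auto
    ultimately show ?thesis
      unfolding V_sets indep_sets2_eq by blast
  qed
qed

subsection \<open>Averages of independent random vectors\<close>

lemma (in prob_space) mart_diff_indep:
  fixes D :: "'a \<Rightarrow> 'b::euclidean_space"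
  assumes p: "1 \<le> p" and ind: "indep_set (sets F) (sets H)" and sp: "space F = space M" "space H = space M"
    and D: "D \<in> borel_measurable H" "integrable M D" "expectation D = 0"
  shows "mart_diff M p F D"
  unfolding mart_diff_def
proof (intro allI impI)
  fix G :: "'a \<Rightarrow> 'b" and V
  assume G: "G \<in> borel_measurable F" and V: "V \<in> borel_measurable M" "integrable M (\<lambda>\<omega>. V \<omega> powr p)"
    and GV: "\<forall>\<omega>\<in>space M. 0 \<le> V \<omega> \<and> norm (G \<omega>) \<le> V \<omega> powr (p - 1)"
  have GM: "G \<in> borel_measurable M"
    using G sp(1) indep_setD_ev1[OF ind] by (rule measurable_sub_algebra)
  have G_int: "integrable M G"
  proof (rule Bochner_Integration.integrable_bound)
    show "integrable M (\<lambda>\<omega>. V \<omega> powr p + 1)" using V by simp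
    show "AE \<omega> in M. norm (G \<omega>) \<le> norm (V \<omega> powr p + 1)"
    proof (intro AE_I2)
      fix \<omega> assume w: "\<omega> \<in> space M"
      then have "norm (G \<omega>) \<le> V \<omega> powr (p - 1) * 1" using GV by simp
      also have "\<dots> \<le> V \<omega> powr p + 1"
        using powr_minus_1_mult_le[OF p, of "V \<omega>" 1] GV w by simp
      finally show "norm (G \<omega>) \<le> norm (V \<omega> powr p + 1)" by simp
    qed
  qed (rule GM)
  have ivar: "indep_var borel (\<lambda>\<omega>. G \<omega> \<bullet> b) borel (\<lambda>\<omega>. D \<omega> \<bullet> b)" for b
    using ind by (rule indep_var_indep_set) (use G D sp in auto)
  have "integrable M (\<lambda>\<omega>. G \<omega> \<bullet> b)" "integrable M (\<lambda>\<omega>. D \<omega> \<bullet> b)" "expectation (\<lambda>\<omega>. D \<omega> \<bullet> b) = 0" for b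
    using G_int D by auto
  note * = indep_var_integrable[OF ivar this(1,2)] indep_var_lebesgue_integral[OF ivar this(1,2)] this(3)
  have "expectation (\<lambda>\<omega>. G \<omega> \<bullet> D \<omega>) = expectation (\<lambda>\<omega>. \<Sum>b\<in>Basis. (G \<omega> \<bullet> b) * (D \<omega> \<bullet> b))"
    by (simp add: euclidean_inner[of "G _" "D _"])
  also have "\<dots> = (\<Sum>b\<in>Basis. expectation (\<lambda>\<omega>. (G \<omega> \<bullet> b) * (D \<omega> \<bullet> b)))"
    using *(1) by (intro Bochner_Integration.integral_sum)
  finally show "expectation (\<lambda>\<omega>. G \<omega> \<bullet> D \<omega>) = 0" using * by simp
qed

text \<open>The factor after \<open>mart_const p\<close> comes from centring: the p-th moment of Y -
  \<mu> is at most 2^p (v + v).\<close>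

definition average_const :: "real \<Rightarrow> real" where
  "average_const p = mart_const p * 2 powr p * 2"

lemma average_const_nonneg [simp]: "0 \<le> average_const p" by (simp add: average_const_def)

text \<open>Taken in order, centred independent vectors are martingale differences for the algebras
  of their predecessors. Equal weights 1/J give the p-th moment of the sum the order J^(p/2), and
  division by J leaves J^(-p/2).\<close>

lemma (in prob_space) moment_le_average:
  fixes Y :: "nat \<Rightarrow> 'a \<Rightarrow> 'b::euclidean_space"
  assumes p: "2 \<le> p" and J: "1 \<le> J"
    and ind: "indep_sets (\<lambda>j. sets (G j)) {1..J}" and sp: "\<And>j. space (G j) = space M"
    and Y: "\<And>j. j \<in> {1..J} \<Longrightarrow> Y j \<in> borel_measurable (G j)" "\<And>j. j \<in> {1..J} \<Longrightarrow> moment_le M p v (Y j)"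
    and \<mu>: "\<And>j. j \<in> {1..J} \<Longrightarrow> expectation (Y j) = \<mu>"
  shows "moment_le M p (average_const p * real J powr (- p / 2) * v)
     (\<lambda>\<omega>. (1 / real J) *\<^sub>R (\<Sum>j = 1..J. Y j \<omega>) - \<mu>)"
proof -
  define D where "D k \<omega> = Y (Suc k) \<omega> - \<mu>" for k \<omega>
  define F where "F k = sigma (space M) (\<Union>j\<in>{1..k}. sets (G j))" for k
  have sub: "sets (G j) \<subseteq> events" if "j \<in> {1..J}" for j
    using ind that by (auto simp: indep_sets_def)
  have Pow: "(\<Union>j\<in>{1..k}. sets (G j)) \<subseteq> Pow (space M)" for k
    using sets.sets_into_space[of _ "G _"] sp by fastforce
  have F: "space (F k) = space M" "sets (F k) = sigma_sets (space M) (\<Union>j\<in>{1..k}. sets (G j))" for k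
    using Pow[of k] by (auto simp: F_def space_measure_of sets_measure_of)
  have Y_int: "integrable M (Y j)" if "j \<in> {1..J}" for j
    using moment_le_integrable[OF _ Y(2)[OF that]] p by simp
  have v: "norm \<mu> powr p \<le> v"
    using norm_expectation_powr_le[OF _ Y(2)[of 1]] \<mu>[of 1] p J by simp
  have D_le: "moment_le M p (2 powr p * (v + v)) (D k)" if "k < J" for k
  proof -
    have "moment_le M p (2 powr p * (v + v)) (\<lambda>\<omega>. Y (Suc k) \<omega> + (- \<mu>))"
      using p that moment_le_mono[OF moment_le_const[of p "- \<mu>"]] v by (intro moment_le_add Y) auto
    then show ?thesis by (simp add: D_def[abs_def])
  qed
  have mart: "mart_diff M p (F k) (D k)" if k: "k < J" for k
  proof (rule mart_diff_indep)
    define C where "C c = (if c then {1..k} else {Suc k})" for c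
    have "indep_sets (\<lambda>c. sigma_sets (space M) (\<Union>j\<in>C c. sets (G j))) UNIV"
    proof (rule indep_sets_collect_sigma)
      show "indep_sets (\<lambda>j. sets (G j)) (\<Union>c\<in>UNIV. C c)"
        using ind by (rule indep_sets_mono_index[rotated]) (use k in \<open>auto simp: C_def split: if_splits\<close>)
      show "Int_stable (sets (G j))" for j by (rule sets.Int_stable)
      show "disjoint_family_on C UNIV" by (auto simp: disjoint_family_on_def C_def)
    qed
    then show "indep_set (sets (F k)) (sets (G (Suc k)))"
      unfolding indep_set_def by (rule indep_sets_mono_sets) (auto simp: C_def F(2) split: bool.split)
    show "D k \<in> borel_measurable (G (Suc k))" unfolding D_def using Y(1)[of "Suc k"] k by simp
    show "integrable M (D k)" unfolding D_def using Y_int[of "Suc k"] k by simp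
    show "expectation (D k) = 0"
      unfolding D_def using Y_int[of "Suc k"] k \<mu>[of "Suc k"] by (simp add: prob_space)
  qed (use p F sp in auto)
  have adapt: "D i \<in> borel_measurable (F k)" if "k < J" "i < k" for i k
  proof -
    have "sets (G (Suc i)) \<subseteq> sets (F k)" unfolding F(2) using that by (auto intro!: sigma_sets.Basic bexI[of _ "Suc i"])
    then have "Y (Suc i) \<in> borel_measurable (F k)"
      using measurable_sub_algebra[OF Y(1)[of "Suc i"]] that sp F(1) by auto
    then show ?thesis unfolding D_def by simp
  qed
  have "moment_le M p (mart_const p * (\<Sum>k<J. (1 / real J) powr (1 - p / 2) * (2 powr p * (v + v)))) (\<lambda>\<omega>. \<Sum>k<J. D k \<omega>)"
    using J by (intro moment_le_martingale[OF p mart adapt D_le]) auto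
  then have "moment_le M p ((1 / real J) powr p * (mart_const p * (\<Sum>k<J. (1 / real J) powr (1 - p / 2) * (2 powr p * (v + v)))))
     (\<lambda>\<omega>. (1 / real J) *\<^sub>R (\<Sum>j = 1..J. Y j \<omega>) - \<mu>)"
  proof (rule moment_le_scaled)
    show "(\<lambda>\<omega>. (1 / real J) *\<^sub>R (\<Sum>j = 1..J. Y j \<omega>) - \<mu>) \<in> borel_measurable M"
      using moment_leD(1)[OF Y(2)]
      by (intro borel_measurable_diff borel_measurable_scaleR borel_measurable_sum borel_measurable_const) auto
    fix \<omega>
    have "(\<Sum>k<J. D k \<omega>) = (\<Sum>j = 1..J. Y j \<omega>) - real J *\<^sub>R \<mu>"
      unfolding D_def sum_subtractf
      by (simp add: sum.atLeast1_atMost_eq scaleR_conv_of_real sum_constant_scaleR)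
    then have "(1 / real J) *\<^sub>R (\<Sum>k<J. D k \<omega>) = (1 / real J) *\<^sub>R (\<Sum>j = 1..J. Y j \<omega>) - \<mu>"
      using J by (simp add: scaleR_right_diff_distrib)
    then show "norm ((1 / real J) *\<^sub>R (\<Sum>j = 1..J. Y j \<omega>) - \<mu>) \<le> 1 / real J * norm (\<Sum>k<J. D k \<omega>)"
      by (metis abs_of_nonneg divide_nonneg_nonneg norm_scaleR of_nat_0_le_iff order_refl zero_le_one)
  qed (use p in auto)
  moreover have "(1 / real J) powr p * (real J * (1 / real J) powr (1 - p / 2)) = real J powr (- p / 2)"
  proof -
    have "(1 / real J) powr p * (real J * (1 / real J) powr (1 - p / 2))
        = real J powr (- p) * (real J powr 1 * real J powr (p / 2 - 1))"
      using J powr_minus_divide[of "real J" p] powr_minus_divide[of "real J" "1 - p / 2"]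
      by (simp add: powr_divide)
    also have "\<dots> = real J powr (- p / 2)"
      using J unfolding powr_add[symmetric] by (intro arg_cong2[of _ _ _ _ "(powr)"]) auto
    finally show ?thesis .
  qed
  then have "(1 / real J) powr p * (mart_const p * (\<Sum>k<J. (1 / real J) powr (1 - p / 2) * (2 powr p * (v + v))))
     = average_const p * real J powr (- p / 2) * v"
    by (simp add: average_const_def algebra_simps)
  ultimately show ?thesis by (simp only:)
qed

subsection \<open>Mean-field particles\<close>

lemma powr_add3_le:
  fixes x y z :: real
  assumes "1 \<le> p" "0 \<le> x" "0 \<le> y" "0 \<le> z"
  shows "(x + y + z) powr p \<le> 3 powr p * (x powr p + y powr p + z powr p)"
proof -
  let ?m = "max x (max y z)"
  have "x + y + z \<le> 3 * ?m" by auto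
  then have "(x + y + z) powr p \<le> (3 * ?m) powr p"
    using assms by (intro powr_mono2) auto
  also have "\<dots> = 3 powr p * ?m powr p" by (simp add: powr_mult)
  also have "?m powr p \<le> x powr p + y powr p + z powr p" by (auto simp: max_def)
  finally show ?thesis by simp
qed

lemma moment_le_dom3:
  assumes p: "1 \<le> p" and f: "moment_le M p u f" and g: "moment_le M p v g" and h: "moment_le M p w h"
    and meas: "Z \<in> borel_measurable M" and c: "0 \<le> c"
    and dom: "\<And>\<omega>. \<omega> \<in> space M \<Longrightarrow> norm (Z \<omega>) \<le> c * (norm (f \<omega>) + norm (g \<omega>) + norm (h \<omega>))"
  shows "moment_le M p (c powr p * 3 powr p * (u + v + w)) Z"
proof (rule moment_le_I[OF meas])
  let ?S = "\<lambda>\<omega>. c powr p * 3 powr p * (norm (f \<omega>) powr p + norm (g \<omega>) powr p + norm (h \<omega>) powr p)"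
  note int = moment_leD(2)[OF f] moment_leD(2)[OF g] moment_leD(2)[OF h]
  show "integrable M ?S" using int by simp
  show "integral\<^sup>L M ?S \<le> c powr p * 3 powr p * (u + v + w)"
    using int moment_leD(3)[OF f] moment_leD(3)[OF g] moment_leD(3)[OF h]
    by (simp add: mult_left_mono)
  fix \<omega> assume "\<omega> \<in> space M"
  then have "norm (Z \<omega>) powr p \<le> (c * (norm (f \<omega>) + norm (g \<omega>) + norm (h \<omega>))) powr p"
    using p dom by (intro powr_mono2) auto
  also have "\<dots> = c powr p * (norm (f \<omega>) + norm (g \<omega>) + norm (h \<omega>)) powr p"
    by (rule powr_mult)
  also have "\<dots> \<le> c powr p * (3 powr p * (norm (f \<omega>) powr p + norm (g \<omega>) powr p + norm (h \<omega>) powr p))"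
    using p by (intro mult_left_mono powr_add3_le) auto
  finally show "norm (Z \<omega>) powr p \<le> ?S \<omega>" by (simp add: mult.assoc)
qed

text \<open>The bound is a supersolution: 1 + z \<le> exp z turns c \<delta>_k e_k into an increment
  of e, and the sum telescopes. The steps may vary, as they do on the union of two grids.\<close>

lemma discrete_gronwall:
  fixes x :: "nat \<Rightarrow> real"
  assumes A: "0 \<le> A" "0 \<le> c" "\<And>k. k < N \<Longrightarrow> 0 \<le> \<delta> k"
    and x: "\<And>n. n \<le> N \<Longrightarrow> x n \<le> A + (\<Sum>k<n. c * \<delta> k * x k)"
  shows "n \<le> N \<Longrightarrow> x n \<le> A * exp (c * (\<Sum>k<n. \<delta> k))"
proof (induction n rule: less_induct)
  case (less n)
  define e where "e k = exp (c * (\<Sum>j<k. \<delta> j))" for k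
  have step: "c * \<delta> k * e k \<le> e (Suc k) - e k" if "k < n" for k
  proof -
    have "(1 + c * \<delta> k) * e k \<le> exp (c * \<delta> k) * e k"
      unfolding e_def by (intro mult_right_mono exp_ge_add_one_self) auto
    also have "\<dots> = e (Suc k)" by (simp add: e_def algebra_simps exp_add)
    finally show ?thesis by (simp add: algebra_simps)
  qed
  have "x n \<le> A + (\<Sum>k<n. c * \<delta> k * x k)" using x less by simp
  also have "(\<Sum>k<n. c * \<delta> k * x k) \<le> (\<Sum>k<n. A * (e (Suc k) - e k))"
  proof (intro sum_mono)
    fix k assume k: "k \<in> {..<n}"
    then have "c * \<delta> k * x k \<le> c * \<delta> k * (A * e k)"
      using less A unfolding e_def by (intro mult_left_mono) auto
    also have "\<dots> = A * (c * \<delta> k * e k)" by simp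
    also have "\<dots> \<le> A * (e (Suc k) - e k)" using step k A by (intro mult_left_mono) auto
    finally show "c * \<delta> k * x k \<le> A * (e (Suc k) - e k)" .
  qed
  also have "(\<Sum>k<n. A * (e (Suc k) - e k)) = A * (e n - e 0)"
    unfolding sum_distrib_left[symmetric] by (simp only: sum_lessThan_telescope)
  finally show ?case by (simp add: e_def algebra_simps)
qed

lemma borel_measurable_lipschitz2:
  fixes f :: "'x::euclidean_space \<Rightarrow> 'y::euclidean_space \<Rightarrow> 'z::euclidean_space"
  assumes lip: "\<And>x x' y y'. norm (f x y - f x' y') \<le> K * (norm (x - x') + norm (y - y'))"
    and u: "u \<in> borel_measurable N" and v: "v \<in> borel_measurable N"
  shows "(\<lambda>\<omega>. f (u \<omega>) (v \<omega>)) \<in> borel_measurable N"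
proof (rule borel_measurable_continuous_Pair[OF u v])
  have "isCont (\<lambda>x. f (fst x) (snd x)) a" for a
  proof -
    have "((\<lambda>x. K * (norm (fst x - fst a) + norm (snd x - snd a))) \<longlongrightarrow> K * (norm (fst a - fst a) + norm (snd a - snd a))) (at a)"
      by (intro tendsto_intros)
    then have "((\<lambda>x. K * (norm (fst x - fst a) + norm (snd x - snd a))) \<longlongrightarrow> 0) (at a)" by simp
    then have "((\<lambda>x. f (fst x) (snd x) - f (fst a) (snd a)) \<longlongrightarrow> 0) (at a)"
      by (rule Lim_null_comparison[rotated]) (intro always_eventually allI lip)
    then show ?thesis unfolding isCont_def by (rule LIM_zero_cancel)
  qed
  then show "continuous_on UNIV (\<lambda>x. f (fst x) (snd x))"
    by (simp add: continuous_on_eq_continuous_at)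
qed

text \<open>The index of the last grid point not after t. Expressing the indices of all levels
  through it lets them be compared at a common physical time.\<close>

definition grid_index :: "real \<Rightarrow> real \<Rightarrow> nat" where
  "grid_index h t = nat \<lfloor>t / h\<rfloor>"

lemma grid_index_bounds:
  assumes "0 < h" "0 \<le> t"
  shows "real (grid_index h t) * h \<le> t" "t < real (Suc (grid_index h t)) * h"
proof -
  have "real (grid_index h t) = of_int \<lfloor>t / h\<rfloor>" using assms by (simp add: grid_index_def)
  moreover have "of_int \<lfloor>t / h\<rfloor> \<le> t / h" "t / h < of_int \<lfloor>t / h\<rfloor> + 1" by linarith+
  ultimately have "real (grid_index h t) \<le> t / h" "t / h < real (Suc (grid_index h t))" by linarith+
  then show "real (grid_index h t) * h \<le> t" "t < real (Suc (grid_index h t)) * h"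
    using assms by (simp_all add: pos_le_divide_eq pos_divide_less_eq)
qed

lemma grid_index_eqI:
  assumes "0 < h" "real n * h \<le> t" "t < real (Suc n) * h"
  shows "grid_index h t = n"
proof -
  have "\<lfloor>t / h\<rfloor> = int n" using assms by (intro floor_unique) (auto simp: field_simps)
  then show ?thesis by (simp add: grid_index_def)
qed

lemma lipschitz_growth:
  fixes f :: "'x::euclidean_space \<Rightarrow> 'y::euclidean_space \<Rightarrow> 'z::euclidean_space"
  assumes lip: "\<And>x x' y y'. norm (f x y - f x' y') \<le> K * (norm (x - x') + norm (y - y'))"
    and 0: "norm (f 0 0) \<le> K"
  shows "norm (f x y) \<le> K * (1 + norm x + norm y)"
proof -
  have "norm (f x y) \<le> norm (f x y - f 0 0) + norm (f 0 0)"
    using norm_triangle_ineq[of "f x y - f 0 0" "f 0 0"] by simp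
  then show ?thesis using lip[of x y 0 0] 0 by (simp add: algebra_simps)
qed

text \<open>Data on which the final constant may depend, with no probability space in sight. One
  number K dominates the Lipschitz constants and the values at the origin; m0 bounds the initial
  moment and h0 is the largest time step.\<close>

locale mv_coeffs =
  fixes b :: "real ^ 'd \<Rightarrow> real ^ 'r \<Rightarrow> real ^ 'd" and \<sigma> :: "real ^ 'd \<Rightarrow> real ^ 'r \<Rightarrow> real ^ 'm ^ 'd"
    and R :: "real ^ 'd \<Rightarrow> real ^ 'r" and p T h0 K m0 \<kappa> \<gamma> :: real
  assumes p2: "2 \<le> p" and T: "0 < T" and h0: "0 < h0"
    and b_lip: "\<And>x x' y y'. norm (b x y - b x' y') \<le> K * (norm (x - x') + norm (y - y'))"
    and \<sigma>_lip: "\<And>x x' y y'. norm (\<sigma> x y - \<sigma> x' y') \<le> K * (norm (x - x') + norm (y - y'))"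
    and R_lip: "\<And>x x'. norm (R x - R x') \<le> K * norm (x - x')"
    and at_0: "norm (b 0 0) \<le> K" "norm (\<sigma> 0 0) \<le> K" "norm (R 0) \<le> K"
    and m0: "0 \<le> m0"
    and \<kappa>: "\<kappa> = ito_const CARD('m) p T" and \<gamma>: "\<gamma> = gauss_const CARD('m) p"
begin

lemma p1: "1 \<le> p" using p2 by simp

lemma K0: "0 \<le> K" using at_0(1) norm_ge_zero[of "b 0 0"] by linarith

lemma \<kappa>0: "0 \<le> \<kappa>" by (simp add: \<kappa>)

lemma \<gamma>0: "0 \<le> \<gamma>" by (simp add: \<gamma>)

lemmas measurable_b = borel_measurable_lipschitz2[OF b_lip]
lemmas measurable_\<sigma> = borel_measurable_lipschitz2[OF \<sigma>_lip]

lemma R_growth: "norm (R x) \<le> K * (1 + norm x)"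
  using lipschitz_growth[of "\<lambda>x (y::real). R x" K x 0] R_lip at_0(3) K0
  by (smt (verit) mult_left_mono norm_ge_zero norm_zero)

lemma measurable_R: "u \<in> borel_measurable N \<Longrightarrow> (\<lambda>\<omega>. R (u \<omega>)) \<in> borel_measurable N"
  using borel_measurable_lipschitz2[of "\<lambda>x y. R x" K u N u] R_lip
  by (smt (verit) K0 mult_left_mono norm_ge_zero)

text \<open>Linear growth when the second argument y is the mean of R: the coefficients have p-th
  moment at most K^p 3^p (1 + u + |y|^p), where |y|^p is itself at most K^p 3^p (1 + u).\<close>

definition coeff_const :: real where
  "coeff_const = K powr p * 3 powr p * (1 + K powr p * 3 powr p)"

definition mf_const :: real where
  "mf_const = (1 + 2 powr p * m0) * exp (2 powr p * \<kappa> * 2 * coeff_const * T)"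

text \<open>Movement within a step of size h: the drift contributes h^p \<le> h0^(p/2) h^(p/2), the
  noise \<gamma> h^(p/2), and the last factor bounds the moments of the coefficients.\<close>

definition freeze_const :: real where
  "freeze_const = 2 powr p * (h0 powr (p / 2) + \<gamma>) * (coeff_const * (2 * mf_const))"

definition lip_const :: real where
  "lip_const = K powr p * 2 powr p * (1 + K powr p)"

text \<open>\<open>2 * freeze_const\<close> is the local error of two schemes together, the
  exponential its amplification by Gronwall, and 3^p the passage from the interpolations back to
  grid values.\<close>

definition strong_const :: real where
  "strong_const = 3 powr p * (2 * freeze_const * (1 + exp (\<kappa> * 2 * lip_const * 3 powr p * T)))"

lemma consts_nonneg: "0 \<le> coeff_const" "1 \<le> mf_const" "0 \<le> freeze_const" "0 \<le> lip_const" "0 \<le> strong_const"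
proof -
  show c: "0 \<le> coeff_const" by (simp add: coeff_const_def)
  have "1 * 1 \<le> mf_const"
    unfolding mf_const_def using c \<kappa>0 m0 T by (intro mult_mono) auto
  then show 1: "1 \<le> mf_const" by simp
  show 2: "0 \<le> freeze_const" unfolding freeze_const_def using c 1 \<gamma>0 by simp
  show "0 \<le> lip_const" by (simp add: lip_const_def)
  show "0 \<le> strong_const" unfolding strong_const_def using 2 by (simp add: add_nonneg_nonneg)
qed

lemma moment_le_lip_diff:
  fixes \<phi> :: "real ^ 'd \<Rightarrow> real ^ 'r \<Rightarrow> 'c::euclidean_space"
  assumes lip: "\<And>x x' y y'. norm (\<phi> x y - \<phi> x' y') \<le> K * (norm (x - x') + norm (y - y'))"
    and f: "moment_le M p u (\<lambda>\<omega>. f \<omega> - f' \<omega>)" and g: "moment_le M p v (\<lambda>\<omega>. g \<omega> - g' \<omega>)"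
    and meas: "f \<in> borel_measurable M" "f' \<in> borel_measurable M" "g \<in> borel_measurable M" "g' \<in> borel_measurable M"
  shows "moment_le M p (K powr p * 2 powr p * (u + v)) (\<lambda>\<omega>. \<phi> (f \<omega>) (g \<omega>) - \<phi> (f' \<omega>) (g' \<omega>))"
proof -
  have nf: "moment_le M p u (\<lambda>\<omega>. norm (f \<omega> - f' \<omega>))"
    by (rule moment_le_dom[OF f]) (use meas p1 in auto)
  have ng: "moment_le M p v (\<lambda>\<omega>. norm (g \<omega> - g' \<omega>))"
    by (rule moment_le_dom[OF g]) (use meas p1 in auto)
  have "moment_le M p (K powr p * (2 powr p * (u + v))) (\<lambda>\<omega>. \<phi> (f \<omega>) (g \<omega>) - \<phi> (f' \<omega>) (g' \<omega>))"
    using moment_le_add[OF p1 nf ng]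
    by (rule moment_le_scaled)
      (use meas p1 K0 lip in \<open>auto intro!: borel_measurable_diff borel_measurable_lipschitz2[OF lip]\<close>)
  then show ?thesis by (simp add: mult.assoc)
qed

lemma moment_le_R_diff:
  assumes f: "moment_le M p u (\<lambda>\<omega>. f \<omega> - f' \<omega>)"
    and meas: "f \<in> borel_measurable M" "f' \<in> borel_measurable M"
  shows "moment_le M p (K powr p * u) (\<lambda>\<omega>. R (f \<omega>) - R (f' \<omega>))"
  using f by (rule moment_le_scaled)
    (use meas p1 K0 R_lip in \<open>auto intro!: borel_measurable_diff measurable_R\<close>)

end

section \<open>A single mean-field particle: moments and dependence on the step size\<close>

locale particle = mv_coeffs b \<sigma> R p T h0 K m0 \<kappa> \<gamma> + driven M F W
  for b :: "real ^ 'd \<Rightarrow> real ^ 'r \<Rightarrow> real ^ 'd" and \<sigma> :: "real ^ 'd \<Rightarrow> real ^ 'r \<Rightarrow> real ^ 'm ^ 'd"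
    and R :: "real ^ 'd \<Rightarrow> real ^ 'r" and p T h0 K m0 \<kappa> \<gamma> :: real
    and M :: "'w measure" and F and W :: "real \<Rightarrow> 'w \<Rightarrow> real ^ 'm" +
  fixes \<xi> :: "'w \<Rightarrow> real ^ 'd"
  assumes \<xi>_F: "\<xi> \<in> borel_measurable (F 0)" and \<xi>_moment: "moment_le M p m0 \<xi>"
begin

lemmas moment_le_ito = moment_le_ito_sum[OF p2 T, folded \<kappa>]

abbreviation "mf h \<equiv> mean_field M b \<sigma> R h \<xi> W"

definition mf_mean :: "real \<Rightarrow> nat \<Rightarrow> real ^ 'r" where
  "mf_mean h n = expectation (\<lambda>\<omega>. R (mf h n \<omega>))"

lemma mf_Suc: "mf h (Suc n) \<omega> = mf h n \<omega> + h *\<^sub>R b (mf h n \<omega>) (mf_mean h n)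
    + \<sigma> (mf h n \<omega>) (mf_mean h n) *v (W (real (Suc n) * h) \<omega> - W (real n * h) \<omega>)"
  by (simp add: euler_step_def mf_mean_def add.commute)

declare mean_field.simps(2)[simp del]

lemma moment_le_R:
  assumes "moment_le M p u f"
  shows "moment_le M p (K powr p * 3 powr p * (1 + u)) (\<lambda>\<omega>. R (f \<omega>))"
proof -
  have "moment_le M p (K powr p * 3 powr p * (1 + u + 0)) (\<lambda>\<omega>. R (f \<omega>))"
  proof (rule moment_le_dom3[OF p1 _ assms])
    show "moment_le M p 1 (\<lambda>_. 1::real)" using moment_le_const[of p "1::real"] by simp
    show "moment_le M p 0 (\<lambda>_. 0::real)" using moment_le_const[of p "0::real"] by simp
    show "(\<lambda>\<omega>. R (f \<omega>)) \<in> borel_measurable M" using moment_leD(1)[OF assms] by (rule measurable_R)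
  qed (use R_growth K0 in auto)
  then show ?thesis by simp
qed

lemma mf_mean_bound:
  assumes "moment_le M p u (mf h n)"
  shows "norm (mf_mean h n) powr p \<le> K powr p * 3 powr p * (1 + u)"
  unfolding mf_mean_def using p1 moment_le_R[OF assms] by (rule norm_expectation_powr_le)

lemma moment_le_coeff:
  fixes \<phi> :: "real ^ 'd \<Rightarrow> real ^ 'r \<Rightarrow> 'c::euclidean_space"
  assumes lip: "\<And>x x' y y'. norm (\<phi> x y - \<phi> x' y') \<le> K * (norm (x - x') + norm (y - y'))"
    and 0: "norm (\<phi> 0 0) \<le> K" and u: "moment_le M p u (mf h n)"
  shows "moment_le M p (coeff_const * (1 + u)) (\<lambda>\<omega>. \<phi> (mf h n \<omega>) (mf_mean h n))"
proof -
  have one: "moment_le M p 1 (\<lambda>_. 1::real)" using moment_le_const[of p "1::real"] by simp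
  have mean: "moment_le M p (K powr p * 3 powr p * (1 + u)) (\<lambda>_. mf_mean h n)"
    using moment_le_const mf_mean_bound[OF u] by (rule moment_le_mono)
  have "moment_le M p (K powr p * 3 powr p * (1 + u + K powr p * 3 powr p * (1 + u))) (\<lambda>\<omega>. \<phi> (mf h n \<omega>) (mf_mean h n))"
    by (rule moment_le_dom3[OF p1 one u mean])
      (use moment_leD(1)[OF u] K0 lipschitz_growth[OF lip 0] in \<open>auto intro!: borel_measurable_lipschitz2[OF lip]\<close>)
  then show ?thesis by (simp add: coeff_const_def algebra_simps)
qed

lemmas moment_le_coeffs = moment_le_coeff[OF b_lip at_0(1)] moment_le_coeff[OF \<sigma>_lip at_0(2)]

lemma mf_F:
  assumes "0 < h"
  shows "mf h n \<in> borel_measurable (F (real n * h))"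
proof (induction n)
  case 0
  then show ?case using \<xi>_F by simp
next
  case (Suc n)
  have le: "real n * h \<le> real (Suc n) * h" using assms by simp
  note X = measurable_F_mono[OF Suc le]
  have "(\<lambda>\<omega>. mf h n \<omega> + h *\<^sub>R b (mf h n \<omega>) (mf_mean h n)
    + \<sigma> (mf h n \<omega>) (mf_mean h n) *v (W (real (Suc n) * h) \<omega> - W (real n * h) \<omega>)) \<in> borel_measurable (F (real (Suc n) * h))"
    using assms le
    by (intro borel_measurable_add borel_measurable_scaleR borel_measurable_const
        borel_measurable_matrix_vector measurable_b measurable_\<sigma> X incr_measurable) auto
  then show ?case unfolding mf_Suc[abs_def, symmetric] .
qed

lemmas mf_M = measurable_F_M[OF mf_F]

lemma mf_coeff_F:
  assumes "0 < h" "real n * h \<le> t"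
  shows "(\<lambda>\<omega>. b (mf h n \<omega>) (mf_mean h n)) \<in> borel_measurable (F t)"
    "(\<lambda>\<omega>. \<sigma> (mf h n \<omega>) (mf_mean h n)) \<in> borel_measurable (F t)"
  using measurable_F_mono[OF mf_F[OF assms(1)] assms(2)]
  by (auto intro!: measurable_b measurable_\<sigma>)

text \<open>Finiteness only, without control in n. It comes before Gronwall's inequality, where the
  expectations must already be genuine moments.\<close>

lemma mf_moment_ex:
  assumes h: "0 < h"
  shows "\<exists>u. moment_le M p u (mf h n)"
proof (induction n)
  case 0
  then show ?case using \<xi>_moment by auto
next
  case (Suc n)
  then obtain u where u: "moment_le M p u (mf h n)" by auto
  have A: "moment_le M p (h powr p * (coeff_const * (1 + u))) (\<lambda>\<omega>. h *\<^sub>R b (mf h n \<omega>) (mf_mean h n))"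
    by (rule moment_le_scaled[OF moment_le_coeffs(1)[OF u]])
      (use h p1 moment_leD(1)[OF moment_le_coeffs(1)[OF u]] in auto)
  have B: "moment_le M p (gauss_const CARD('m) p * (real (Suc n) * h - real n * h) powr (p / 2) * (coeff_const * (1 + u)))
     (\<lambda>\<omega>. \<sigma> (mf h n \<omega>) (mf_mean h n) *v (W (real (Suc n) * h) \<omega> - W (real n * h) \<omega>))"
    by (rule moment_le_stoch_incr[OF p1 _ _ moment_le_coeffs(2)[OF u]]) (use h mf_coeff_F in auto)
  show ?case unfolding mf_Suc[abs_def]
    using moment_le_add[OF p1 moment_le_add[OF p1 u A] B] by blast
qed

lemma mf_integrable: "0 < h \<Longrightarrow> integrable M (\<lambda>\<omega>. R (mf h n \<omega>))"
  using mf_moment_ex[of h n] moment_le_R moment_le_integrable[OF p1] by blast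

lemma mf_sum:
  "mf h n \<omega> = \<xi> \<omega> + (\<Sum>k<n. (real (Suc k) * h - real k * h) *\<^sub>R b (mf h k \<omega>) (mf_mean h k)
    + \<sigma> (mf h k \<omega>) (mf_mean h k) *v (W (real (Suc k) * h) \<omega> - W (real k * h) \<omega>))"
proof (induction n)
  case (Suc n)
  have "real (Suc n) * h - real n * h = h" by (simp add: algebra_simps)
  then show ?case using Suc by (simp add: mf_Suc)
qed simp

lemma mf_moment:
  assumes h: "0 < h" and n: "real n * h \<le> T"
  shows "moment_le M p mf_const (mf h n)"
proof -
  define u where "u k = expectation (\<lambda>\<omega>. norm (mf h k \<omega>) powr p)" for k
  have u: "moment_le M p (u k) (mf h k)" for k
    using mf_moment_ex[OF h, of k] unfolding moment_le_def u_def by auto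
  let ?c = "2 powr p * \<kappa> * 2 * coeff_const"
  \<comment> \<open>Estimating 1 + u in place of u makes the affine growth of the coefficients
    linear.\<close>
  have rec: "1 + u i \<le> (1 + 2 powr p * m0) + (\<Sum>k<i. ?c * h * (1 + u k))" if i: "i \<le> n" for i
  proof -
    have iT: "real i * h \<le> T" using n mult_right_mono[of "real i" "real n" h] i h by linarith
    let ?S = "\<lambda>m \<omega>. \<Sum>k<m. (real (Suc k) * h - real k * h) *\<^sub>R b (mf h k \<omega>) (mf_mean h k)
      + \<sigma> (mf h k \<omega>) (mf_mean h k) *v (W (real (Suc k) * h) \<omega> - W (real k * h) \<omega>)"
    have "moment_le M p (\<kappa> * (\<Sum>k<i. (real (Suc k) * h - real k * h) * (coeff_const * (1 + u k) + coeff_const * (1 + u k))))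
       (running_max ?S i)"
      by (rule moment_le_ito)
        (use h iT moment_le_coeffs[OF u] mf_coeff_F[OF h] in auto)
    then have "moment_le M p (\<kappa> * (\<Sum>k<i. (real (Suc k) * h - real k * h) * (coeff_const * (1 + u k) + coeff_const * (1 + u k)))) (?S i)"
    proof (rule moment_le_dom)
      have "?S i = (\<lambda>\<omega>. mf h i \<omega> - \<xi> \<omega>)" by (auto simp: mf_sum[of h i])
      then show "?S i \<in> borel_measurable M"
        using mf_M[OF h, of i] moment_leD(1)[OF \<xi>_moment] by simp
      show "norm (?S i \<omega>) \<le> norm (running_max ?S i \<omega>)" for \<omega>
        using running_max_ge[of i i ?S \<omega>] by simp
    qed (use p1 in simp)
    also have "\<kappa> * (\<Sum>k<i. (real (Suc k) * h - real k * h) * (coeff_const * (1 + u k) + coeff_const * (1 + u k)))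
        = (\<Sum>k<i. \<kappa> * 2 * coeff_const * h * (1 + u k))"
      unfolding sum_distrib_left by (intro sum.cong) (auto simp: algebra_simps)
    finally have "moment_le M p (2 powr p * (m0 + (\<Sum>k<i. \<kappa> * 2 * coeff_const * h * (1 + u k)))) (mf h i)"
      unfolding mf_sum[of h i, abs_def] by (rule moment_le_add[OF p1 \<xi>_moment])
    from moment_leD(3)[OF this] show ?thesis
      by (simp add: u_def[symmetric] algebra_simps sum_distrib_left)
  qed
  have "1 + u n \<le> (1 + 2 powr p * m0) * exp (?c * (\<Sum>k<n. h))"
    by (rule discrete_gronwall[where N = n and x = "\<lambda>k. 1 + u k"])
      (use m0 \<kappa>0 consts_nonneg(1) h rec in auto)
  also have "\<dots> \<le> mf_const"
    unfolding mf_const_def using n m0 \<kappa>0 consts_nonneg(1)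
    by (intro mult_left_mono iffD2[OF exp_le_cancel_iff]) auto
  finally show ?thesis using moment_le_mono[OF u[of n], of mf_const] by simp
qed

lemma mf_coeff_moment:
  assumes h: "0 < h" and n: "real n * h \<le> T"
  shows "moment_le M p (coeff_const * (2 * mf_const)) (\<lambda>\<omega>. b (mf h n \<omega>) (mf_mean h n))"
    and "moment_le M p (coeff_const * (2 * mf_const)) (\<lambda>\<omega>. \<sigma> (mf h n \<omega>) (mf_mean h n))"
proof -
  have le: "coeff_const * (1 + mf_const) \<le> coeff_const * (2 * mf_const)"
    using consts_nonneg by (intro mult_left_mono) auto
  show "moment_le M p (coeff_const * (2 * mf_const)) (\<lambda>\<omega>. b (mf h n \<omega>) (mf_mean h n))"
    "moment_le M p (coeff_const * (2 * mf_const)) (\<lambda>\<omega>. \<sigma> (mf h n \<omega>) (mf_mean h n))"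
    using moment_le_mono[OF moment_le_coeffs(1)[OF mf_moment[OF h n]] le]
      moment_le_mono[OF moment_le_coeffs(2)[OF mf_moment[OF h n]] le] by auto
qed

text \<open>The Euler scheme is interpolated between its grid points so that two step sizes with
  non-nested grids can be compared on the union of their grids.\<close>

definition interp :: "real \<Rightarrow> real \<Rightarrow> 'w \<Rightarrow> real ^ 'd" where
  "interp h t \<omega> = (let n = grid_index h t in mf h n \<omega> + (t - real n * h) *\<^sub>R b (mf h n \<omega>) (mf_mean h n)
     + \<sigma> (mf h n \<omega>) (mf_mean h n) *v (W t \<omega> - W (real n * h) \<omega>))"

lemma interp_freeze:
  assumes h: "0 < h" "h \<le> h0" and t: "0 \<le> t" "t \<le> T"
  shows "moment_le M p (freeze_const * h powr (p / 2)) (\<lambda>\<omega>. interp h t \<omega> - mf h (grid_index h t) \<omega>)"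
proof -
  define n where "n = grid_index h t"
  define C where "C = coeff_const * (2 * mf_const)"
  have n: "real n * h \<le> t" "t < real (Suc n) * h" using grid_index_bounds[OF h(1) t(1)] by (auto simp: n_def)
  have eq: "interp h t \<omega> - mf h n \<omega> = (t - real n * h) *\<^sub>R b (mf h n \<omega>) (mf_mean h n)
     + \<sigma> (mf h n \<omega>) (mf_mean h n) *v (W t \<omega> - W (real n * h) \<omega>)" for \<omega>
    by (simp add: interp_def Let_def n_def[symmetric])
  have C: "0 \<le> C" unfolding C_def using consts_nonneg by simp
  show ?thesis unfolding n_def[symmetric]
  \<comment> \<open>At a grid point the difference is zero; this case is separate because Gaussian
    increments are available only over intervals of positive length.\<close>
  proof (cases "t = real n * h")
    case True
    then have "(\<lambda>\<omega>. interp h t \<omega> - mf h n \<omega>) = (\<lambda>_. 0)" unfolding eq by simp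
    then show "moment_le M p (freeze_const * h powr (p / 2)) (\<lambda>\<omega>. interp h t \<omega> - mf h n \<omega>)"
      using consts_nonneg(3) by (simp add: moment_le_def)
  next
    case False
    then have lt: "real n * h < t" using n by simp
    have nT: "real n * h \<le> T" using n t by simp
    note co = mf_coeff_moment[OF h(1) nT, folded C_def]
    have th: "0 \<le> t - real n * h" "t - real n * h \<le> h" using n by (auto simp: algebra_simps)
    have A: "moment_le M p ((t - real n * h) powr p * C) (\<lambda>\<omega>. (t - real n * h) *\<^sub>R b (mf h n \<omega>) (mf_mean h n))"
      by (rule moment_le_scaled[OF co(1)]) (use th p1 moment_leD(1)[OF co(1)] in auto)
    have B: "moment_le M p (\<gamma> * (t - real n * h) powr (p / 2) * C)
        (\<lambda>\<omega>. \<sigma> (mf h n \<omega>) (mf_mean h n) *v (W t \<omega> - W (real n * h) \<omega>))"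
      unfolding \<gamma> by (rule moment_le_stoch_incr[OF p1 _ lt co(2)]) (use h mf_coeff_F[OF h(1)] in auto)
    have "(t - real n * h) powr p * C + \<gamma> * (t - real n * h) powr (p / 2) * C
        \<le> h0 powr (p / 2) * h powr (p / 2) * C + \<gamma> * h powr (p / 2) * C"
    proof (intro add_mono mult_right_mono mult_left_mono)
      have "(t - real n * h) powr p \<le> h powr p" using th p1 by (intro powr_mono2) auto
      also have "\<dots> = h powr (p / 2) * h powr (p / 2)" by (simp flip: powr_add)
      also have "\<dots> \<le> h0 powr (p / 2) * h powr (p / 2)" using h p1 by (intro mult_right_mono powr_mono2) auto
      finally show "(t - real n * h) powr p \<le> h0 powr (p / 2) * h powr (p / 2)" .
      show "(t - real n * h) powr (p / 2) \<le> h powr (p / 2)" using th p1 by (intro powr_mono2) auto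
    qed (use C \<gamma>0 in auto)
    then have "2 powr p * ((t - real n * h) powr p * C + \<gamma> * (t - real n * h) powr (p / 2) * C)
        \<le> 2 powr p * (h0 powr (p / 2) * h powr (p / 2) * C + \<gamma> * h powr (p / 2) * C)"
      by (intro mult_left_mono) auto
    also have "\<dots> = freeze_const * h powr (p / 2)"
      by (simp add: freeze_const_def C_def algebra_simps)
    finally show "moment_le M p (freeze_const * h powr (p / 2)) (\<lambda>\<omega>. interp h t \<omega> - mf h n \<omega>)"
      unfolding eq by (rule moment_le_mono[OF moment_le_add[OF p1 A B]])
  qed
qed

text \<open>With no grid point of h strictly between s and t, the coefficients stay frozen at the
  index belonging to s.\<close>

lemma interp_step:
  assumes h: "0 < h" and st: "0 \<le> s" "s < t" and gap: "\<And>n. \<not> (s < real n * h \<and> real n * h < t)"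
  shows "interp h t \<omega> - interp h s \<omega> = (t - s) *\<^sub>R b (mf h (grid_index h s) \<omega>) (mf_mean h (grid_index h s))
     + \<sigma> (mf h (grid_index h s) \<omega>) (mf_mean h (grid_index h s)) *v (W t \<omega> - W s \<omega>)"
proof -
  define n where "n = grid_index h s"
  have n: "real n * h \<le> s" "s < real (Suc n) * h" using grid_index_bounds[OF h st(1)] by (auto simp: n_def)
  have t: "t \<le> real (Suc n) * h" using gap[of "Suc n"] n by auto
  have Is: "interp h s \<omega> = mf h n \<omega> + (s - real n * h) *\<^sub>R b (mf h n \<omega>) (mf_mean h n)
     + \<sigma> (mf h n \<omega>) (mf_mean h n) *v (W s \<omega> - W (real n * h) \<omega>)"
    by (simp add: interp_def Let_def n_def)
  have It: "interp h t \<omega> = mf h n \<omega> + (t - real n * h) *\<^sub>R b (mf h n \<omega>) (mf_mean h n)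
     + \<sigma> (mf h n \<omega>) (mf_mean h n) *v (W t \<omega> - W (real n * h) \<omega>)"
  proof (cases "t = real (Suc n) * h")
    case True
    have "grid_index h t = Suc n" by (rule grid_index_eqI[OF h]) (use True h in auto)
    then have "interp h t \<omega> = mf h (Suc n) \<omega>" using True by (simp add: interp_def Let_def)
    moreover have "t - real n * h = h" using True by (simp add: algebra_simps)
    ultimately show ?thesis using True by (simp add: mf_Suc)
  next
    case False
    have "grid_index h t = n" by (rule grid_index_eqI[OF h]) (use False t n st in auto)
    then show ?thesis by (simp add: interp_def Let_def)
  qed
  show ?thesis
    unfolding Is It n_def[symmetric]
    by (simp add: algebra_simps matrix_vector_mult_diff_distrib)
qed

lemma interp_0: "0 < h \<Longrightarrow> interp h 0 \<omega> = \<xi> \<omega>"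
  using grid_index_eqI[of h 0 0] by (simp add: interp_def Let_def)

lemma interp_moment_ex:
  assumes "0 < h" "h \<le> h0" "0 \<le> t" "t \<le> T"
  shows "\<exists>u. moment_le M p u (interp h t)"
proof -
  obtain u where "moment_le M p u (mf h (grid_index h t))" using mf_moment_ex assms by blast
  from moment_le_add[OF p1 interp_freeze[OF assms] this] show ?thesis by auto
qed

text \<open>Both schemes have the same initial value and noise, so on the union of their grids the
  difference of the interpolations is one stochastic sum. Its coefficients are controlled by that
  difference, the two freezing errors, and the difference of the means, itself bounded by the same
  moments. Gronwall for d + 2 \<open>freeze_const\<close> H closes the estimate.\<close>

lemma mf_strong_error:
  assumes h: "0 < h" "h \<le> h0" and h': "0 < h'" "h' \<le> h0" and t: "0 \<le> t" "t \<le> T"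
  shows "moment_le M p (strong_const * max h h' powr (p / 2))
     (\<lambda>\<omega>. mf h (grid_index h t) \<omega> - mf h' (grid_index h' t) \<omega>)"
proof -
  define H where "H = max h h' powr (p / 2)"
  define D where "D s \<omega> = interp h s \<omega> - interp h' s \<omega>" for s \<omega>
  define d where "d s = expectation (\<lambda>\<omega>. norm (D s \<omega>) powr p)" for s
  have D: "moment_le M p (d s) (D s)" if s: "0 \<le> s" "s \<le> T" for s
  proof -
    obtain u u' where u: "moment_le M p u (interp h s)" "moment_le M p u' (interp h' s)"
      using interp_moment_ex h h' s by blast
    have "moment_le M p (1 powr p * u') (\<lambda>\<omega>. - interp h' s \<omega>)"
      by (rule moment_le_scaled[OF u(2)]) (use p1 moment_leD(1)[OF u(2)] in auto)
    from moment_le_add[OF p1 u(1) this] show ?thesis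
      by (simp add: D_def[abs_def] d_def moment_le_def)
  qed
  have Hh: "freeze_const * h powr (p / 2) \<le> freeze_const * H" "freeze_const * h' powr (p / 2) \<le> freeze_const * H"
    unfolding H_def using h h' p1 consts_nonneg by (auto intro!: mult_left_mono powr_mono2)
  have diff: "moment_le M p (3 powr p * (2 * freeze_const * H + d s))
      (\<lambda>\<omega>. mf h (grid_index h s) \<omega> - mf h' (grid_index h' s) \<omega>)" if s: "0 \<le> s" "s \<le> T" for s
  proof -
    have "moment_le M p (1 powr p * 3 powr p * (freeze_const * H + d s + freeze_const * H))
      (\<lambda>\<omega>. mf h (grid_index h s) \<omega> - mf h' (grid_index h' s) \<omega>)"
    proof (rule moment_le_dom3[OF p1 _ D[OF s]])
      show "moment_le M p (freeze_const * H) (\<lambda>\<omega>. interp h s \<omega> - mf h (grid_index h s) \<omega>)"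
        by (rule moment_le_mono[OF interp_freeze[OF h s] Hh(1)])
      show "moment_le M p (freeze_const * H) (\<lambda>\<omega>. interp h' s \<omega> - mf h' (grid_index h' s) \<omega>)"
        by (rule moment_le_mono[OF interp_freeze[OF h' s] Hh(2)])
      show "(\<lambda>\<omega>. mf h (grid_index h s) \<omega> - mf h' (grid_index h' s) \<omega>) \<in> borel_measurable M"
        using mf_M h h' by auto
      fix \<omega>
      show "norm (mf h (grid_index h s) \<omega> - mf h' (grid_index h' s) \<omega>)
        \<le> 1 * (norm (interp h s \<omega> - mf h (grid_index h s) \<omega>) + norm (D s \<omega>) + norm (interp h' s \<omega> - mf h' (grid_index h' s) \<omega>))"
        unfolding D_def by norm
    qed simp
    then show ?thesis by (simp add: algebra_simps)
  qed
  have mean: "norm (mf_mean h (grid_index h s) - mf_mean h' (grid_index h' s)) powr p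
      \<le> K powr p * (3 powr p * (2 * freeze_const * H + d s))" if s: "0 \<le> s" "s \<le> T" for s
  proof -
    have "mf_mean h (grid_index h s) - mf_mean h' (grid_index h' s) =
      expectation (\<lambda>\<omega>. R (mf h (grid_index h s) \<omega>) - R (mf h' (grid_index h' s) \<omega>))"
      unfolding mf_mean_def using mf_integrable h h' by simp
    then show ?thesis
      using norm_expectation_powr_le[OF p1 moment_le_R_diff[OF diff[OF s]]] mf_M h h' by simp
  qed
  define L where "L = lip_const * 3 powr p"
  have L0: "0 \<le> L" unfolding L_def using consts_nonneg by simp
  have coeff: "moment_le M p (L * (2 * freeze_const * H + d s))
       (\<lambda>\<omega>. b (mf h (grid_index h s) \<omega>) (mf_mean h (grid_index h s)) - b (mf h' (grid_index h' s) \<omega>) (mf_mean h' (grid_index h' s)))"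
     "moment_le M p (L * (2 * freeze_const * H + d s))
       (\<lambda>\<omega>. \<sigma> (mf h (grid_index h s) \<omega>) (mf_mean h (grid_index h s)) - \<sigma> (mf h' (grid_index h' s) \<omega>) (mf_mean h' (grid_index h' s)))"
    if s: "0 \<le> s" "s \<le> T" for s
  proof -
    have eq: "K powr p * 2 powr p * (3 powr p * (2 * freeze_const * H + d s) + K powr p * (3 powr p * (2 * freeze_const * H + d s)))
       = L * (2 * freeze_const * H + d s)"
      by (simp add: L_def lip_const_def algebra_simps)
    note l = moment_le_lip_diff[OF b_lip diff[OF s] moment_le_mono[OF moment_le_const mean[OF s]], unfolded eq]
      moment_le_lip_diff[OF \<sigma>_lip diff[OF s] moment_le_mono[OF moment_le_const mean[OF s]], unfolded eq]
    show "moment_le M p (L * (2 * freeze_const * H + d s))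
       (\<lambda>\<omega>. b (mf h (grid_index h s) \<omega>) (mf_mean h (grid_index h s)) - b (mf h' (grid_index h' s) \<omega>) (mf_mean h' (grid_index h' s)))"
     "moment_le M p (L * (2 * freeze_const * H + d s))
       (\<lambda>\<omega>. \<sigma> (mf h (grid_index h s) \<omega>) (mf_mean h (grid_index h s)) - \<sigma> (mf h' (grid_index h' s) \<omega>) (mf_mean h' (grid_index h' s)))"
      using mf_M h h' by (auto intro!: l)
  qed
  define G where "G = insert 0 (insert t ((\<lambda>n. real n * h) ` {n. real n * h \<le> t} \<union> (\<lambda>n. real n * h') ` {n. real n * h' \<le> t}))"
  have fin: "finite {n. real n * x \<le> t}" if "0 < x" for x
  proof (rule finite_subset)
    show "{n. real n * x \<le> t} \<subseteq> {..nat \<lfloor>t / x\<rfloor>}"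
      using that by (auto simp: le_nat_floor field_simps)
  qed simp
  have G: "finite G" "G \<noteq> {}" "G \<subseteq> {0..t}" unfolding G_def using fin h h' t by auto
  obtain \<tau> N where \<tau>: "\<tau> ` {..N} = G" "\<And>k. k < N \<Longrightarrow> \<tau> k < \<tau> (Suc k)"
    using finite_real_grid[OF G(1,2)] by blast
  note \<tau>_mono = chain_mono[of N \<tau>, OF \<tau>(2)]
  have \<tau>_in: "0 \<le> \<tau> k" "\<tau> k \<le> t" if "k \<le> N" for k
    using \<tau>(1) G(3) that by (auto simp: set_eq_iff subset_iff)
  have ends: "\<tau> 0 = 0" "\<tau> N = t"
  proof -
    have "0 \<in> \<tau> ` {..N}" "t \<in> \<tau> ` {..N}" unfolding \<tau>(1) by (auto simp: G_def)
    then obtain i j where "i \<le> N" "\<tau> i = 0" "j \<le> N" "\<tau> j = t" by auto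
    then show "\<tau> 0 = 0" "\<tau> N = t" using \<tau>_mono[of 0 i] \<tau>_mono[of j N] \<tau>_in[of 0] \<tau>_in[of N] by auto
  qed
  have gap: "\<not> (\<tau> k < real n * x \<and> real n * x < \<tau> (Suc k))" if k: "k < N" and x: "x = h \<or> x = h'" for k n x
  proof
    assume *: "\<tau> k < real n * x \<and> real n * x < \<tau> (Suc k)"
    then have "real n * x \<le> t" using \<tau>_in[of "Suc k"] k by simp
    then have "real n * x \<in> G" using x unfolding G_def by auto
    then obtain i where i: "i \<le> N" "real n * x = \<tau> i" unfolding \<tau>(1)[symmetric] by auto
    show False
    proof (cases "i \<le> k")
      case True
      then show False using \<tau>_mono[of i k] k * i by simp
    next
      case False
      then show False using \<tau>_mono[of "Suc k" i] i * by simp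
    qed
  qed
  define B where "B k \<omega> = b (mf h (grid_index h (\<tau> k)) \<omega>) (mf_mean h (grid_index h (\<tau> k)))
      - b (mf h' (grid_index h' (\<tau> k)) \<omega>) (mf_mean h' (grid_index h' (\<tau> k)))" for k \<omega>
  define A where "A k \<omega> = \<sigma> (mf h (grid_index h (\<tau> k)) \<omega>) (mf_mean h (grid_index h (\<tau> k)))
      - \<sigma> (mf h' (grid_index h' (\<tau> k)) \<omega>) (mf_mean h' (grid_index h' (\<tau> k)))" for k \<omega>
  let ?S = "\<lambda>m \<omega>. \<Sum>k<m. (\<tau> (Suc k) - \<tau> k) *\<^sub>R B k \<omega> + A k \<omega> *v (W (\<tau> (Suc k)) \<omega> - W (\<tau> k) \<omega>)"
  have D_sum: "D (\<tau> m) \<omega> = ?S m \<omega>" if "m \<le> N" for m \<omega>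
    using that
  proof (induction m)
    case 0
    then show ?case using h h' by (simp add: ends D_def interp_0)
  next
    case (Suc m)
    then have m: "m < N" by simp
    have "D (\<tau> (Suc m)) \<omega> - D (\<tau> m) \<omega> = (interp h (\<tau> (Suc m)) \<omega> - interp h (\<tau> m) \<omega>) - (interp h' (\<tau> (Suc m)) \<omega> - interp h' (\<tau> m) \<omega>)"
      by (simp add: D_def)
    also have "\<dots> = (\<tau> (Suc m) - \<tau> m) *\<^sub>R B m \<omega> + A m \<omega> *v (W (\<tau> (Suc m)) \<omega> - W (\<tau> m) \<omega>)"
      using interp_step[OF h(1) _ \<tau>(2)[OF m]] interp_step[OF h'(1) _ \<tau>(2)[OF m]] gap[OF m] \<tau>_in[of m] m
      by (simp add: A_def B_def scaleR_diff_right matrix_vector_mult_diff_rdistrib)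
    finally show ?case using Suc by (simp add: algebra_simps)
  qed
  have rec: "d (\<tau> i) + 2 * freeze_const * H \<le> 2 * freeze_const * H
      + (\<Sum>k<i. \<kappa> * 2 * L * (\<tau> (Suc k) - \<tau> k) * (d (\<tau> k) + 2 * freeze_const * H))" if i: "i \<le> N" for i
  proof -
    have "moment_le M p (\<kappa> * (\<Sum>k<i. (\<tau> (Suc k) - \<tau> k) * (L * (2 * freeze_const * H + d (\<tau> k)) + L * (2 * freeze_const * H + d (\<tau> k))))) (running_max ?S i)"
    proof (rule moment_le_ito)
      show "\<tau> i - \<tau> 0 \<le> T" "0 \<le> \<tau> 0" using ends \<tau>_in[OF i] t by auto
      fix k assume k: "k < i"
      then have kN: "k < N" using i by simp
      show "\<tau> k < \<tau> (Suc k)" using \<tau>(2) kN by simp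
      have s: "0 \<le> \<tau> k" "\<tau> k \<le> T" using \<tau>_in[of k] kN t by auto
      show "moment_le M p (L * (2 * freeze_const * H + d (\<tau> k))) (A k)"
        unfolding A_def using coeff[OF s] by auto
      show "moment_le M p (L * (2 * freeze_const * H + d (\<tau> k))) (B k)"
        unfolding B_def using coeff[OF s] by auto
      show "A k \<in> borel_measurable (F (\<tau> k))"
        unfolding A_def using mf_coeff_F(2)[OF h(1) grid_index_bounds(1)[OF h(1) s(1)]]
           mf_coeff_F(2)[OF h'(1) grid_index_bounds(1)[OF h'(1) s(1)]] by (rule borel_measurable_diff)
    qed
    then have "moment_le M p (\<kappa> * (\<Sum>k<i. (\<tau> (Suc k) - \<tau> k) * (L * (2 * freeze_const * H + d (\<tau> k)) + L * (2 * freeze_const * H + d (\<tau> k))))) (D (\<tau> i))"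
    proof (rule moment_le_dom)
      show "D (\<tau> i) \<in> borel_measurable M" using moment_leD(1)[OF D] \<tau>_in[OF i] t by simp
      show "norm (D (\<tau> i) \<omega>) \<le> norm (running_max ?S i \<omega>)" for \<omega>
        unfolding D_sum[OF i] using running_max_ge[of i i ?S \<omega>] by simp
    qed (use p1 in simp)
    from moment_leD(3)[OF this] have "d (\<tau> i) \<le> \<kappa> * (\<Sum>k<i. (\<tau> (Suc k) - \<tau> k) * (L * (2 * freeze_const * H + d (\<tau> k)) + L * (2 * freeze_const * H + d (\<tau> k))))"
      by (simp add: d_def)
    also have "\<dots> = (\<Sum>k<i. \<kappa> * 2 * L * (\<tau> (Suc k) - \<tau> k) * (d (\<tau> k) + 2 * freeze_const * H))"
      unfolding sum_distrib_left by (intro sum.cong) (auto simp: algebra_simps)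
    finally show ?thesis by simp
  qed
  have H0: "0 \<le> 2 * freeze_const * H" unfolding H_def using consts_nonneg by simp
  have "d (\<tau> N) + 2 * freeze_const * H \<le> 2 * freeze_const * H * exp (\<kappa> * 2 * L * (\<Sum>k<N. \<tau> (Suc k) - \<tau> k))"
    by (rule discrete_gronwall[where N = N and x = "\<lambda>k. d (\<tau> k) + 2 * freeze_const * H" and \<delta> = "\<lambda>k. \<tau> (Suc k) - \<tau> k"])
      (use H0 \<kappa>0 L0 \<tau>(2) rec in \<open>auto intro: less_imp_le\<close>)
  also have "(\<Sum>k<N. \<tau> (Suc k) - \<tau> k) = t" unfolding sum_lessThan_telescope ends by simp
  also have "2 * freeze_const * H * exp (\<kappa> * 2 * L * t) \<le> 2 * freeze_const * H * exp (\<kappa> * 2 * L * T)"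
    using H0 \<kappa>0 L0 t by (intro mult_left_mono iffD2[OF exp_le_cancel_iff]) auto
  finally have "d (\<tau> N) \<le> 2 * freeze_const * H * exp (\<kappa> * 2 * L * T)" using H0 by linarith
  then have "d t \<le> 2 * freeze_const * H * exp (\<kappa> * 2 * L * T)" unfolding ends .
  then have "3 powr p * (2 * freeze_const * H + d t) \<le> 3 powr p * (2 * freeze_const * H + 2 * freeze_const * H * exp (\<kappa> * 2 * L * T))"
    by (intro mult_left_mono add_left_mono) auto
  also have "\<dots> = strong_const * H"
    by (simp add: strong_const_def L_def algebra_simps)
  finally show ?thesis unfolding H_def[symmetric] by (rule moment_le_mono[OF diff[OF t]])
qed

end

section \<open>Equality in law of mean-field particles\<close>

lemma (in prob_space) distr_pair_indep_set:
  assumes ind: "indep_set (sets F) (sets H)" and sp: "space F = space M" "space H = space M"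
    and X: "X \<in> measurable F N" and Z: "Z \<in> measurable H N'"
  shows "distr M (N \<Otimes>\<^sub>M N') (\<lambda>\<omega>. (X \<omega>, Z \<omega>)) = distr M N X \<Otimes>\<^sub>M distr M N' Z"
proof (rule pair_measure_eqI[symmetric])
  have XM[measurable]: "X \<in> measurable M N"
    using X sp(1) indep_setD_ev1[OF ind] by (rule measurable_sub_algebra)
  have ZM[measurable]: "Z \<in> measurable M N'"
    using Z sp(2) indep_setD_ev2[OF ind] by (rule measurable_sub_algebra)
  interpret X: prob_space "distr M N X" by (rule prob_space_distr) simp
  interpret Z: prob_space "distr M N' Z" by (rule prob_space_distr) simp
  show "sigma_finite_measure (distr M N X)" "sigma_finite_measure (distr M N' Z)" by unfold_locales
  show "sets (distr M N X \<Otimes>\<^sub>M distr M N' Z) = sets (distr M (N \<Otimes>\<^sub>M N') (\<lambda>\<omega>. (X \<omega>, Z \<omega>)))"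
    by (simp cong: sets_pair_measure_cong)
  fix A B assume A: "A \<in> sets (distr M N X)" and B: "B \<in> sets (distr M N' Z)"
  have "(\<lambda>\<omega>. (X \<omega>, Z \<omega>)) -` (A \<times> B) \<inter> space M = (X -` A \<inter> space M) \<inter> (Z -` B \<inter> space M)" by auto
  moreover have "X -` A \<inter> space M \<in> sets F" "Z -` B \<inter> space M \<in> sets H"
    using measurable_sets[OF X, of A] measurable_sets[OF Z, of B] A B sp by auto
  ultimately have "prob ((\<lambda>\<omega>. (X \<omega>, Z \<omega>)) -` (A \<times> B) \<inter> space M) = prob (X -` A \<inter> space M) * prob (Z -` B \<inter> space M)"
    using indep_setD[OF ind] by simp
  then show "emeasure (distr M N X) A * emeasure (distr M N' Z) B = emeasure (distr M (N \<Otimes>\<^sub>M N') (\<lambda>\<omega>. (X \<omega>, Z \<omega>))) (A \<times> B)"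
    using A B by (simp add: emeasure_distr emeasure_eq_measure ennreal_mult)
qed

text \<open>The recursion depends on its randomness only through the current state and the next
  increment. These are independent of each other, and each has the same law for both particles, so
  the laws, and with them the means of R, agree step by step.\<close>

lemma mean_field_distr:
  assumes 1: "particle b \<sigma> R p T h0 K m0 \<kappa> \<gamma> M F1 W1 \<xi>1"
    and 2: "particle b \<sigma> R p T h0 K m0 \<kappa> \<gamma> M F2 W2 \<xi>2"
    and h: "0 < h" and eq: "distr M borel \<xi>1 = distr M borel \<xi>2"
  shows "distr M borel (mean_field M b \<sigma> R h \<xi>1 W1 n) = distr M borel (mean_field M b \<sigma> R h \<xi>2 W2 n)"
proof (induction n)
  case 0
  then show ?case using eq by simp
next
  case (Suc n)
  interpret P1: particle b \<sigma> R p T h0 K m0 \<kappa> \<gamma> M F1 W1 \<xi>1 by fact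
  interpret P2: particle b \<sigma> R p T h0 K m0 \<kappa> \<gamma> M F2 W2 \<xi>2 by fact
  note X1 = P1.mf_M[OF h, of n] and X2 = P2.mf_M[OF h, of n]
  have R: "R \<in> borel_measurable borel" using P1.measurable_R[of "\<lambda>x. x"] by simp
  have "P1.mf_mean h n = integral\<^sup>L (distr M borel (P1.mf h n)) R"
    unfolding P1.mf_mean_def using X1 R by (simp add: integral_distr)
  also have "\<dots> = P2.mf_mean h n"
    unfolding P2.mf_mean_def Suc using X2 R by (simp add: integral_distr)
  finally have mean: "P1.mf_mean h n = P2.mf_mean h n" .
  define \<mu> where "\<mu> = P2.mf_mean h n"
  define \<Phi> where "\<Phi> = (\<lambda>(x, z). x + h *\<^sub>R b x \<mu> + \<sigma> x \<mu> *v z)"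
  have \<Phi>: "\<Phi> \<in> measurable (borel \<Otimes>\<^sub>M borel) borel"
    unfolding \<Phi>_def split_beta
    by (intro borel_measurable_add borel_measurable_scaleR borel_measurable_const
        borel_measurable_matrix_vector P1.measurable_b P1.measurable_\<sigma>) auto
  have lt: "0 \<le> real n * h" "real n * h < real (Suc n) * h" using h by auto
  let ?Z1 = "\<lambda>\<omega>. W1 (real (Suc n) * h) \<omega> - W1 (real n * h) \<omega>"
  let ?Z2 = "\<lambda>\<omega>. W2 (real (Suc n) * h) \<omega> - W2 (real n * h) \<omega>"
  have Z1: "?Z1 \<in> borel_measurable M"
    using lt by (intro P1.measurable_F_M[OF P1.incr_measurable[OF _ _ order.refl]]) auto
  have Z2: "?Z2 \<in> borel_measurable M"
    using lt by (intro P2.measurable_F_M[OF P2.incr_measurable[OF _ _ order.refl]]) auto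
  have "distr M borel ?Z1 = distr M lborel ?Z1" by (intro distr_cong) auto
  also have "\<dots> = distr M lborel ?Z2"
    using P1.incr_distributed[OF lt] P2.incr_distributed[OF lt]
    by (simp add: distributed_distr_eq_density)
  also have "\<dots> = distr M borel ?Z2" by (intro distr_cong) auto
  finally have Z_eq: "distr M borel ?Z1 = distr M borel ?Z2" .
  have "distr M borel (P1.mf h (Suc n)) = distr M borel (\<Phi> \<circ> (\<lambda>\<omega>. (P1.mf h n \<omega>, ?Z1 \<omega>)))"
    by (intro distr_cong) (auto simp: P1.mf_Suc mean \<Phi>_def \<mu>_def)
  also have "\<dots> = distr (distr M (borel \<Otimes>\<^sub>M borel) (\<lambda>\<omega>. (P1.mf h n \<omega>, ?Z1 \<omega>))) borel \<Phi>"
    using \<Phi> X1 Z1 by (intro distr_distr[symmetric]) auto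
  also have "distr M (borel \<Otimes>\<^sub>M borel) (\<lambda>\<omega>. (P1.mf h n \<omega>, ?Z1 \<omega>)) = distr M borel (P1.mf h n) \<Otimes>\<^sub>M distr M borel ?Z1"
    by (rule P1.distr_pair_indep_set[OF P1.incr_indep[OF lt]])
      (auto simp: P1.space_F P1.mf_F[OF h] intro!: measurable_vimage_algebra1)
  also have "\<dots> = distr M borel (P2.mf h n) \<Otimes>\<^sub>M distr M borel ?Z2"
    unfolding Suc Z_eq ..
  also have "\<dots> = distr M (borel \<Otimes>\<^sub>M borel) (\<lambda>\<omega>. (P2.mf h n \<omega>, ?Z2 \<omega>))"
    by (rule P1.distr_pair_indep_set[OF P2.incr_indep[OF lt], symmetric])
      (auto simp: P2.space_F P2.mf_F[OF h] intro!: measurable_vimage_algebra1)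
  also have "distr \<dots> borel \<Phi> = distr M borel (\<Phi> \<circ> (\<lambda>\<omega>. (P2.mf h n \<omega>, ?Z2 \<omega>)))"
    using \<Phi> X2 Z2 by (intro distr_distr) auto
  also have "\<dots> = distr M borel (P2.mf h (Suc n))"
    by (intro distr_cong) (auto simp: P2.mf_Suc \<Phi>_def \<mu>_def)
  finally show ?case .
qed

subsection \<open>The multilevel scheme\<close>

text \<open>With the interaction input y left abstract, fine and coarse particles are covered at
  once. The errors on the right occur at indices k < n only, since the scheme is explicit; the
  induction on n rests on this.\<close>

lemma (in particle) scheme_error:
  assumes h: "0 < h" and n: "real n * h \<le> T"
    and Z0: "\<And>\<omega>. \<omega> \<in> space M \<Longrightarrow> Z 0 \<omega> = \<xi> \<omega>"
    and Z_Suc: "\<And>k \<omega>. \<omega> \<in> space M \<Longrightarrow> Z (Suc k) \<omega> = euler_step b \<sigma> h W k \<omega> (y k \<omega>) (Z k \<omega>)"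
    and Z_F: "\<And>k. k < n \<Longrightarrow> Z k \<in> borel_measurable (F (real k * h))"
    and y_F: "\<And>k. k < n \<Longrightarrow> y k \<in> borel_measurable (F (real k * h))"
    and u: "\<And>k. k < n \<Longrightarrow> moment_le M p (u k) (\<lambda>\<omega>. Z k \<omega> - mf h k \<omega>)"
    and v: "\<And>k. k < n \<Longrightarrow> moment_le M p (v k) (\<lambda>\<omega>. y k \<omega> - mf_mean h k)"
  shows "moment_le M p (\<kappa> * (2 * (K powr p * 2 powr p)) * (\<Sum>k<n. h * (u k + v k)))
     (running_max (\<lambda>m \<omega>. Z m \<omega> - mf h m \<omega>) n)"
proof -
  define B where "B k \<omega> = b (Z k \<omega>) (y k \<omega>) - b (mf h k \<omega>) (mf_mean h k)" for k \<omega>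
  define A where "A k \<omega> = \<sigma> (Z k \<omega>) (y k \<omega>) - \<sigma> (mf h k \<omega>) (mf_mean h k)" for k \<omega>
  let ?S = "\<lambda>m \<omega>. \<Sum>k<m. (real (Suc k) * h - real k * h) *\<^sub>R B k \<omega> + A k \<omega> *v (W (real (Suc k) * h) \<omega> - W (real k * h) \<omega>)"
  have S: "Z m \<omega> - mf h m \<omega> = ?S m \<omega>" if w: "\<omega> \<in> space M" for m \<omega>
  proof (induction m)
    case 0
    then show ?case using Z0[OF w] by simp
  next
    case (Suc m)
    have "real (Suc m) * h - real m * h = h" by (simp add: algebra_simps)
    then show ?case using Suc[symmetric]
      by (simp add: Z_Suc[OF w] mf_Suc euler_step_def A_def B_def scaleR_diff_right
          matrix_vector_mult_diff_rdistrib add.commute)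
  qed
  let ?u = "\<lambda>k. K powr p * 2 powr p * (u k + v k)"
  have "moment_le M p (\<kappa> * (\<Sum>k<n. (real (Suc k) * h - real k * h) * (?u k + ?u k))) (running_max ?S n)"
  proof (rule moment_le_ito)
    show "real n * h - real 0 * h \<le> T" using n by simp
    fix k assume k: "k < n"
    show "real k * h < real (Suc k) * h" using h by simp
    show "moment_le M p (?u k) (A k)" "moment_le M p (?u k) (B k)"
      unfolding A_def B_def
      by (intro moment_le_lip_diff[OF b_lip] moment_le_lip_diff[OF \<sigma>_lip] u v k measurable_F_M[OF Z_F] measurable_F_M[OF y_F] mf_M h borel_measurable_const)+
    show "A k \<in> borel_measurable (F (real k * h))"
      unfolding A_def using mf_coeff_F(2)[OF h order.refl, of k] measurable_\<sigma>[OF Z_F[OF k] y_F[OF k]]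
      by (rule borel_measurable_diff[rotated])
  qed simp
  also have "\<kappa> * (\<Sum>k<n. (real (Suc k) * h - real k * h) * (?u k + ?u k)) =
      \<kappa> * (2 * (K powr p * 2 powr p)) * (\<Sum>k<n. h * (u k + v k))"
    unfolding sum_distrib_left by (intro sum.cong) (auto simp: algebra_simps)
  finally show ?thesis
    by (rule moment_le_cong) (simp add: running_max_def S)
qed

section \<open>Constants and parameters of the multilevel bound\<close>

locale ml_coeffs = mv_coeffs b \<sigma> R p T h0 K m0 \<kappa> \<gamma>
  for b :: "real ^ 'd \<Rightarrow> real ^ 'r \<Rightarrow> real ^ 'd" and \<sigma> :: "real ^ 'd \<Rightarrow> real ^ 'r \<Rightarrow> real ^ 'm ^ 'd"
    and R :: "real ^ 'd \<Rightarrow> real ^ 'r" and p T h0 K m0 \<kappa> \<gamma> :: real +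
  fixes a q :: real
  assumes a1: "1 < a" and q1: "1 < q"
begin

definition geom_const :: real where
  "geom_const = q / (q - 1)"

text \<open>One constant for all levels: in the parentheses, the first summand comes from the strong
  error at levels k \<ge> 1, the second from the plain moment at level 0. The factors 2^(p/2) and
  a^(p/2) make up for the floors in the ensemble sizes and in L.\<close>

definition stat_const :: real where
  "stat_const = (average_const p * 2 powr (p / 2) * a powr (p / 2) *
     (K powr p * (strong_const * (h0 * a) powr (p / 2)) + K powr p * 3 powr p * (1 + mf_const))) powr (1 / p)"

text \<open>The exponential rate of the error: 1 stands for the feedback of a particle's own error,
  the other summand for that of the errors in its interaction term.\<close>

definition rate_const :: real where
  "rate_const = \<kappa> * (2 * (K powr p * 2 powr p)) * (1 + 2 powr p * (2 * K * geom_const) powr p)"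

text \<open>Chosen so that its p-th power is the statistical contribution accumulated over [0, T],
  in units of the p-th power of \<epsilon> / q^(L-l).\<close>

definition base_const :: real where
  "base_const = (\<kappa> * (2 * (K powr p * 2 powr p)) * (2 powr p * (stat_const * geom_const) powr p) * T) powr (1 / p)"

lemma stat_const_nonneg: "0 \<le> stat_const" by (simp add: stat_const_def)

lemma rate_const_nonneg: "0 \<le> rate_const" using \<kappa>0 by (simp add: rate_const_def)

lemma base_const_nonneg: "0 \<le> base_const" by (simp add: base_const_def)

lemma stat_const_powr: "stat_const powr p = average_const p * 2 powr (p / 2) * a powr (p / 2) *
     (K powr p * (strong_const * (h0 * a) powr (p / 2)) + K powr p * 3 powr p * (1 + mf_const))"
proof -
  have "0 \<le> average_const p * 2 powr (p / 2) * a powr (p / 2) *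
     (K powr p * (strong_const * (h0 * a) powr (p / 2)) + K powr p * 3 powr p * (1 + mf_const))"
    using consts_nonneg by (intro mult_nonneg_nonneg add_nonneg_nonneg) auto
  then show ?thesis using p1 by (simp add: stat_const_def powr_powr)
qed

lemma base_const_powr:
  "base_const powr p = \<kappa> * (2 * (K powr p * 2 powr p)) * (2 powr p * (stat_const * geom_const) powr p) * T"
  using \<kappa>0 T p1 by (simp add: base_const_def powr_powr)

end

locale ml_system = ml_coeffs b \<sigma> R p T h0 K m0 \<kappa> \<gamma> a q + prob_space M
  for b :: "real ^ 'd \<Rightarrow> real ^ 'r \<Rightarrow> real ^ 'd" and \<sigma> :: "real ^ 'd \<Rightarrow> real ^ 'r \<Rightarrow> real ^ 'm ^ 'd"
    and R :: "real ^ 'd \<Rightarrow> real ^ 'r" and p T h0 K m0 \<kappa> \<gamma> a q :: real and M :: "'w measure" +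
  fixes C\<^sub>J \<epsilon> :: real and \<rho>0 :: "(real ^ 'd) measure" and L :: nat and J :: "nat \<Rightarrow> nat"
    and \<xi> :: "nat \<Rightarrow> nat \<Rightarrow> 'w \<Rightarrow> real ^ 'd" and W :: "nat \<Rightarrow> nat \<Rightarrow> real \<Rightarrow> 'w \<Rightarrow> real ^ 'm"
    and X X' :: "nat \<Rightarrow> nat \<Rightarrow> nat \<Rightarrow> 'w \<Rightarrow> real ^ 'd"
  assumes CJ: "1 \<le> C\<^sub>J" and \<epsilon>: "0 < \<epsilon>" and L_def: "L = num_levels a \<epsilon>" and J_def: "J = num_samples C\<^sub>J q a L"
    and noise: "driving_noise M \<rho>0 (SIGMA l:{..L}. {1..J l}) \<xi> W"
    and scheme: "ml_scheme M b \<sigma> R a h0 L J \<xi> W X X'"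
    and sets_\<rho>0: "sets \<rho>0 = sets borel" and \<rho>0_int: "integrable \<rho>0 (\<lambda>x. norm x powr p)"
    and \<rho>0_moment: "(\<integral>x. norm x powr p \<partial>\<rho>0) \<le> m0"
begin

abbreviation "I \<equiv> SIGMA l:{..L}. {1..J l}"
abbreviation "\<F> \<equiv> noise_filtration M \<xi> W I"
abbreviation "dt \<equiv> time_step a h0"
abbreviation "err l \<equiv> \<epsilon> / q ^ (L - l)"
abbreviation "MF h l j \<equiv> mean_field M b \<sigma> R h (\<xi> l j) (W l j)"

lemma finite_I: "finite I" by auto

lemma dt_pos: "0 < dt l" using h0 a1 by (simp add: time_step_def)

lemma dt_le: "dt l \<le> h0"
  using h0 a1 by (simp add: time_step_def divide_le_eq mult_left_mono[of 1 "a ^ l" h0, simplified] one_le_power)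

lemma dt_antimono: "k \<le> l \<Longrightarrow> dt l \<le> dt k"
  using h0 a1 by (simp add: time_step_def frac_le power_increasing)

lemma particleI:
  assumes "(l, j) \<in> I"
  shows "particle b \<sigma> R p T h0 K m0 \<kappa> \<gamma> M \<F> (W l j) (\<xi> l j)"
proof -
  interpret D: driven M \<F> "W l j" by (rule driving_noise_driven[OF noise finite_I assms])
  note init = driving_noise_initial[OF noise assms]
  have "\<xi> l j \<in> borel_measurable (\<F> 0)" by (rule noise_filtration_initial[OF assms])
  moreover have "moment_le M p m0 (\<xi> l j)"
    unfolding moment_le_def
  proof (intro conjI)
    show "integrable M (\<lambda>\<omega>. norm (\<xi> l j \<omega>) powr p)"
      using \<rho>0_int init(1) unfolding init(2)[symmetric] by (subst (asm) integrable_distr_eq) auto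
    have "(\<integral>x. norm x powr p \<partial>\<rho>0) = expectation (\<lambda>\<omega>. norm (\<xi> l j \<omega>) powr p)"
      using init(1) unfolding init(2)[symmetric] by (subst integral_distr) auto
    then show "expectation (\<lambda>\<omega>. norm (\<xi> l j \<omega>) powr p) \<le> m0" using \<rho>0_moment by simp
  qed (rule init(1))
  ultimately show ?thesis by unfold_locales
qed

text \<open>The floor is taken of a number that is at least 1, so it costs at most a factor
  2.\<close>

lemma J_ge: "real (J l) \<ge> q ^ (2 * (L - l)) * a ^ (L - l) / 2" "1 \<le> J l"
proof -
  define z where "z = q ^ (2 * (L - l)) * a ^ (L - l)"
  have "1 * 1 \<le> z" unfolding z_def using q1 a1 by (intro mult_mono one_le_power) auto
  then have z: "1 \<le> z" by simp
  define x where "x = C\<^sub>J * z"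
  have x: "z \<le> x" using mult_right_mono[OF CJ, of z] z by (simp add: x_def)
  have J: "J l = nat \<lfloor>x\<rfloor>" by (simp add: J_def num_samples_def x_def z_def mult.assoc)
  have fl: "1 \<le> \<lfloor>x\<rfloor>" using x z by simp
  then show "1 \<le> J l" unfolding J by linarith
  have "real (J l) = of_int \<lfloor>x\<rfloor>" unfolding J using fl by simp
  then have "real (J l) > x - 1" "1 \<le> real (J l)" using fl by linarith+
  then have "x / 2 \<le> real (J l)" by linarith
  then show "real (J l) \<ge> z / 2" using x by simp
qed

text \<open>The floor gives L + 1 > 2 log_a (1/\<epsilon>), so stopping at level L loses at most the
  factor a^(1/2) against the accuracy \<epsilon>.\<close>

lemma levels_bound: "a powr (- real L / 2) \<le> a powr (1 / 2) * \<epsilon>"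
proof -
  have "log a (1 / \<epsilon>) \<le> (real L + 1) / 2"
  proof -
    have "2 * log a (1 / \<epsilon>) < of_int \<lfloor>2 * log a (1 / \<epsilon>)\<rfloor> + 1" by linarith
    also have "\<dots> \<le> real L + 1" unfolding L_def num_levels_def by simp
    finally show ?thesis by simp
  qed
  then have "a powr log a (1 / \<epsilon>) \<le> a powr ((real L + 1) / 2)" using a1 by (intro powr_mono) auto
  then have "1 / \<epsilon> \<le> a powr ((real L + 1) / 2)" using a1 \<epsilon> by simp
  then have "1 \<le> a powr ((real L + 1) / 2) * \<epsilon>" using \<epsilon> by (simp add: field_simps)
  then have "a powr (- real L / 2) * 1 \<le> a powr (- real L / 2) * (a powr ((real L + 1) / 2) * \<epsilon>)"
    by (intro mult_left_mono) auto
  also have "\<dots> = a powr (- real L / 2 + (real L + 1) / 2) * \<epsilon>" by (simp only: powr_add mult.assoc)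
  also have "- real L / 2 + (real L + 1) / 2 = 1 / 2" by (simp add: field_simps)
  finally show ?thesis by simp
qed

lemma err_pos: "0 < err l" using \<epsilon> q1 by simp

text \<open>This is where the ensemble sizes are balanced: J_k^(-1/2) is at most of order q^(-(L-k))
  a^(-(L-k)/2), and a^(-k/2) completes the last factor to a^(-L/2), which is at most of order
  \<epsilon>.\<close>

lemma J_powr_le:
  assumes k: "k \<le> L"
  shows "real (J k) powr (- p / 2) * (a powr (- real k / 2)) powr p \<le> 2 powr (p / 2) * a powr (p / 2) * err k powr p"
proof -
  define n where "n = L - k"
  have pos: "0 < q ^ (2 * n) * a ^ n / 2" using q1 a1 by simp
  have "real (J k) powr (- p / 2) \<le> (q ^ (2 * n) * a ^ n / 2) powr (- p / 2)"
    using J_ge(1)[of k] pos p1 unfolding n_def by (intro powr_mono2') auto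
  also have "\<dots> = 2 powr (p / 2) * ((1 / q ^ n) * a powr (- real n / 2)) powr p"
  proof -
    have "q ^ (2 * n) * a ^ n / 2 = ((q ^ n * a powr (real n / 2)) powr 2) / 2"
      using q1 a1 by (simp add: powr_mult powr_powr powr_realpow power_mult power_mult_distrib mult.commute
          flip: powr_numeral)
    then have "(q ^ (2 * n) * a ^ n / 2) powr (- p / 2) = (q ^ n * a powr (real n / 2)) powr (- p) / 2 powr (- p / 2)"
      by (simp add: powr_divide powr_powr)
    also have "\<dots> = 2 powr (p / 2) * ((q ^ n * a powr (real n / 2)) powr (- 1)) powr p"
      using q1 a1 by (simp add: powr_minus_divide powr_divide abs_mult)
    also have "(q ^ n * a powr (real n / 2)) powr (- 1) = (1 / q ^ n) * a powr (- real n / 2)"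
      using q1 a1 by (simp add: powr_neg_one powr_minus_divide)
    finally show ?thesis .
  qed
  finally have "real (J k) powr (- p / 2) * (a powr (- real k / 2)) powr p
      \<le> 2 powr (p / 2) * ((1 / q ^ n) * a powr (- real n / 2)) powr p * (a powr (- real k / 2)) powr p"
    by (intro mult_right_mono) auto
  also have "\<dots> = 2 powr (p / 2) * ((1 / q ^ n) * a powr (- real L / 2)) powr p"
  proof -
    have "real L = real n + real k" using k by (simp add: n_def)
    then have "a powr (- real L / 2) = a powr (- real n / 2) * a powr (- real k / 2)"
      unfolding powr_add[symmetric] by (simp add: add_divide_distrib diff_divide_distrib)
    then show ?thesis by (simp only: powr_mult mult.assoc)
  qed
  also have "\<dots> \<le> 2 powr (p / 2) * ((1 / q ^ n) * (a powr (1 / 2) * \<epsilon>)) powr p"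
    using levels_bound p1 q1 by (intro mult_left_mono powr_mono2) auto
  also have "(1 / q ^ n) * (a powr (1 / 2) * \<epsilon>) = a powr (1 / 2) * err k" by (simp add: n_def)
  also have "2 powr (p / 2) * (a powr (1 / 2) * err k) powr p = 2 powr (p / 2) * a powr (p / 2) * err k powr p"
    unfolding powr_mult[of "a powr (1 / 2)" "err k"] by (simp add: powr_powr)
  finally show ?thesis .
qed

text \<open>\<open>err\<close> grows by the factor q per level, and
  \<open>geom_const * q = geom_const + q\<close> closes the induction.\<close>

lemma sum_err_le: "l \<le> L \<Longrightarrow> (\<Sum>k\<le>l. err k) \<le> geom_const * err l"
proof (induction l)
  case 0
  have "1 \<le> geom_const" using q1 by (simp add: geom_const_def)
  then show ?case using mult_right_mono[of 1 geom_const "err 0"] err_pos[of 0] by simp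
next
  case (Suc l)
  have "err (Suc l) = q * err l"
  proof -
    have "q ^ (L - l) = q * q ^ (L - Suc l)"
      using Suc.prems Suc_diff_Suc[of l L] by (metis Suc_le_lessD power_Suc)
    then show ?thesis using q1 by simp
  qed
  moreover have "geom_const * q = geom_const + q" using q1 by (simp add: geom_const_def field_simps)
  then have "geom_const * (q * err l) = geom_const * err l + q * err l"
    by (metis distrib_right mult.assoc)
  ultimately show ?case using Suc by simp
qed

text \<open>Particle 1 is a representative, present because ensembles are nonempty. By equality in
  law any other particle, of whatever level, gives the same mean when run with step
  \<open>dt k\<close>.\<close>

definition mbar :: "nat \<Rightarrow> nat \<Rightarrow> real ^ 'r" where
  "mbar k n = expectation (\<lambda>\<omega>. R (MF (dt k) k 1 n \<omega>))"

lemma mbar_eq: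
  assumes k: "k \<le> L" and i: "(l, j) \<in> I"
  shows "expectation (\<lambda>\<omega>. R (MF (dt k) l j n \<omega>)) = mbar k n"
proof -
  have k1: "(k, 1) \<in> I" using k J_ge(2) by auto
  interpret P1: particle b \<sigma> R p T h0 K m0 \<kappa> \<gamma> M \<F> "W l j" "\<xi> l j" by (rule particleI[OF i])
  interpret P2: particle b \<sigma> R p T h0 K m0 \<kappa> \<gamma> M \<F> "W k 1" "\<xi> k 1" by (rule particleI[OF k1])
  have R: "R \<in> borel_measurable borel" using measurable_R[of "\<lambda>x. x"] by simp
  have eq: "distr M borel (MF (dt k) l j n) = distr M borel (MF (dt k) k 1 n)"
    using driving_noise_initial(2)[OF noise i] driving_noise_initial(2)[OF noise k1]
    by (intro mean_field_distr[OF particleI[OF i] particleI[OF k1] dt_pos]) simp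
  have "expectation (\<lambda>\<omega>. R (MF (dt k) l j n \<omega>)) = integral\<^sup>L (distr M borel (MF (dt k) l j n)) R"
    using P1.mf_M[OF dt_pos] R by (simp add: integral_distr)
  also have "\<dots> = mbar k n"
    unfolding eq mbar_def using P2.mf_M[OF dt_pos] R by (simp add: integral_distr)
  finally show ?thesis .
qed

text \<open>A mean-field particle is a function of its own noise alone. The joint filtration does
  not show this, so measurability is proved for the particle's own algebra, from which independence
  within an ensemble follows.\<close>

lemma mf_particle_algebra:
  assumes h: "0 < h"
  shows "MF h l j n \<in> borel_measurable (particle_algebra M \<xi> W (l, j))"
proof (induction n)
  case 0
  show ?case by (simp add: particle_algebra_initial)
next
  case (Suc n)
  then show ?case unfolding mean_field.simps euler_step_def using h
    by (intro borel_measurable_add borel_measurable_scaleR borel_measurable_const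
        borel_measurable_matrix_vector measurable_b measurable_\<sigma> particle_algebra_incr) auto
qed

section \<open>Statistical error of the mean-field multilevel estimate\<close>

lemma indep_level_algebras:
  assumes k: "k \<le> L"
  shows "indep_sets (\<lambda>j. sets (particle_algebra M \<xi> W (k, j))) {1..J k}"
proof (rule indep_setsI)
  note ind = indep_particle_algebras[OF noise]
  fix j assume "j \<in> {1..J k}"
  then show "sets (particle_algebra M \<xi> W (k, j)) \<subseteq> events" using ind k by (auto simp: indep_sets_def)
next
  note ind = indep_particle_algebras[OF noise]
  fix A N assume N: "N \<noteq> {}" "N \<subseteq> {1..J k}" "finite N" "\<forall>j\<in>N. A j \<in> sets (particle_algebra M \<xi> W (k, j))"
  have "prob (\<Inter>i\<in>Pair k ` N. A (snd i)) = (\<Prod>i\<in>Pair k ` N. prob (A (snd i)))"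
    using ind by (rule indep_setsD) (use N k in auto)
  then show "prob (\<Inter>j\<in>N. A j) = (\<Prod>j\<in>N. prob (A j))"
    by (simp add: prod.reindex inj_on_def image_image)
qed

text \<open>Averaging gains J_k^(-p/2) and the summands bring the factor a^(-kp/2); the product is
  the balanced quantity of \<open>J_powr_le\<close>.\<close>

lemma average_error:
  assumes k: "k \<le> L"
    and Y_alg: "\<And>j. Y j \<in> borel_measurable (particle_algebra M \<xi> W (k, j))"
    and Y: "\<And>j. j \<in> {1..J k} \<Longrightarrow> moment_le M p (v * (a powr (- real k / 2)) powr p) (Y j)"
      "\<And>j. j \<in> {1..J k} \<Longrightarrow> expectation (Y j) = \<mu>"
    and v: "0 \<le> v" "v \<le> K powr p * (strong_const * (h0 * a) powr (p / 2)) + K powr p * 3 powr p * (1 + mf_const)"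
  shows "moment_le M p ((stat_const * err k) powr p) (\<lambda>\<omega>. (1 / real (J k)) *\<^sub>R (\<Sum>j = 1..J k. Y j \<omega>) - \<mu>)"
proof (rule moment_le_mono)
  show "moment_le M p (average_const p * real (J k) powr (- p / 2) * (v * (a powr (- real k / 2)) powr p))
     (\<lambda>\<omega>. (1 / real (J k)) *\<^sub>R (\<Sum>j = 1..J k. Y j \<omega>) - \<mu>)"
    using Y Y_alg k by (intro moment_le_average[OF p2 J_ge(2) indep_level_algebras]) auto
  define c where "c = average_const p * v"
  have c: "0 \<le> c" unfolding c_def using v by simp
  have "average_const p * real (J k) powr (- p / 2) * (v * (a powr (- real k / 2)) powr p)
      = c * (real (J k) powr (- p / 2) * (a powr (- real k / 2)) powr p)"
    unfolding c_def by (simp only: mult_ac)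
  also have "\<dots> \<le> c * (2 powr (p / 2) * a powr (p / 2) * err k powr p)"
    by (intro mult_left_mono J_powr_le c k)
  also have "\<dots> = average_const p * 2 powr (p / 2) * a powr (p / 2) * v * err k powr p"
    unfolding c_def by (simp only: mult_ac)
  also have "\<dots> \<le> stat_const powr p * err k powr p"
    unfolding stat_const_powr by (intro mult_right_mono mult_left_mono v) auto
  also have "\<dots> = (stat_const * err k) powr p" by (simp only: powr_mult)
  finally show "average_const p * real (J k) powr (- p / 2) * (v * (a powr (- real k / 2)) powr p) \<le> (stat_const * err k) powr p" .
qed

lemma stat_error_fine:
  assumes k: "k \<in> {1..L}" and t: "0 \<le> t" "t \<le> T"
  shows "moment_le M p ((stat_const * err k) powr p)
    (\<lambda>\<omega>. (ens_mean R (J k) (\<lambda>j. MF (dt k) k j (grid_index (dt k) t) \<omega>)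
        - ens_mean R (J k) (\<lambda>j. MF (dt (k - 1)) k j (grid_index (dt (k - 1)) t) \<omega>))
        - (mbar k (grid_index (dt k) t) - mbar (k - 1) (grid_index (dt (k - 1)) t)))"
proof -
  let ?i = "grid_index (dt k) t"
  let ?i' = "grid_index (dt (k - 1)) t"
  define Y where "Y j \<omega> = R (MF (dt k) k j ?i \<omega>) - R (MF (dt (k - 1)) k j ?i' \<omega>)" for j \<omega>
  define v where "v = K powr p * (strong_const * (h0 * a) powr (p / 2))"
  have kL: "k \<le> L" "k - 1 \<le> L" using k by auto
  \<comment> \<open>The coarser step governs the strong error; it is a multiple of a^(-k), so its
    power p/2 produces the required a^(-kp/2).\<close>
  have "dt (k - 1) = h0 * a * (a powr (- real k / 2)) powr 2"
  proof -
    have "a ^ k = a * a ^ (k - 1)" using k by (cases k) auto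
    moreover have "(a powr (- real k / 2)) powr 2 = 1 / a ^ k"
      using a1 unfolding powr_powr by (simp add: powr_minus_divide powr_realpow)
    ultimately show ?thesis using a1 by (simp add: time_step_def)
  qed
  then have "dt (k - 1) powr (p / 2) = (h0 * a) powr (p / 2) * (a powr (- real k / 2)) powr p"
    by (simp only: powr_mult powr_powr) simp
  then have v: "K powr p * (strong_const * max (dt k) (dt (k - 1)) powr (p / 2)) = v * (a powr (- real k / 2)) powr p"
    using dt_antimono[of "k - 1" k] by (simp add: v_def)
  have "moment_le M p ((stat_const * err k) powr p)
      (\<lambda>\<omega>. (1 / real (J k)) *\<^sub>R (\<Sum>j = 1..J k. Y j \<omega>) - (mbar k ?i - mbar (k - 1) ?i'))"
  proof (rule average_error[OF kL(1)])
    show "Y j \<in> borel_measurable (particle_algebra M \<xi> W (k, j))" for j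
      unfolding Y_def by (intro borel_measurable_diff measurable_R mf_particle_algebra dt_pos)
    fix j assume j: "j \<in> {1..J k}"
    then have I: "(k, j) \<in> I" using k by auto
    interpret P: particle b \<sigma> R p T h0 K m0 \<kappa> \<gamma> M \<F> "W k j" "\<xi> k j" by (rule particleI[OF I])
    show "moment_le M p (v * (a powr (- real k / 2)) powr p) (Y j)"
      unfolding Y_def v[symmetric]
      by (intro moment_le_R_diff P.mf_strong_error P.mf_M dt_pos dt_le t)
    show "expectation (Y j) = mbar k ?i - mbar (k - 1) ?i'"
      unfolding Y_def using P.mf_integrable[OF dt_pos] mbar_eq[OF _ I] kL by simp
  qed (use consts_nonneg in \<open>auto simp: v_def\<close>)
  then show ?thesis by (simp add: ens_mean_def Y_def sum_subtractf scaleR_diff_right)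
qed

text \<open>Level 0 averages no differences, so only a moment bound is available; it fits the common
  form because a^(-k/2) is 1 for k = 0.\<close>

lemma stat_error_coarse:
  assumes t: "0 \<le> t" "t \<le> T"
  shows "moment_le M p ((stat_const * err 0) powr p)
    (\<lambda>\<omega>. ens_mean R (J 0) (\<lambda>j. MF (dt 0) 0 j (grid_index (dt 0) t) \<omega>) - mbar 0 (grid_index (dt 0) t))"
  unfolding ens_mean_def
proof (rule average_error[where v = "K powr p * 3 powr p * (1 + mf_const)"])
  let ?i = "grid_index (dt 0) t"
  show "(\<lambda>\<omega>. R (MF (dt 0) 0 j ?i \<omega>)) \<in> borel_measurable (particle_algebra M \<xi> W (0, j))" for j
    by (intro measurable_R mf_particle_algebra dt_pos)
  fix j assume "j \<in> {1..J 0}"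
  then have I: "(0, j) \<in> I" by auto
  interpret P: particle b \<sigma> R p T h0 K m0 \<kappa> \<gamma> M \<F> "W 0 j" "\<xi> 0 j" by (rule particleI[OF I])
  have "real ?i * dt 0 \<le> T" using grid_index_bounds(1)[OF dt_pos t(1), of 0] t by simp
  then show "moment_le M p (K powr p * 3 powr p * (1 + mf_const) * (a powr (- real 0 / 2)) powr p) (\<lambda>\<omega>. R (MF (dt 0) 0 j ?i \<omega>))"
    using a1 P.moment_le_R[OF P.mf_moment[OF dt_pos, of ?i 0]] by simp
  show "expectation (\<lambda>\<omega>. R (MF (dt 0) 0 j ?i \<omega>)) = mbar 0 ?i" by (rule mbar_eq[OF _ I]) simp
qed (use consts_nonneg in auto)

text \<open>Since n dt l / dt k = n / a^(l-k), the floors in the multilevel mean select the last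
  grid point of level k not after the current time.\<close>

lemma level_index:
  assumes "k \<le> l"
  shows "nat \<lfloor>real n / a ^ (l - k)\<rfloor> = grid_index (dt k) (real n * dt l)"
proof -
  have "a ^ l = a ^ (l - k) * a ^ k" using assms by (simp flip: power_add)
  then have "real n * dt l / dt k = real n / a ^ (l - k)"
    using h0 a1 by (simp add: time_step_def field_simps)
  then show ?thesis by (simp add: grid_index_def)
qed

lemma ml_mean_index:
  "ml_mean R a J Y Y' l n \<omega> = ens_mean R (J 0) (\<lambda>j. Y 0 j (grid_index (dt 0) (real n * dt l)) \<omega>) +
     (\<Sum>k = 1..l. ens_mean R (J k) (\<lambda>j. Y k j (grid_index (dt k) (real n * dt l)) \<omega>) -
        ens_mean R (J k) (\<lambda>j. Y' k j (grid_index (dt (k - 1)) (real n * dt l)) \<omega>))"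
proof -
  have 0: "nat \<lfloor>real n / a ^ l\<rfloor> = grid_index (dt 0) (real n * dt l)" using level_index[of 0 l n] by simp
  have 1: "nat \<lfloor>real n / a ^ (l - k)\<rfloor> = grid_index (dt k) (real n * dt l)"
     "nat \<lfloor>real n / a ^ (l - k + 1)\<rfloor> = grid_index (dt (k - 1)) (real n * dt l)" if "k \<in> {1..l}" for k
  proof -
    have "l - k + 1 = l - (k - 1)" using that by auto
    then show "nat \<lfloor>real n / a ^ (l - k)\<rfloor> = grid_index (dt k) (real n * dt l)"
     "nat \<lfloor>real n / a ^ (l - k + 1)\<rfloor> = grid_index (dt (k - 1)) (real n * dt l)"
      using level_index[of k l n] level_index[of "k - 1" l n] that by auto
  qed
  show ?thesis unfolding ml_mean_def using 0 1 by (intro arg_cong2[where f="(+)"] sum.cong) auto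
qed

lemma grid_index_own: "grid_index (dt l) (real n * dt l) = n"
  using dt_pos[of l] by (simp add: grid_index_def)

abbreviation "MFf l j n \<equiv> MF (dt l) l j n"
abbreviation "MFc l j n \<equiv> MF (dt (l - 1)) l j n"

text \<open>The error splits into centred level terms, because the subtracted expectations telescope
  from \<open>mbar 0\<close> to \<open>mbar l\<close>. Minkowski's inequality then leaves the
  geometric sum of \<open>err\<close>.\<close>

lemma stat_error:
  assumes l: "l \<le> L" and n: "real n * dt l \<le> T"
  shows "moment_le M p ((stat_const * geom_const * err l) powr p)
     (\<lambda>\<omega>. ml_mean R a J MFf MFc l n \<omega> - mbar l n)"
proof -
  define t where "t = real n * dt l"
  have t: "0 \<le> t" "t \<le> T" using n dt_pos[of l] by (auto simp: t_def)
  define f where "f k \<omega> = (if k = 0 then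
      ens_mean R (J 0) (\<lambda>j. MFf 0 j (grid_index (dt 0) t) \<omega>) - mbar 0 (grid_index (dt 0) t)
    else (ens_mean R (J k) (\<lambda>j. MFf k j (grid_index (dt k) t) \<omega>)
        - ens_mean R (J k) (\<lambda>j. MFc k j (grid_index (dt (k - 1)) t) \<omega>))
        - (mbar k (grid_index (dt k) t) - mbar (k - 1) (grid_index (dt (k - 1)) t)))" for k \<omega>
  have "moment_le M p ((stat_const * err k) powr p) (f k)" if "k \<le> l" for k
    using stat_error_coarse[OF t] stat_error_fine[OF _ t, of k] that l
    unfolding f_def by (cases "k = 0") auto
  then have "moment_le M p ((\<Sum>k\<le>l. stat_const * err k) powr p) (\<lambda>\<omega>. \<Sum>k\<le>l. f k \<omega>)"
    using p1 mult_nonneg_nonneg[OF stat_const_nonneg less_imp_le[OF err_pos]] by (intro moment_le_sum) auto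
  also have "(\<lambda>\<omega>. \<Sum>k\<le>l. f k \<omega>) = (\<lambda>\<omega>. ml_mean R a J MFf MFc l n \<omega> - mbar l n)"
  proof
    fix \<omega>
    let ?m = "\<lambda>k. mbar k (grid_index (dt k) t)"
    have split: "(\<Sum>k\<le>l. g k) = g 0 + (\<Sum>k = 1..l. g k)" for g :: "nat \<Rightarrow> real ^ 'r"
      by (simp add: atMost_atLeast0 sum.atLeast_Suc_atMost)
    have tele: "(\<Sum>k = 1..l. ?m k - ?m (k - 1)) = ?m l - ?m 0"
      using sum_telescope''[of 0 l ?m] by simp
    have own: "?m l = mbar l n" unfolding t_def grid_index_own ..
    show "(\<Sum>k\<le>l. f k \<omega>) = ml_mean R a J MFf MFc l n \<omega> - mbar l n"
      unfolding split ml_mean_index t_def[symmetric] own[symmetric]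
      using tele by (simp add: f_def sum_subtractf sum.distrib algebra_simps)
  qed
  finally show ?thesis
  proof (rule moment_le_mono)
    have "(\<Sum>k\<le>l. stat_const * err k) \<le> stat_const * (geom_const * err l)"
      unfolding sum_distrib_left[symmetric] by (intro mult_left_mono sum_err_le l stat_const_nonneg)
    then show "(\<Sum>k\<le>l. stat_const * err k) powr p \<le> (stat_const * geom_const * err l) powr p"
      using p1 mult_nonneg_nonneg[OF stat_const_nonneg less_imp_le[OF err_pos]]
      by (intro powr_mono2 sum_nonneg) (auto simp: mult.assoc)
  qed
qed

text \<open>
  Fine particles of level \<open>l\<close> and coarse particles of level \<open>l + 1\<close> obey the same recursion and are
  treated alike: \<open>host\<close> is the level whose noise drives them.
\<close>

definition host :: "bool \<Rightarrow> nat \<Rightarrow> nat" where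
  "host coarse l = (if coarse then Suc l else l)"

definition Z :: "bool \<Rightarrow> nat \<Rightarrow> nat \<Rightarrow> nat \<Rightarrow> 'w \<Rightarrow> real ^ 'd" where
  "Z coarse l = (if coarse then X' (Suc l) else X l)"

abbreviation "Zbar c l j \<equiv> MF (dt l) (host c l) j"

lemma host_simps [simp]: "host True l = Suc l" "host False l = l" "Z True l = X' (Suc l)" "Z False l = X l"
  by (auto simp: host_def Z_def)

lemma le_host: "l \<le> host c l" by (simp add: host_def)

section \<open>Adaptedness of the scheme\<close>

lemma scheme_step:
  assumes "host c l \<le> L" "j \<in> {1..J (host c l)}" "\<omega> \<in> space M"
  shows "Z c l j 0 \<omega> = \<xi> (host c l) j \<omega>"
    "Z c l j (Suc n) \<omega> = euler_step b \<sigma> (dt l) (W (host c l) j) n \<omega> (ml_mean R a J X X' l n \<omega>) (Z c l j n \<omega>)"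
proof -
  have "c \<Longrightarrow> Suc l \<in> {1..L}" using assms by auto
  then show "Z c l j 0 \<omega> = \<xi> (host c l) j \<omega>"
    "Z c l j (Suc n) \<omega> = euler_step b \<sigma> (dt l) (W (host c l) j) n \<omega> (ml_mean R a J X X' l n \<omega>) (Z c l j n \<omega>)"
    using scheme assms unfolding ml_scheme_def by (cases c; fastforce)+
qed

lemma filtration_mono: "f \<in> borel_measurable (\<F> s) \<Longrightarrow> s \<le> t \<Longrightarrow> f \<in> borel_measurable (\<F> t)"
  using particle.axioms(2)[OF particleI, THEN driven.measurable_F_mono, of 0 1] J_ge(2)[of 0] by auto

lemma filtration_M: "f \<in> borel_measurable (\<F> s) \<Longrightarrow> f \<in> borel_measurable M"
  using particle.axioms(2)[OF particleI, THEN driven.measurable_F_M, of 0 1] J_ge(2)[of 0] by auto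

lemma ml_mean_measurable:
  assumes Z: "\<And>c k j. host c k \<le> l \<Longrightarrow> j \<in> {1..J (host c k)} \<Longrightarrow>
        Z c k j (grid_index (dt k) (real n * dt l)) \<in> borel_measurable (\<F> (real (grid_index (dt k) (real n * dt l)) * dt k))"
  shows "(\<lambda>\<omega>. ml_mean R a J X X' l n \<omega>) \<in> borel_measurable (\<F> (real n * dt l))"
proof -
  have t: "0 \<le> real n * dt l" using dt_pos[of l] by simp
  have Z1: "Z c k j (grid_index (dt k) (real n * dt l)) \<in> borel_measurable (\<F> (real n * dt l))"
    if "host c k \<le> l" "j \<in> {1..J (host c k)}" for c k j
    by (rule filtration_mono[OF Z[OF that] grid_index_bounds(1)[OF dt_pos t]])
  have X: "X k j (grid_index (dt k) (real n * dt l)) \<in> borel_measurable (\<F> (real n * dt l))"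
    if "k \<le> l" "j \<in> {1..J k}" for k j
    using Z1[of False k j] that by simp
  have X': "X' k j (grid_index (dt (k - 1)) (real n * dt l)) \<in> borel_measurable (\<F> (real n * dt l))"
    if "k \<in> {1..l}" "j \<in> {1..J k}" for k j
    using Z1[of True "k - 1" j] that by (cases k) auto
  show ?thesis unfolding ml_mean_index ens_mean_def
    by (intro borel_measurable_add borel_measurable_sum borel_measurable_diff borel_measurable_scaleR
        borel_measurable_const measurable_R X X') auto
qed

lemma euler_measurable:
  assumes "(l', j) \<in> I" "0 < h"
    and y: "y \<in> borel_measurable (\<F> (real n * h))" and x: "x \<in> borel_measurable (\<F> (real n * h))"
    and eq: "\<And>\<omega>. \<omega> \<in> space M \<Longrightarrow> x' \<omega> = euler_step b \<sigma> h (W l' j) n \<omega> (y \<omega>) (x \<omega>)"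
  shows "x' \<in> borel_measurable (\<F> (real (Suc n) * h))"
proof -
  have le: "real n * h \<le> real (Suc n) * h" using assms by simp
  have "(\<lambda>\<omega>. euler_step b \<sigma> h (W l' j) n \<omega> (y \<omega>) (x \<omega>)) \<in> borel_measurable (\<F> (real (Suc n) * h))"
    unfolding euler_step_def using assms(1,2) le
    by (intro borel_measurable_add borel_measurable_scaleR borel_measurable_const
        borel_measurable_matrix_vector measurable_b measurable_\<sigma> filtration_mono[OF y] filtration_mono[OF x]
        noise_filtration_incr) auto
  then show ?thesis by (subst measurable_cong[OF eq]) auto
qed

text \<open>Lexicographic induction on level and time. The interaction term at (l, n) involves
  particles run with coarser steps \<open>dt k\<close>, k < l, at earlier or equal times, and those
  with step \<open>dt l\<close> only through the fine ensemble at index n.\<close>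

lemma scheme_adapted:
  "host c l \<le> L \<Longrightarrow> j \<in> {1..J (host c l)} \<Longrightarrow> Z c l j n \<in> borel_measurable (\<F> (real n * dt l))"
proof (induction l arbitrary: c j n rule: less_induct)
  case (less l)
  note outer = less.IH
  show ?case using less.prems
  proof (induction n arbitrary: c j)
    case 0
    have "\<xi> (host c l) j \<in> borel_measurable (\<F> 0)" using 0 by (intro noise_filtration_initial) auto
    then show ?case using scheme_step(1)[OF 0] by (subst measurable_cong[of _ _ "\<xi> (host c l) j"]) auto
  next
    case (Suc n)
    have "(\<lambda>\<omega>. ml_mean R a J X X' l n \<omega>) \<in> borel_measurable (\<F> (real n * dt l))"
    proof (rule ml_mean_measurable)
      fix c' k j' assume k: "host c' k \<le> l" "j' \<in> {1..J (host c' k)}"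
      then have "k \<le> l" "host c' k \<le> L" using le_host[of k c'] le_host[of l c] Suc.prems by auto
      then show "Z c' k j' (grid_index (dt k) (real n * dt l)) \<in> borel_measurable (\<F> (real (grid_index (dt k) (real n * dt l)) * dt k))"
        using outer[of k c' j'] Suc.IH[of c' j'] k by (cases "k = l") (auto simp: grid_index_own)
    qed
    then show ?case
      using Suc by (intro euler_measurable[OF _ dt_pos _ _ scheme_step(2)]) auto
  qed
qed

lemmas scheme_measurable = filtration_M[OF scheme_adapted]

lemma Zbar_measurable:
  "host c l \<le> L \<Longrightarrow> j \<in> {1..J (host c l)} \<Longrightarrow> Zbar c l j n \<in> borel_measurable M"
  by (rule particle.mf_M[OF particleI dt_pos]) auto

lemma ml_mean_adapted:
  assumes "l \<le> L"
  shows "(\<lambda>\<omega>. ml_mean R a J X X' l n \<omega>) \<in> borel_measurable (\<F> (real n * dt l))"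
  using scheme_adapted assms by (intro ml_mean_measurable) auto

section \<open>Interaction error and the bound on all levels\<close>

lemma ens_mean_error:
  assumes "1 \<le> N" "0 \<le> c"
    and Y: "\<And>j. j \<in> {1..N} \<Longrightarrow> moment_le M p (c powr p) (\<lambda>\<omega>. Y j \<omega> - Y' j \<omega>)"
    and meas: "\<And>j. j \<in> {1..N} \<Longrightarrow> Y j \<in> borel_measurable M" "\<And>j. j \<in> {1..N} \<Longrightarrow> Y' j \<in> borel_measurable M"
  shows "moment_le M p ((K * c) powr p) (\<lambda>\<omega>. ens_mean R N (\<lambda>j. Y j \<omega>) - ens_mean R N (\<lambda>j. Y' j \<omega>))"
proof -
  have "moment_le M p ((1 / real N * (K * c)) powr p) (\<lambda>\<omega>. (1 / real N) *\<^sub>R (R (Y j \<omega>) - R (Y' j \<omega>)))"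
    if j: "j \<in> {1..N}" for j
    unfolding powr_mult[of "1 / real N"] powr_mult[of K]
    using moment_le_R_diff[OF Y[OF j] meas(1)[OF j] meas(2)[OF j]]
    by (rule moment_le_scaled)
      (use meas[OF j] p1 in \<open>auto intro!: borel_measurable_scaleR borel_measurable_diff measurable_R\<close>)
  \<comment> \<open>Only Minkowski is used: the particles of the scheme are coupled by the
    interaction, so averaging is not credited with any gain, and N terms of weight 1/N add up to the
    error of one particle.\<close>
  then have "moment_le M p ((\<Sum>j = 1..N. 1 / real N * (K * c)) powr p)
      (\<lambda>\<omega>. \<Sum>j = 1..N. (1 / real N) *\<^sub>R (R (Y j \<omega>) - R (Y' j \<omega>)))"
    using p1 K0 assms(2) by (intro moment_le_sum) auto
  then show ?thesis using assms(1)
    by (simp add: ens_mean_def sum_subtractf scaleR_diff_right scaleR_sum_right)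
qed

text \<open>Ensemble k contributes the error of its fine particles, of size \<open>err k\<close>,
  and for k \<ge> 1 that of its coarse ones, of size \<open>err (k - 1)\<close>. Each of the two
  sums is dominated by \<open>geom_const * err l\<close>, whence the factor 2.\<close>

lemma interaction_error:
  assumes l: "l \<le> L" and c: "0 \<le> c" and t_def: "t = real n * dt l"
    and Z: "\<And>d k j. host d k \<le> l \<Longrightarrow> j \<in> {1..J (host d k)} \<Longrightarrow>
        moment_le M p ((c * err k) powr p) (\<lambda>\<omega>. Z d k j (grid_index (dt k) t) \<omega> - Zbar d k j (grid_index (dt k) t) \<omega>)"
  shows "moment_le M p ((2 * K * geom_const * c * err l) powr p)
     (\<lambda>\<omega>. ml_mean R a J X X' l n \<omega> - ml_mean R a J MFf MFc l n \<omega>)"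
proof -
  have ce: "0 \<le> c * err k" for k by (rule mult_nonneg_nonneg[OF c less_imp_le[OF err_pos]])
  note Kce = mult_nonneg_nonneg[OF K0 ce]
  define f where "f d k \<omega> = ens_mean R (J (host d k)) (\<lambda>j. Z d k j (grid_index (dt k) t) \<omega>)
     - ens_mean R (J (host d k)) (\<lambda>j. Zbar d k j (grid_index (dt k) t) \<omega>)" for d k \<omega>
  have f: "moment_le M p ((K * (c * err k)) powr p) (f d k)" if "host d k \<le> l" for d k
    unfolding f_def using that l by (intro ens_mean_error Z J_ge(2) ce scheme_measurable Zbar_measurable) auto
  have F: "moment_le M p ((\<Sum>k\<le>l. K * (c * err k)) powr p) (\<lambda>\<omega>. \<Sum>k\<le>l. f False k \<omega>)"
    using p1 Kce f[of False] by (intro moment_le_sum) auto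
  have G: "moment_le M p ((\<Sum>k<l. K * (c * err k)) powr p) (\<lambda>\<omega>. \<Sum>k<l. f True k \<omega>)"
    using p1 Kce f[of True] by (intro moment_le_sum) auto
  have G': "moment_le M p ((\<Sum>k<l. K * (c * err k)) powr p) (\<lambda>\<omega>. - (\<Sum>k<l. f True k \<omega>))"
    by (rule moment_le_dom[OF G]) (use moment_leD(1)[OF G] p1 in auto)
  have "moment_le M p (((\<Sum>k\<le>l. K * (c * err k)) + (\<Sum>k<l. K * (c * err k))) powr p)
      (\<lambda>\<omega>. (\<Sum>k\<le>l. f False k \<omega>) + - (\<Sum>k<l. f True k \<omega>))"
    by (intro moment_le_add2 F G' p1 sum_nonneg Kce)
  also have "(\<lambda>\<omega>. (\<Sum>k\<le>l. f False k \<omega>) + - (\<Sum>k<l. f True k \<omega>))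
      = (\<lambda>\<omega>. ml_mean R a J X X' l n \<omega> - ml_mean R a J MFf MFc l n \<omega>)"
  proof
    fix \<omega>
    have split: "(\<Sum>k\<le>l. g k) = g 0 + (\<Sum>k = 1..l. g k)" for g :: "nat \<Rightarrow> real ^ 'r"
      by (simp add: atMost_atLeast0 sum.atLeast_Suc_atMost)
    have shift: "(\<Sum>k<l. g (Suc k)) = (\<Sum>k = 1..l. g k)" for g :: "nat \<Rightarrow> real ^ 'r"
      by (simp add: sum.atLeast1_atMost_eq)
    have "(\<Sum>k<l. f True k \<omega>) = (\<Sum>k = 1..l. ens_mean R (J k) (\<lambda>j. X' k j (grid_index (dt (k - 1)) t) \<omega>)
     - ens_mean R (J k) (\<lambda>j. MFc k j (grid_index (dt (k - 1)) t) \<omega>))"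
      unfolding shift[symmetric] f_def by simp
    then show "(\<Sum>k\<le>l. f False k \<omega>) + - (\<Sum>k<l. f True k \<omega>) = ml_mean R a J X X' l n \<omega> - ml_mean R a J MFf MFc l n \<omega>"
      unfolding split ml_mean_index t_def[symmetric] f_def by (simp add: sum_subtractf algebra_simps)
  qed
  finally show ?thesis
  proof (rule moment_le_mono)
    have "(\<Sum>k<l. K * (c * err k)) \<le> (\<Sum>k\<le>l. K * (c * err k))"
      using Kce by (intro sum_mono2) auto
    moreover have "(\<Sum>k\<le>l. K * (c * err k)) \<le> K * (c * (geom_const * err l))"
      unfolding sum_distrib_left[symmetric] by (intro mult_left_mono sum_err_le l K0 c)
    moreover have "2 * K * geom_const * c * err l = K * (c * (geom_const * err l)) + K * (c * (geom_const * err l))"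
      by (simp add: field_simps)
    ultimately have "(\<Sum>k\<le>l. K * (c * err k)) + (\<Sum>k<l. K * (c * err k)) \<le> 2 * K * geom_const * c * err l"
      by linarith
    then show "((\<Sum>k\<le>l. K * (c * err k)) + (\<Sum>k<l. K * (c * err k))) powr p \<le> (2 * K * geom_const * c * err l) powr p"
      using p1 Kce by (intro powr_mono2 add_nonneg_nonneg sum_nonneg) auto
  qed
qed

text \<open>The ansatz of the induction: the p-th power of the target size, times an exponential in
  physical time and not in the index, so that bounds of different levels can be compared.\<close>

definition level_bound :: "nat \<Rightarrow> nat \<Rightarrow> real" where
  "level_bound l n = (base_const * err l) powr p * exp (rate_const * (real n * dt l))"

lemma level_bound_eq:
  "level_bound l n = (base_const * exp (rate_const * (real n * dt l) / p) * err l) powr p"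
proof -
  have "exp (rate_const * (real n * dt l)) = exp (rate_const * (real n * dt l) / p) powr p"
    using p1 by (simp add: powr_def)
  then show ?thesis unfolding level_bound_def by (simp only: powr_mult mult_ac)
qed

text \<open>The ansatz is a supersolution of the error recursion: through \<open>rate_const\<close>
  the terms proportional to \<open>level_bound\<close> become increments of the exponential, and by
  the choice of \<open>base_const\<close> the statistical term over [0, T] is the value of the
  ansatz at time 0.\<close>

lemma level_bound_sum:
  "\<kappa> * (2 * (K powr p * 2 powr p)) * (\<Sum>k<n. dt l * (level_bound l k +
      2 powr p * ((2 * K * geom_const * (base_const * exp (rate_const * (real k * dt l) / p)) * err l) powr p
        + (stat_const * geom_const * err l) powr p))) \<le> level_bound l n"
  if n: "real n * dt l \<le> T"
proof -
  define e where "e k = exp (rate_const * (real k * dt l))" for k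
  define u where "u = (base_const * err l) powr p"
  define w where "w = 2 powr p * (stat_const * geom_const * err l) powr p"
  define c where "c = \<kappa> * (2 * (K powr p * 2 powr p))"
  have c0: "0 \<le> c" using \<kappa>0 by (simp add: c_def)
  have summand: "level_bound l k + 2 powr p * ((2 * K * geom_const * (base_const * exp (rate_const * (real k * dt l) / p)) * err l) powr p
        + (stat_const * geom_const * err l) powr p) = (1 + 2 powr p * (2 * K * geom_const) powr p) * (u * e k) + w" for k
  proof -
    have "2 * K * geom_const * (base_const * exp (rate_const * (real k * dt l) / p)) * err l =
      (2 * K * geom_const) * (base_const * exp (rate_const * (real k * dt l) / p) * err l)" by (simp add: mult_ac)
    then have "(2 * K * geom_const * (base_const * exp (rate_const * (real k * dt l) / p)) * err l) powr p
      = (2 * K * geom_const) powr p * level_bound l k"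
      unfolding level_bound_eq by (simp only: powr_mult)
    moreover have "level_bound l k = u * e k" by (simp add: level_bound_def u_def e_def)
    ultimately show ?thesis by (simp add: w_def algebra_simps)
  qed
  have "c * (\<Sum>k<n. dt l * ((1 + 2 powr p * (2 * K * geom_const) powr p) * (u * e k) + w))
     = u * (\<Sum>k<n. rate_const * dt l * e k) + c * w * (real n * dt l)"
    unfolding rate_const_def c_def by (simp add: algebra_simps sum.distrib sum_distrib_left)
  also have "\<dots> \<le> u * (e n - e 0) + c * w * T"
  proof (intro add_mono mult_left_mono n)
    have "rate_const * dt l * e k \<le> e (Suc k) - e k" for k
    proof -
      have "(1 + rate_const * dt l) * e k \<le> exp (rate_const * dt l) * e k"
        unfolding e_def by (intro mult_right_mono exp_ge_add_one_self) auto
      also have "\<dots> = e (Suc k)" by (simp add: e_def algebra_simps exp_add)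
      finally show ?thesis by (simp add: algebra_simps)
    qed
    then have "(\<Sum>k<n. rate_const * dt l * e k) \<le> (\<Sum>k<n. e (Suc k) - e k)" by (intro sum_mono)
    then show "(\<Sum>k<n. rate_const * dt l * e k) \<le> e n - e 0" by (simp only: sum_lessThan_telescope)
    show "0 \<le> u" by (simp add: u_def)
    show "0 \<le> c * w" using c0 by (simp add: w_def)
  qed
  also have "c * w * T = u"
    unfolding u_def w_def c_def powr_mult[of _ "err l"] base_const_powr by (simp add: mult_ac)
  also have "u * (e n - e 0) + u = level_bound l n"
    by (simp add: level_bound_def u_def e_def algebra_simps)
  finally show ?thesis unfolding summand c_def[symmetric] .
qed

lemma level_bound_mono:
  assumes "k \<le> l" "real i * dt k \<le> real n * dt l"
  shows "level_bound k i \<le> (base_const * exp (rate_const * (real n * dt l) / p) * err k) powr p"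
  unfolding level_bound_eq using assms p1 base_const_nonneg err_pos[of k] rate_const_nonneg
    mult_nonneg_nonneg[OF mult_nonneg_nonneg[OF base_const_nonneg exp_ge_zero] less_imp_le[OF err_pos]]
  by (intro powr_mono2 mult_right_mono mult_left_mono iffD2[OF exp_le_cancel_iff] divide_right_mono) auto

text \<open>Fine particles of level l and coarse ones of level l + 1 are carried through one
  induction, because the interaction term contains both kinds. The explicit recursion calls only for
  the same step size at smaller indices and for coarser step sizes at times up to T.\<close>

lemma level_errors:
  "host c l \<le> L \<Longrightarrow> j \<in> {1..J (host c l)} \<Longrightarrow> real n * dt l \<le> T \<Longrightarrow>
    moment_le M p (level_bound l n) (running_max (\<lambda>m \<omega>. Z c l j m \<omega> - Zbar c l j m \<omega>) n)"
proof (induction l arbitrary: c j n rule: less_induct)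
  case (less l)
  note outer = less.IH
  show ?case using less.prems
  proof (induction n arbitrary: c j rule: less_induct)
    case (less n)
    note host = less.prems(1) and j = less.prems(2) and n = less.prems(3)
    have l: "l \<le> L" using le_host[of l c] host by simp
    have kT: "real k * dt l \<le> T" if "k < n" for k
      using n mult_right_mono[of "real k" "real n" "dt l"] that dt_pos[of l] by linarith
    \<comment> \<open>Both induction hypotheses in one statement, with the running maximum weakened
      to its last entry.\<close>
    have prev: "moment_le M p (level_bound i m) (\<lambda>\<omega>. Z d i j' m \<omega> - Zbar d i j' m \<omega>)"
      if "i < l \<and> real m * dt i \<le> T \<or> i = l \<and> m < n" "host d i \<le> L" "j' \<in> {1..J (host d i)}" for d i j' m
    proof (rule moment_le_dom)
      show "moment_le M p (level_bound i m) (running_max (\<lambda>m \<omega>. Z d i j' m \<omega> - Zbar d i j' m \<omega>) m)"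
        using that outer[of i d j' m] less.IH[of m d j'] kT[of m] by auto
      show "(\<lambda>\<omega>. Z d i j' m \<omega> - Zbar d i j' m \<omega>) \<in> borel_measurable M"
        using that by (intro borel_measurable_diff scheme_measurable Zbar_measurable) auto
    qed (use p1 running_max_ge[of m m "\<lambda>m \<omega>. Z d i j' m \<omega> - Zbar d i j' m \<omega>"] in auto)
    define v where "v k = 2 powr p * ((2 * K * geom_const * (base_const * exp (rate_const * (real k * dt l) / p)) * err l) powr p
        + (stat_const * geom_const * err l) powr p)" for k
    have mean: "moment_le M p (v k) (\<lambda>\<omega>. ml_mean R a J X X' l k \<omega> - mbar l k)" if k: "k < n" for k
    proof -
      define t where "t = real k * dt l"
      have t: "0 \<le> t" "t \<le> T" using kT[OF k] dt_pos[of l] by (auto simp: t_def)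
      have "moment_le M p ((2 * K * geom_const * (base_const * exp (rate_const * (real k * dt l) / p)) * err l) powr p)
         (\<lambda>\<omega>. ml_mean R a J X X' l k \<omega> - ml_mean R a J MFf MFc l k \<omega>)"
      proof (rule interaction_error[OF l _ t_def])
        show "0 \<le> base_const * exp (rate_const * (real k * dt l) / p)" using base_const_nonneg by simp
        fix d i j' assume i: "host d i \<le> l" "j' \<in> {1..J (host d i)}"
        have gi: "real (grid_index (dt i) t) * dt i \<le> t" by (rule grid_index_bounds(1)[OF dt_pos t(1)])
        have il: "i \<le> l" using le_host[of i d] i by simp
        \<comment> \<open>For i = l the grid index is k itself, which is below n.\<close>
        have "i < l \<and> real (grid_index (dt i) t) * dt i \<le> T \<or> i = l \<and> grid_index (dt i) t < n"
          using il gi t k grid_index_own[of l k] by (cases "i = l") (auto simp: t_def)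
        moreover have "level_bound i (grid_index (dt i) t) \<le> (base_const * exp (rate_const * (real k * dt l) / p) * err i) powr p"
          using gi unfolding t_def by (intro level_bound_mono il)
        ultimately show "moment_le M p ((base_const * exp (rate_const * (real k * dt l) / p) * err i) powr p)
            (\<lambda>\<omega>. Z d i j' (grid_index (dt i) t) \<omega> - Zbar d i j' (grid_index (dt i) t) \<omega>)"
          using prev[of i "grid_index (dt i) t" d j'] i l by (blast intro: moment_le_mono order_trans)
      qed
      from moment_le_add[OF p1 this stat_error[OF l kT[OF k]]] show ?thesis by (simp add: v_def)
    qed
    have I: "(host c l, j) \<in> I" using j host by auto
    interpret P: particle b \<sigma> R p T h0 K m0 \<kappa> \<gamma> M \<F> "W (host c l) j" "\<xi> (host c l) j" by (rule particleI[OF I])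
    have mm: "P.mf_mean (dt l) k = mbar l k" for k unfolding P.mf_mean_def by (rule mbar_eq[OF l I])
    have "moment_le M p (level_bound l k) (\<lambda>\<omega>. Z c l j k \<omega> - P.mf (dt l) k \<omega>)" if "k < n" for k
      using prev[of l k c j] that host j by simp
    note scheme = P.scheme_error[OF dt_pos n scheme_step(1)[OF host j] scheme_step(2)[OF host j]
        scheme_adapted[OF host j] ml_mean_adapted[OF l] this mean[folded mm]]
    have "\<kappa> * (2 * (K powr p * 2 powr p)) * (\<Sum>k<n. dt l * (level_bound l k + v k)) \<le> level_bound l n"
      unfolding v_def by (rule level_bound_sum[OF n])
    from moment_le_mono[OF scheme this] show ?case by simp
  qed
qed

end

section \<open>From moment bounds to the errors of the theorem\<close>

lemma max_error_le:
  assumes p: "0 \<le> p" and Y: "moment_le M p v (running_max (\<lambda>m \<omega>. Y m \<omega> - Z m \<omega>) n)"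
  shows "max_error M p Y Z n \<le> ennreal v"
proof -
  let ?r = "running_max (\<lambda>m \<omega>. Y m \<omega> - Z m \<omega>) n"
  have "max_error M p Y Z n \<le> (\<integral>\<^sup>+ \<omega>. ennreal (norm (?r \<omega>) powr p) \<partial>M)"
    unfolding max_error_def
  proof (intro nn_integral_mono ennreal_leI)
    fix \<omega>
    have "norm (Y m \<omega> - Z m \<omega>) powr p \<le> norm (?r \<omega>) powr p" if "m \<le> n" for m
      using running_max_ge[OF that, of "\<lambda>m \<omega>. Y m \<omega> - Z m \<omega>" \<omega>] p by (intro powr_mono2) auto
    then show "Max ((\<lambda>m. norm (Y m \<omega> - Z m \<omega>) powr p) ` {..n}) \<le> norm (?r \<omega>) powr p"
      by (subst Max_le_iff) auto
  qed
  also have "\<dots> = ennreal (\<integral>\<omega>. norm (?r \<omega>) powr p \<partial>M)"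
    using moment_leD(2)[OF Y] by (intro nn_integral_eq_integral) auto
  also have "\<dots> \<le> ennreal v" using moment_leD(3)[OF Y] by (rule ennreal_leI)
  finally show ?thesis .
qed

theorem theorem1:
  fixes p T dt0 a q C\<^sub>J L\<^sub>b L\<^sub>\<sigma> L\<^sub>R :: real
    and b :: "real ^ 'd \<Rightarrow> real ^ 'r \<Rightarrow> real ^ 'd"
    and \<sigma> :: "real ^ 'd \<Rightarrow> real ^ 'r \<Rightarrow> real ^ 'm ^ 'd"
    and R :: "real ^ 'd \<Rightarrow> real ^ 'r"
    and \<rho>0 :: "(real ^ 'd) measure"
  assumes "p \<ge> 2" and "T > 0" and "dt0 > 0" and "a > 1" and "q > 1" and "C\<^sub>J \<ge> 1"
    and b_lipschitz: "\<And>x x' y y'. norm (b x y - b x' y') \<le> L\<^sub>b * (norm (x - x') + norm (y - y'))"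
    and \<sigma>_lipschitz: "\<And>x x' y y'. norm (\<sigma> x y - \<sigma> x' y') \<le> L\<^sub>\<sigma> * (norm (x - x') + norm (y - y'))"
    and R_lipschitz: "\<And>x x'. norm (R x - R x') \<le> L\<^sub>R * norm (x - x')"
    and "prob_space \<rho>0" and "sets \<rho>0 = sets borel"
    and moment: "integrable \<rho>0 (\<lambda>x. norm x powr p)"
  shows "\<exists>C :: real. \<forall>\<epsilon>. 0 < \<epsilon> \<and> \<epsilon> \<le> a powr (- 1 / 2) \<longrightarrow>
    (let L = num_levels a \<epsilon>; J = num_samples C\<^sub>J q a L in
      \<forall>(M :: 'w measure) \<xi> (W :: nat \<Rightarrow> nat \<Rightarrow> real \<Rightarrow> 'w \<Rightarrow> real ^ 'm) X X' js.
        prob_space M \<and>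
        driving_noise M \<rho>0 (SIGMA l:{..L}. {1..J l}) \<xi> W \<and>
        ml_scheme M b \<sigma> R a dt0 L J \<xi> W X X' \<and>
        (\<forall>l\<le>L. js l \<in> {1..J l}) \<longrightarrow>
        (\<forall>l\<le>L. \<forall>n. real n * time_step a dt0 l \<le> T \<longrightarrow>
          (let E = level_error M p b \<sigma> R a dt0 L \<xi> W X X' js l n in
            E < \<infinity> \<and> enn2real E powr (1 / p) \<le> C * \<epsilon> / q ^ (L - l))))"
proof -
  \<comment> \<open>The norms at the origin are included for the growth bounds; they also make K
    nonnegative whatever the signs of the given Lipschitz constants.\<close>
  define K where "K = Max {L\<^sub>b, L\<^sub>\<sigma>, L\<^sub>R, norm (b 0 0), norm (\<sigma> 0 0), norm (R 0)}"
  have K: "L\<^sub>b \<le> K" "L\<^sub>\<sigma> \<le> K" "L\<^sub>R \<le> K" "norm (b 0 0) \<le> K" "norm (\<sigma> 0 0) \<le> K" "norm (R 0) \<le> K"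
    unfolding K_def by (rule Max_ge; simp)+
  define m0 where "m0 = (\<integral>x. norm x powr p \<partial>\<rho>0)"
  define \<kappa> where "\<kappa> = ito_const CARD('m) p T"
  define \<gamma> where "\<gamma> = gauss_const CARD('m) p"
  \<comment> \<open>The constants are obtained before \<epsilon>, the probability space and the
    particles are introduced, which makes C independent of them.\<close>
  interpret C: ml_coeffs b \<sigma> R p T dt0 K m0 \<kappa> \<gamma> a q
  proof
    show "norm (b x y - b x' y') \<le> K * (norm (x - x') + norm (y - y'))" for x x' y y'
      using b_lipschitz[of x y x' y'] mult_right_mono[OF K(1), of "norm (x - x') + norm (y - y')"] by simp
    show "norm (\<sigma> x y - \<sigma> x' y') \<le> K * (norm (x - x') + norm (y - y'))" for x x' y y'
      using \<sigma>_lipschitz[of x y x' y'] mult_right_mono[OF K(2), of "norm (x - x') + norm (y - y')"] by simp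
    show "norm (R x - R x') \<le> K * norm (x - x')" for x x'
      using R_lipschitz[of x x'] mult_right_mono[OF K(3), of "norm (x - x')"] by simp
    show "0 \<le> m0" unfolding m0_def by (intro Bochner_Integration.integral_nonneg) simp
  qed (use assms K in \<open>auto simp: \<kappa>_def \<gamma>_def\<close>)
  \<comment> \<open>The p-th root of \<open>level_bound\<close> at the final time T, relative to
    \<epsilon> / q^(L-l).\<close>
  define C where "C = C.base_const * exp (C.rate_const * T / p)"
  have C0: "0 \<le> C" using C.base_const_nonneg by (simp add: C_def)
  show ?thesis
    unfolding Let_def
  proof (intro exI[of _ C] allI impI, elim conjE)
    fix \<epsilon> :: real and M :: "'w measure" and \<xi> and W :: "nat \<Rightarrow> nat \<Rightarrow> real \<Rightarrow> 'w \<Rightarrow> real ^ 'm" and X X' js l n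
    assume \<epsilon>: "0 < \<epsilon>" "\<epsilon> \<le> a powr (- 1 / 2)"
    define L where "L = num_levels a \<epsilon>"
    define J where "J = num_samples C\<^sub>J q a L"
    assume "prob_space M"
      and "driving_noise M \<rho>0 (SIGMA l:{..num_levels a \<epsilon>}. {1..num_samples C\<^sub>J q a (num_levels a \<epsilon>) l}) \<xi> W"
      and "ml_scheme M b \<sigma> R a dt0 (num_levels a \<epsilon>) (num_samples C\<^sub>J q a (num_levels a \<epsilon>)) \<xi> W X X'"
      and "\<forall>l\<le>num_levels a \<epsilon>. js l \<in> {1..num_samples C\<^sub>J q a (num_levels a \<epsilon>) l}"
      and "l \<le> num_levels a \<epsilon>" and n: "real n * time_step a dt0 l \<le> T"
    then have M: "prob_space M" and dn: "driving_noise M \<rho>0 (SIGMA l:{..L}. {1..J l}) \<xi> W"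
      and sc: "ml_scheme M b \<sigma> R a dt0 L J \<xi> W X X'" and js: "\<forall>l\<le>L. js l \<in> {1..J l}" and l: "l \<le> L"
      by (auto simp: L_def J_def)
    interpret prob_space M by (rule M)
    interpret S: ml_system b \<sigma> R p T dt0 K m0 \<kappa> \<gamma> a q M C\<^sub>J \<epsilon> \<rho>0 L J \<xi> W X X'
      by unfold_locales (use assms \<epsilon> dn sc in \<open>auto simp: L_def J_def m0_def\<close>)
    have p0: "0 \<le> p" using assms by simp
    define v where "v = S.level_bound l n"
    have errs: "moment_le M p v (running_max (\<lambda>m \<omega>. S.Z c l (js (S.host c l)) m \<omega> - S.Zbar c l (js (S.host c l)) m \<omega>) n)"
      if "S.host c l \<le> L" for c
      unfolding v_def using js that by (intro S.level_errors n) auto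
    define E where "E = level_error M p b \<sigma> R a dt0 L \<xi> W X X' js l n"
    have "E \<le> ennreal v"
      unfolding E_def level_error_def Let_def
    proof (rule max.boundedI)
      show "max_error M p (X l (js l)) (mean_field M b \<sigma> R (time_step a dt0 l) (\<xi> l (js l)) (W l (js l))) n \<le> ennreal v"
        using errs[of False] l by (intro max_error_le[OF p0]) simp
      show "(if l + 1 = L + 1 then 0 else max_error M p (X' (l + 1) (js (l + 1)))
         (mean_field M b \<sigma> R (time_step a dt0 (l + 1 - 1)) (\<xi> (l + 1) (js (l + 1))) (W (l + 1) (js (l + 1)))) n) \<le> ennreal v"
      \<comment> \<open>For l = L the coarse error is zero by convention; otherwise level l + 1
        hosts coarse particles that run with the step of level l.\<close>
      proof (cases "l = L")
        case False
        then show ?thesis using max_error_le[OF p0 errs[of True]] l by simp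
      qed simp
    qed
    have v0: "0 \<le> v" by (simp add: v_def S.level_bound_def)
    have "v \<le> (C * (\<epsilon> / q ^ (L - l))) powr p"
      unfolding v_def S.level_bound_eq C_def
      using n p0 C.base_const_nonneg C.rate_const_nonneg S.err_pos[of l]
        mult_nonneg_nonneg[OF mult_nonneg_nonneg[OF C.base_const_nonneg exp_ge_zero] less_imp_le[OF S.err_pos]]
      by (intro powr_mono2 mult_right_mono mult_left_mono iffD2[OF exp_le_cancel_iff] divide_right_mono) auto
    then have "v powr (1 / p) \<le> ((C * (\<epsilon> / q ^ (L - l))) powr p) powr (1 / p)"
      using v0 assms by (intro powr_mono2) auto
    also have "\<dots> = C * \<epsilon> / q ^ (L - l)"
      using assms C0 \<epsilon> by (simp add: powr_powr)
    finally have v_le: "v powr (1 / p) \<le> C * \<epsilon> / q ^ (L - l)" .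
    have fin: "E < \<infinity>" using \<open>E \<le> ennreal v\<close> by (metis ennreal_less_top infinity_ennreal_def order_le_less_trans)
    have "enn2real E \<le> v" using \<open>E \<le> ennreal v\<close> v0 by (simp add: enn2real_leI)
    then have "enn2real E powr (1 / p) \<le> v powr (1 / p)" using assms by (intro powr_mono2) auto
    then have "E < \<infinity> \<and> enn2real E powr (1 / p) \<le> C * \<epsilon> / q ^ (L - l)" using fin v_le by simp
    then show "level_error M p b \<sigma> R a dt0 (num_levels a \<epsilon>) \<xi> W X X' js l n < \<infinity> \<and>
       enn2real (level_error M p b \<sigma> R a dt0 (num_levels a \<epsilon>) \<xi> W X X' js l n) powr (1 / p)
         \<le> C * \<epsilon> / q ^ (num_levels a \<epsilon> - l)"
      unfolding E_def L_def .
  qed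
qed

end
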